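(* Let $\eta_0,\kappa_0,\kappa_\infty\in\mathbb{C}$ with $\eta_0\kappa_\infty\neq0$, and consider the Hamiltonian system $y_3'=\partial H/\partial z_3$, $z_3'=-\partial H/\partial y_3$ with Hamiltonian $$H(y_3,z_3;x)=\frac1x\Big(2y_3^2z_3^2+\kappa_\infty x\,y_3-z_3\big((2\kappa_0+1)y_3-2\eta_0x\big)\Big).$$ Let $q=q(x)$ be a solution of $(\mathrm{P}_{\mathrm{III}},D_7)$ with $\gamma=0$ and parameters $\alpha=-4\kappa_\infty$, $\beta=4\eta_0(\kappa_0+1)$, $\delta=-4\eta_0^2$. Applying to this system the transformation $(y_3,z_3)\mapsto(y,z)$ defined by $$y_3=z+q,\qquad z_3=yz+\frac{x(q'-2\eta_0)}{4q^2}+\frac{2\kappa_0+1}{4q}$$ gives rise to the system $$\begin{cases}\begin{aligned} y'&=2y\left(\frac{2\eta_0-q'}{q}-\frac{2y}{x}\left(q^2+3qz+2z^2\right)\right)-\left(\frac{2\kappa_0+1}{2\sqrt{x}\,q}-\frac{\sqrt{x}\,(2\eta_0-q')}{2q^2}\right)^{2}\\ &\quad+y\left(\frac{3z}{q}+2\right)\left(\frac{2\eta_0-q'}{q}-\frac{2\kappa_0+1}{x}\right),\end{aligned}\\[5ex] z'=\left(\dfrac{z^2}{q}+z\right)\left(\dfrac{4yq(q+z)}{x}+\dfrac{2\kappa_0+1}{x}\right)-\left(\dfrac{z^2}{q}+2z\right)\dfrac{2\eta_0-q'}{q},\end{cases}$$ and this system is Bureau-Guillot for $(\mathrm{P}_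{\mathrm{III}},D_7)$.
   Context: The independent variable is $x\in\mathbb{C}$ and $'=d/dx$. The third Painlevé equation is $y''=\frac{(y')^2}{y}-\frac{y'}{x}+\frac{\alpha y^2+\beta}{x}+\gamma y^3+\frac{\delta}{y}$; $(\mathrm{P}_{\mathrm{III}},D_7)$ is this equation with $\gamma=0$, $\alpha\delta\neq0$ (the version used here) or with $\delta=0$, $\beta\gamma\neq0$. The Hamiltonian system with coefficients rational in $x$ associated with $(\mathrm{P}_{\mathrm{III}},D_7)$, $\gamma=0$, is the one with the Hamiltonian $H$ in the claim (its component $y_3$ satisfies this equation with the stated parameters). Regularisation process. A system $y'=P(y,z;x)$, $z'=Q(y,z;x)$, with $P,Q$ rational in $(y,z)$ and coefficients depending on $x$, is extended to $\mathbb{P}^2$, covered by the affine charts $(y,z)$, $(u_0,v_0)$, $(U_0,V_0)$ with $[1:y:z]=[u_0:1:v_0]=[V_0:U_0:1]$. In each chart one looks for base points, i.e. points where the right-hand side of one of the (rational) equations becomes $0/0$. Each base point (in a chart $(y,z)$, at $(a,b)$) is blown up, by introducing the charts $u=y-a$, $v=\frac{z-b}{y-a}$ and $U=\frac{y-a}{z-b}$, $V=z-b$, with exceptional curve $\{u=0\}\cup\{V=0\}$; new base points on it are blown up again, which gives for each base point one or more finite sequences ("cascades") of blow-ups, until no indeterminacy is left in the final charts. The system is regularised if in every cascade it is regular on the last exceptional curve in one of the final charts. The regularising conditions are the (differential) constraints on the coefficient functions of the system which make it regular on the last exceptional curves in this sense. Definition. A system $y'=P(y,z;x)$, $z'=Q(y,z;x)$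 is an analogue of the Bureau-Guillot system (Bureau-Guillot, for short) for $(\mathrm{P}_{\mathrm J})$ if: (i) it is birationally equivalent (by a transformation of $(y,z)$ with coefficients depending on $x$) to the Hamiltonian system with coefficients rational in $x$ associated with $(\mathrm{P}_{\mathrm J})$; (ii) it has coefficient functions both rational and meromorphic in $x$ which are functions of the Painlevé transcendent $\mathrm{P}_{\mathrm J}$ (here $q$) and its derivatives; (iii) the Painlevé equation $(\mathrm{P}_{\mathrm J})$ is obtained as a regularising condition in the regularisation process of the system, i.e., regarding $q$ as an a priori undetermined function, the regularising conditions are differential equations for $q$ that are satisfied when $q$ solves $(\mathrm{P}_{\mathrm J})$. *)

theory Defs
  imports
    "HOL-Complex_Analysis.Complex_Analysis"
    "HOL-Computational_Algebra.Computational_Algebra"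
    "HOL-Computational_Algebra.Field_as_Ring"
begin

section \<open>Formal Laurent series as a coefficient field\<close>

text \<open>The instance below is the trivial one that \<^theory>\<open>HOL-Computational_Algebra.Field_as_Ring\<close>
  sets up for the number fields. It makes reduced fractions (\<^const>\<open>quot_of_fract\<close>) available for
  rational functions with Laurent series coefficients.\<close>

instantiation fls :: (field)
  "{unique_euclidean_ring, normalization_euclidean_semiring, normalization_semidom_multiplicative}"
begin

definition [simp]: "normalize_fls = (normalize_field :: 'a fls \<Rightarrow> _)"
definition [simp]: "unit_factor_fls = (unit_factor_field :: 'a fls \<Rightarrow> _)"
definition [simp]: "modulo_fls = (mod_field :: 'a fls \<Rightarrow> _)"
definition [simp]: "euclidean_size_fls = (euclidean_size_field :: 'a fls \<Rightarrow> _)"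
definition [simp]: "division_segment (x :: 'a fls) = 1"

instance
  by standard
    (simp_all add: dvd_field_iff field_split_simps split: if_splits)

end

instantiation fls :: (field) euclidean_ring_gcd
begin

definition gcd_fls :: "'a fls \<Rightarrow> 'a fls \<Rightarrow> 'a fls" where
  "gcd_fls = Euclidean_Algorithm.gcd"
definition lcm_fls :: "'a fls \<Rightarrow> 'a fls \<Rightarrow> 'a fls" where
  "lcm_fls = Euclidean_Algorithm.lcm"
definition Gcd_fls :: "'a fls set \<Rightarrow> 'a fls" where
  "Gcd_fls = Euclidean_Algorithm.Gcd"
definition Lcm_fls :: "'a fls set \<Rightarrow> 'a fls" where
  "Lcm_fls = Euclidean_Algorithm.Lcm"

instance by standard (simp_all add: gcd_fls_def lcm_fls_def Gcd_fls_def Lcm_fls_def)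

end

instance fls :: (field) field_gcd ..


section \<open>Rational functions in two variables over a differential field\<close>

text \<open>A rational function of \<open>(y, z)\<close> is a fraction of polynomials in \<open>z\<close> (outer variable) whose
  coefficients are polynomials in \<open>y\<close> (inner variable). The type \<open>'k\<close> is the field of
  coefficients, i.e. of functions of the independent variable \<open>x\<close>; the derivation \<open>d/dx\<close> on it is
  passed as a parameter \<open>\<delta>\<close>.\<close>

type_synonym 'k ratfun = "'k poly poly fract"

definition cst :: "'k::field_gcd \<Rightarrow> 'k ratfun" where
  "cst c = to_fract [:[:c:]:]"

definition var_y :: "'k::field_gcd ratfun" where
  "var_y = to_fract [:[:0, 1:]:]"

definition var_z :: "'k::field_gcd ratfun" where
  "var_z = to_fract [:0, 1:]"

definition num :: "'k::field_gcd ratfun \<Rightarrow> 'k poly poly" where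
  "num f = fst (quot_of_fract f)"

definition den :: "'k::field_gcd ratfun \<Rightarrow> 'k poly poly" where
  "den f = snd (quot_of_fract f)"

definition poly2 :: "'k::field_gcd poly poly \<Rightarrow> 'k \<Rightarrow> 'k \<Rightarrow> 'k" where
  "poly2 p a b = poly (poly p [:b:]) a"

definition poly2_subst :: "'k::field_gcd poly poly \<Rightarrow> 'k ratfun \<Rightarrow> 'k ratfun \<Rightarrow> 'k ratfun" where
  "poly2_subst p f g = poly (map_poly (\<lambda>c. poly (map_poly cst c) f) p) g"

text \<open>\<open>subst h f g\<close> is \<open>h(f, g)\<close>.\<close>

definition subst :: "'k::field_gcd ratfun \<Rightarrow> 'k ratfun \<Rightarrow> 'k ratfun \<Rightarrow> 'k ratfun" where
  "subst h f g = poly2_subst (num h) f g / poly2_subst (den h) f g"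

definition quotient_rule ::
    "('k::field_gcd poly poly \<Rightarrow> 'k poly poly) \<Rightarrow> 'k ratfun \<Rightarrow> 'k ratfun" where
  "quotient_rule d f = Fract (d (num f) * den f - num f * d (den f)) (den f ^ 2)"

definition D_x :: "('k::field_gcd \<Rightarrow> 'k) \<Rightarrow> 'k ratfun \<Rightarrow> 'k ratfun" where
  "D_x \<delta> = quotient_rule (map_poly (map_poly \<delta>))"

definition D_y :: "'k::field_gcd ratfun \<Rightarrow> 'k ratfun" where
  "D_y = quotient_rule (map_poly pderiv)"

definition D_z :: "'k::field_gcd ratfun \<Rightarrow> 'k ratfun" where
  "D_z = quotient_rule pderiv"


section \<open>Planar systems and changes of coordinates\<close>

text \<open>The pair \<open>(P, Q)\<close> stands for the system \<open>y' = P\<close>, \<open>z' = Q\<close>.\<close>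

type_synonym 'k system = "'k ratfun \<times> 'k ratfun"

definition derivative_along ::
    "('k::field_gcd \<Rightarrow> 'k) \<Rightarrow> 'k system \<Rightarrow> 'k ratfun \<Rightarrow> 'k ratfun" where
  "derivative_along \<delta> S f = D_x \<delta> f + D_y f * fst S + D_z f * snd S"

text \<open>The system \<open>S\<close> rewritten in the new coordinates \<open>(u, v) = (U(y, z), V(y, z))\<close>, whose inverse
  is \<open>(y, z) = (Y(u, v), Z(u, v))\<close>.\<close>

definition in_coordinates ::
    "('k::field_gcd \<Rightarrow> 'k) \<Rightarrow> 'k system \<Rightarrow> 'k ratfun \<times> 'k ratfun \<Rightarrow> 'k ratfun \<times> 'k ratfun
       \<Rightarrow> 'k system" where
  "in_coordinates \<delta> S = (\<lambda>(U, V) (Y, Z).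
     (subst (derivative_along \<delta> S U) Y Z, subst (derivative_along \<delta> S V) Y Z))"

definition hamiltonian_system :: "'k::field_gcd ratfun \<Rightarrow> 'k system" where
  "hamiltonian_system H = (D_z H, - D_y H)"

definition mutually_inverse ::
    "'k::field_gcd ratfun \<times> 'k ratfun \<Rightarrow> 'k ratfun \<times> 'k ratfun \<Rightarrow> bool" where
  "mutually_inverse = (\<lambda>(U, V) (Y, Z).
     subst U Y Z = var_y \<and> subst V Y Z = var_z \<and> subst Y U V = var_y \<and> subst Z U V = var_z)"


section \<open>The regularisation process\<close>

text \<open>The three affine charts of the projective plane, \<open>[1 : y : z] = [u\<^sub>0 : 1 : v\<^sub>0] = [V\<^sub>0 : U\<^sub>0 : 1]\<close>.
  Both coordinate changes at infinity, \<open>(u\<^sub>0, v\<^sub>0) = (1/y, z/y)\<close> and \<open>(U\<^sub>0, V\<^sub>0) = (y/z, 1/z)\<close>, are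
  involutions.\<close>

definition projective_charts :: "('k::field_gcd \<Rightarrow> 'k) \<Rightarrow> 'k system \<Rightarrow> 'k system set" where
  "projective_charts \<delta> S =
     {S,
      in_coordinates \<delta> S (1 / var_y, var_z / var_y) (1 / var_y, var_z / var_y),
      in_coordinates \<delta> S (var_y / var_z, 1 / var_z) (var_y / var_z, 1 / var_z)}"

text \<open>Numerators and denominators are taken in lowest terms.\<close>

definition indeterminate_at :: "'k::field_gcd ratfun \<Rightarrow> 'k \<Rightarrow> 'k \<Rightarrow> bool" where
  "indeterminate_at f a b \<longleftrightarrow> poly2 (num f) a b = 0 \<and> poly2 (den f) a b = 0"

definition base_point :: "'k::field_gcd system \<Rightarrow> 'k \<Rightarrow> 'k \<Rightarrow> bool" where
  "base_point S a b \<longleftrightarrow> indeterminate_at (fst S) a b \<or> indeterminate_at (snd S) a b"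

definition regular_at :: "'k::field_gcd system \<Rightarrow> 'k \<Rightarrow> 'k \<Rightarrow> bool" where
  "regular_at S a b \<longleftrightarrow> poly2 (den (fst S)) a b \<noteq> 0 \<and> poly2 (den (snd S)) a b \<noteq> 0"

text \<open>The two charts of the blow-up at \<open>(a, b)\<close>: the chart \<open>(u, v) = (y - a, (z - b)/(y - a))\<close> with
  exceptional curve \<open>u = 0\<close>, and the chart \<open>(U, V) = ((y - a)/(z - b), z - b)\<close> with exceptional
  curve \<open>V = 0\<close>. The centre \<open>(a, b)\<close> depends on \<open>x\<close> and is differentiated, too.\<close>

definition blowup_uv :: "('k::field_gcd \<Rightarrow> 'k) \<Rightarrow> 'k system \<Rightarrow> 'k \<Rightarrow> 'k \<Rightarrow> 'k system" where
  "blowup_uv \<delta> S a b = in_coordinates \<delta> S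
     (var_y - cst a, (var_z - cst b) / (var_y - cst a))
     (var_y + cst a, var_y * var_z + cst b)"

definition blowup_UV :: "('k::field_gcd \<Rightarrow> 'k) \<Rightarrow> 'k system \<Rightarrow> 'k \<Rightarrow> 'k \<Rightarrow> 'k system" where
  "blowup_UV \<delta> S a b = in_coordinates \<delta> S
     ((var_y - cst a) / (var_z - cst b), var_z - cst b)
     (var_y * var_z + cst a, var_z + cst b)"

text \<open>The exceptional curve is a projective line. Its points are the points \<open>(0, c)\<close> of the chart
  \<open>(u, v)\<close> and the origin of the chart \<open>(U, V)\<close>; the other points \<open>(c, 0)\<close> of \<open>V = 0\<close> are the points
  \<open>(0, 1/c)\<close> of the chart \<open>(u, v)\<close> again, so that every point of the curve is treated once.\<close>

definition determinate_on_exceptional_curve ::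
    "('k::field_gcd \<Rightarrow> 'k) \<Rightarrow> 'k system \<Rightarrow> 'k \<Rightarrow> 'k \<Rightarrow> bool" where
  "determinate_on_exceptional_curve \<delta> S a b \<longleftrightarrow>
     (\<forall>c. \<not> base_point (blowup_uv \<delta> S a b) 0 c) \<and> \<not> base_point (blowup_UV \<delta> S a b) 0 0"

text \<open>\<open>regularised_at \<delta> S a b\<close>: all cascades of blow-ups starting with the blow-up of the system \<open>S\<close>
  at its base point \<open>(a, b)\<close> are finite, and at the end of each of them the system is regular on the
  last exceptional curve in one of the two final charts.\<close>

inductive regularised_at ::
    "('k::field_gcd \<Rightarrow> 'k) \<Rightarrow> 'k system \<Rightarrow> 'k \<Rightarrow> 'k \<Rightarrow> bool" for \<delta> where
  final: "determinate_on_exceptional_curve \<delta> S a b \<Longrightarrow>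
      (\<forall>c. regular_at (blowup_uv \<delta> S a b) 0 c) \<or> (\<forall>c. regular_at (blowup_UV \<delta> S a b) c 0) \<Longrightarrow>
      regularised_at \<delta> S a b"
| blow_up: "\<not> determinate_on_exceptional_curve \<delta> S a b \<Longrightarrow>
      (\<And>c. base_point (blowup_uv \<delta> S a b) 0 c \<Longrightarrow> regularised_at \<delta> (blowup_uv \<delta> S a b) 0 c) \<Longrightarrow>
      (base_point (blowup_UV \<delta> S a b) 0 0 \<Longrightarrow> regularised_at \<delta> (blowup_UV \<delta> S a b) 0 0) \<Longrightarrow>
      regularised_at \<delta> S a b"

definition regularised :: "('k::field_gcd \<Rightarrow> 'k) \<Rightarrow> 'k system \<Rightarrow> bool" where
  "regularised \<delta> S \<longleftrightarrow>
     (\<forall>T\<in>projective_charts \<delta> S. \<forall>a b. base_point T a b \<longrightarrow> regularised_at \<delta> T a b)"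


section \<open>Systems whose coefficients are functions on a domain\<close>

text \<open>Functions that are meromorphic on a domain are turned into elements of a differential field by
  expanding them at a point \<open>x\<^sub>0\<close> of the domain. A system whose coefficients are functions on \<open>D\<close>
  is therefore a map from the points of \<open>D\<close> to systems over \<^typ>\<open>complex fls\<close>. All points \<open>x\<^sub>0\<close> have to be
  considered because a base point whose position is an algebraic function of \<open>x\<close> has coordinates in
  the Laurent series at \<open>x\<^sub>0\<close> only if \<open>x\<^sub>0\<close> is not a branch point.\<close>

type_synonym system_germs = "complex \<Rightarrow> complex fls system"

definition germ :: "(complex \<Rightarrow> complex) \<Rightarrow> complex \<Rightarrow> complex fls ratfun" where
  "germ f x0 = cst (laurent_expansion f x0)"

definition regularised_on :: "complex set \<Rightarrow> system_germs \<Rightarrow> bool" where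
  "regularised_on D S \<longleftrightarrow> (\<forall>x0\<in>D. regularised fls_deriv (S x0))"

text \<open>\<open>R\<close> is the quotient of two polynomials of degree at most \<open>n\<close> in each of \<open>y\<close> and \<open>z\<close>, with
  coefficient functions \<open>N i j\<close> and \<open>M i j\<close> on \<open>D\<close> of the monomials \<open>y\<^sup>i z\<^sup>j\<close>.\<close>

definition has_coefficients ::
    "complex set \<Rightarrow> nat \<Rightarrow> (nat \<Rightarrow> nat \<Rightarrow> complex \<Rightarrow> complex) \<Rightarrow> (nat \<Rightarrow> nat \<Rightarrow> complex \<Rightarrow> complex)
       \<Rightarrow> (complex \<Rightarrow> complex fls ratfun) \<Rightarrow> bool" where
  "has_coefficients D n N M R \<longleftrightarrow> (\<forall>x0\<in>D.
     (\<Sum>i\<le>n. \<Sum>j\<le>n. germ (M i j) x0 * var_y ^ i * var_z ^ j) \<noteq> 0 \<and>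
     R x0 = (\<Sum>i\<le>n. \<Sum>j\<le>n. germ (N i j) x0 * var_y ^ i * var_z ^ j) /
            (\<Sum>i\<le>n. \<Sum>j\<le>n. germ (M i j) x0 * var_y ^ i * var_z ^ j))"

definition meromorphic_coefficients ::
    "complex set \<Rightarrow> (complex \<Rightarrow> complex fls ratfun) \<Rightarrow> bool" where
  "meromorphic_coefficients D R \<longleftrightarrow> (\<exists>n N M.
     (\<forall>i j. N i j meromorphic_on D \<and> M i j meromorphic_on D) \<and> has_coefficients D n N M R)"

definition birationally_equivalent_on ::
    "complex set \<Rightarrow> system_germs \<Rightarrow> system_germs \<Rightarrow> bool" where
  "birationally_equivalent_on D S T \<longleftrightarrow> (\<exists>U V Y Z.
     meromorphic_coefficients D U \<and> meromorphic_coefficients D V \<and>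
     meromorphic_coefficients D Y \<and> meromorphic_coefficients D Z \<and>
     (\<forall>x0\<in>D. mutually_inverse (U x0, V x0) (Y x0, Z x0) \<and>
        in_coordinates fls_deriv (S x0) (U x0, V x0) (Y x0, Z x0) = T x0))"


section \<open>Differential polynomials in an undetermined function\<close>

text \<open>\<open>Jet n\<close> is the \<open>n\<close>-th derivative of the undetermined function \<open>q\<close> of \<open>x\<close>.\<close>

datatype diff_poly = Const complex | Indep | Jet nat
  | Plus diff_poly diff_poly | Times diff_poly diff_poly

primrec eval_dp :: "diff_poly \<Rightarrow> (complex \<Rightarrow> complex) \<Rightarrow> complex \<Rightarrow> complex" where
  "eval_dp (Const c) q x = c"
| "eval_dp Indep q x = x"
| "eval_dp (Jet n) q x = (deriv ^^ n) q x"
| "eval_dp (Plus F G) q x = eval_dp F q x + eval_dp G q x"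
| "eval_dp (Times F G) q x = eval_dp F q x * eval_dp G q x"

definition vanishes_on :: "complex set \<Rightarrow> diff_poly \<Rightarrow> (complex \<Rightarrow> complex) \<Rightarrow> bool" where
  "vanishes_on D F q \<longleftrightarrow> (\<forall>x\<in>D. eval_dp F q x = 0)"

type_synonym diff_rat = "diff_poly \<times> diff_poly"

definition eval_dr :: "diff_rat \<Rightarrow> (complex \<Rightarrow> complex) \<Rightarrow> complex \<Rightarrow> complex" where
  "eval_dr c q x = eval_dp (fst c) q x / eval_dp (snd c) q x"


section \<open>Bureau-Guillot systems\<close>

text \<open>The system under consideration depends on a function \<open>q\<close>, which is regarded as undetermined for
  the regularising conditions; so it is given as a family \<open>S\<close> indexed by \<open>q\<close>. Shrinking the domain,
  one may assume that \<open>q\<close> has neither poles nor zeros.\<close>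

definition admissible :: "complex set \<Rightarrow> (complex \<Rightarrow> complex) set" where
  "admissible D = {q. q holomorphic_on D \<and> (\<forall>x\<in>D. q x \<noteq> 0)}"

definition coefficients_in_q ::
    "complex set \<Rightarrow> ((complex \<Rightarrow> complex) \<Rightarrow> complex \<Rightarrow> complex fls ratfun) \<Rightarrow> bool" where
  "coefficients_in_q D R \<longleftrightarrow> (\<exists>n (N :: nat \<Rightarrow> nat \<Rightarrow> diff_rat) (M :: nat \<Rightarrow> nat \<Rightarrow> diff_rat).
     \<forall>q\<in>admissible D.
       (\<forall>c\<in>{N i j |i j. True} \<union> {M i j |i j. True}.
          \<not> vanishes_on D (snd c) q \<and> eval_dr c q meromorphic_on D) \<and>
       has_coefficients D n (\<lambda>i j. eval_dr (N i j) q) (\<lambda>i j. eval_dr (M i j) q) (R q))"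

text \<open>The regularising conditions of the family \<open>S\<close> are differential equations \<open>F = 0\<close>, \<open>F \<in> \<F>\<close>: for
  generic \<open>q\<close> (those for which a further differential polynomial \<open>G\<close> does not vanish identically)
  they hold if and only if the system is regularised, they do not hold for every generic \<open>q\<close>, and
  they hold for all solutions of the Painleve equation, which moreover are generic.\<close>

definition obtained_as_regularising_condition ::
    "complex set \<Rightarrow> ((complex \<Rightarrow> complex) \<Rightarrow> bool) \<Rightarrow> ((complex \<Rightarrow> complex) \<Rightarrow> system_germs)
       \<Rightarrow> bool" where
  "obtained_as_regularising_condition D PJ S \<longleftrightarrow> (\<exists>\<F> G. finite \<F> \<and>
     (\<forall>q\<in>admissible D. \<not> vanishes_on D G q \<longrightarrow>
        (regularised_on D (S q) \<longleftrightarrow> (\<forall>F\<in>\<F>. vanishes_on D F q))) \<and>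
     (\<exists>q\<in>admissible D. \<not> vanishes_on D G q \<and> (\<exists>F\<in>\<F>. \<not> vanishes_on D F q)) \<and>
     (\<forall>q\<in>admissible D. PJ q \<longrightarrow> \<not> vanishes_on D G q \<and> (\<forall>F\<in>\<F>. vanishes_on D F q)))"

text \<open>\<open>PJ\<close> is the Painleve equation, as a predicate on functions on \<open>D\<close>, and \<open>H\<close> the associated
  Hamiltonian system.\<close>

definition bureau_guillot ::
    "complex set \<Rightarrow> ((complex \<Rightarrow> complex) \<Rightarrow> bool) \<Rightarrow> system_germs
       \<Rightarrow> ((complex \<Rightarrow> complex) \<Rightarrow> system_germs) \<Rightarrow> (complex \<Rightarrow> complex) \<Rightarrow> bool" where
  "bureau_guillot D PJ H S q \<longleftrightarrow>
     birationally_equivalent_on D (S q) H \<and>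
     coefficients_in_q D (\<lambda>q x0. fst (S q x0)) \<and> coefficients_in_q D (\<lambda>q x0. snd (S q x0)) \<and>
     obtained_as_regularising_condition D PJ S"


section \<open>The third Painleve equation of type \<open>D\<^sub>7\<close>\<close>

definition painleve_III ::
    "complex \<Rightarrow> complex \<Rightarrow> complex \<Rightarrow> complex \<Rightarrow> complex set \<Rightarrow> (complex \<Rightarrow> complex) \<Rightarrow> bool" where
  "painleve_III \<alpha> \<beta> \<gamma> \<delta> D q \<longleftrightarrow> (\<forall>x\<in>D.
     deriv (deriv q) x = (deriv q x)\<^sup>2 / q x - deriv q x / x + (\<alpha> * (q x)\<^sup>2 + \<beta>) / x
       + \<gamma> * (q x) ^ 3 + \<delta> / q x)"

text \<open>The following formulas are used both with complex numbers and with rational functions of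
  \<open>(y, z)\<close> in place of \<open>'a\<close>.\<close>

definition ham_D7 :: "'a \<Rightarrow> 'a \<Rightarrow> 'a \<Rightarrow> 'a \<Rightarrow> 'a \<Rightarrow> 'a \<Rightarrow> 'a::field" where
  "ham_D7 \<eta>0 \<kappa>0 \<kappa>inf x y3 z3 =
     1 / x * (2 * y3\<^sup>2 * z3\<^sup>2 + \<kappa>inf * x * y3 - z3 * ((2 * \<kappa>0 + 1) * y3 - 2 * \<eta>0 * x))"

text \<open>Here \<open>s\<close> is a square root of \<open>x\<close> and \<open>q'\<close> the derivative of \<open>q\<close>. The branch of \<open>s\<close> is immaterial,
  as \<open>s\<close> occurs only in a square that depends on \<open>s\<^sup>2\<close>.\<close>

definition bg_rhs_y :: "'a \<Rightarrow> 'a \<Rightarrow> 'a \<Rightarrow> 'a \<Rightarrow> 'a \<Rightarrow> 'a \<Rightarrow> 'a \<Rightarrow> 'a \<Rightarrow> 'a::field" where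
  "bg_rhs_y \<eta>0 \<kappa>0 s x q q' y z =
     2 * y * ((2 * \<eta>0 - q') / q - 2 * y / x * (q\<^sup>2 + 3 * q * z + 2 * z\<^sup>2))
     - ((2 * \<kappa>0 + 1) / (2 * s * q) - s * (2 * \<eta>0 - q') / (2 * q\<^sup>2))\<^sup>2
     + y * (3 * z / q + 2) * ((2 * \<eta>0 - q') / q - (2 * \<kappa>0 + 1) / x)"

definition bg_rhs_z :: "'a \<Rightarrow> 'a \<Rightarrow> 'a \<Rightarrow> 'a \<Rightarrow> 'a \<Rightarrow> 'a \<Rightarrow> 'a \<Rightarrow> 'a::field" where
  "bg_rhs_z \<eta>0 \<kappa>0 x q q' y z =
     (z\<^sup>2 / q + z) * (4 * y * q * (q + z) / x + (2 * \<kappa>0 + 1) / x)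
     - (z\<^sup>2 / q + 2 * z) * ((2 * \<eta>0 - q') / q)"

definition ham_D7_system :: "complex \<Rightarrow> complex \<Rightarrow> complex \<Rightarrow> system_germs" where
  "ham_D7_system \<eta>0 \<kappa>0 \<kappa>inf x0 = hamiltonian_system
     (ham_D7 (germ (\<lambda>_. \<eta>0) x0) (germ (\<lambda>_. \<kappa>0) x0) (germ (\<lambda>_. \<kappa>inf) x0) (germ (\<lambda>x. x) x0)
        var_y var_z)"

text \<open>The function \<open>x \<mapsto> csqrt x\<^sub>0 * csqrt (x / x\<^sub>0)\<close> is a holomorphic square root of \<open>x\<close> near \<open>x\<^sub>0 \<noteq> 0\<close>,
  also if \<open>x\<^sub>0\<close> lies on the branch cut of \<^const>\<open>csqrt\<close>.\<close>

definition bg_D7_system :: "complex \<Rightarrow> complex \<Rightarrow> (complex \<Rightarrow> complex) \<Rightarrow> system_germs" where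
  "bg_D7_system \<eta>0 \<kappa>0 q x0 =
     (let \<eta>0 = germ (\<lambda>_. \<eta>0) x0; \<kappa>0 = germ (\<lambda>_. \<kappa>0) x0;
          s = germ (\<lambda>x. csqrt x0 * csqrt (x / x0)) x0; x = germ (\<lambda>x. x) x0;
          q' = germ (deriv q) x0; q = germ q x0
      in (bg_rhs_y \<eta>0 \<kappa>0 s x q q' var_y var_z, bg_rhs_z \<eta>0 \<kappa>0 x q q' var_y var_z))"

end

(*
Multiplied by x, the system has polynomial coefficients in q, x and e, where z_3 = y z - e, and
one can define a function K by x e' = x K + 4 q e^2 + (2 kappa_0 + 1) e. Undoing the
transformation turns the system into the Hamiltonian system with K in place of the constant
kappa_infinity; the Painleve equation says that K = kappa_infinity. So the equivalence of the two
systems is a computation, and the regularising condition is a property of K. It turns out that all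
base points lie over the points [0:1:0] and [0:0:1] at infinity. The cascades over [0:1:0] end
in regular systems whenever K is nonzero. In the last step of the cascade over [0:0:1] the linearisation is
resonant, and the obstruction to regularity is a nonzero multiple of (x K'/K)'. Thus the system is
regularised for nonzero K if and only if (x K'/K)' = 0, which holds in particular for constant K; exponential
functions q show that the condition is not vacuous.
*)

theory Submission
  imports Defs
begin

section \<open>Evaluation of bivariate polynomials\<close>

text \<open>The process is defined through fractions in lowest terms, while the charts arise as
  large unreduced expressions. The proof never computes a reduced fraction but works in the local
  rings of points: a quotient whose numerator is nonzero at a point is not 0/0 there, and a
  numerator that vanishes at one point of an exceptional curve but not at another one is not
  divisible by the equation of the curve, so that the quotient is 0/0 at the first point. K does not
  occur in the system itself. It enters when the moving centre with coordinate \<open>1 / e\<close>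
  is differentiated, because e' contains K. The derivative of the next moving centre, a multiple of
  K, brings in the logarithmic derivative of K; the position of the last centre contains that, so
  its own derivative contains (x K'/K)'. This fixes the order of the condition. Where K is nonzero,
  e is nonzero too, as e = 0 would give K = 0. Hence the single differential polynomial -4 q^3 K
  describes the generic functions q.\<close>

definition is_ring_hom :: "('a::comm_ring_1 \<Rightarrow> 'b::comm_ring_1) \<Rightarrow> bool" where
  "is_ring_hom f \<longleftrightarrow>
     f 1 = 1 \<and> (\<forall>a b. f (a + b) = f a + f b) \<and> (\<forall>a b. f (a * b) = f a * f b)"

lemma ring_hom_0:
  assumes "is_ring_hom f"
  shows "f 0 = 0"
proof -
  have "f (0 + 0) = f 0 + f 0" using assms unfolding is_ring_hom_def by blast
  then show ?thesis by simp
qed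

lemma ring_hom_diff:
  assumes "is_ring_hom f"
  shows "f (a - b) = f a - f b"
proof -
  have "f (a - b + b) = f (a - b) + f b" using assms unfolding is_ring_hom_def by blast
  then show ?thesis by (simp add: algebra_simps)
qed

text \<open>Used twice, for the inner and then for the outer variable, this makes
  \<open>poly2_subst\<close> a ring homomorphism.\<close>

lemma ring_hom_eval_poly:
  assumes \<phi>: "is_ring_hom \<phi>"
  shows "is_ring_hom (\<lambda>p. poly (map_poly \<phi> p) g)"
proof -
  have \<phi>0: "\<phi> 0 = 0" using ring_hom_0[OF \<phi>] .
  have \<phi>1: "\<phi> 1 = 1" and \<phi>a: "\<phi> (a + b) = \<phi> a + \<phi> b" and \<phi>m: "\<phi> (a * b) = \<phi> a * \<phi> b" for a b
    using \<phi> by (auto simp: is_ring_hom_def)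
  have add: "map_poly \<phi> (p + q) = map_poly \<phi> p + map_poly \<phi> q" for p q
    by (rule poly_eqI) (simp add: coeff_map_poly \<phi>0 \<phi>a)
  have sm: "map_poly \<phi> (smult c p) = smult (\<phi> c) (map_poly \<phi> p)" for c p
    by (rule poly_eqI) (simp add: coeff_map_poly \<phi>0 \<phi>m)
  have mult: "map_poly \<phi> (p * q) = map_poly \<phi> p * map_poly \<phi> q" for p q
  proof (induction p)
    case (pCons a p)
    have "map_poly \<phi> (pCons a p * q) = map_poly \<phi> (smult a q + pCons 0 (p * q))"
      by simp
    also have "\<dots> = smult (\<phi> a) (map_poly \<phi> q) + pCons 0 (map_poly \<phi> p * map_poly \<phi> q)"
      by (simp only: add sm map_poly_pCons[where f = \<phi>, OF \<phi>0] \<phi>0 pCons.IH)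
    also have "\<dots> = map_poly \<phi> (pCons a p) * map_poly \<phi> q"
      by (simp add: map_poly_pCons[where f = \<phi>, OF \<phi>0])
    finally show ?case .
  qed simp
  show ?thesis
    unfolding is_ring_hom_def using \<phi>1 by (auto simp: add mult)
qed

lemma cst_simps [simp]:
  "cst 0 = 0" "cst 1 = 1" "cst (a + b) = cst a + cst b" "cst (a - b) = cst a - cst b"
  "cst (- a) = - cst a" "cst (a * b) = cst a * cst b"
  unfolding cst_def
  by (simp_all flip: one_pCons to_fract_add to_fract_diff to_fract_mult to_fract_uminus)

lemma cst_eq_iff [simp]: "cst a = cst b \<longleftrightarrow> a = b"
  by (simp add: cst_def)

lemma cst_eq_0_iff [simp]: "cst a = 0 \<longleftrightarrow> a = 0"
  using cst_eq_iff[of a 0] by (simp del: cst_eq_iff)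

lemma cst_of_nat [simp]: "cst (of_nat n) = of_nat n"
  by (induction n) auto

lemma cst_numeral [simp]: "cst (numeral n) = numeral n"
  using cst_of_nat[of "numeral n"] by (simp del: cst_of_nat)

lemma cst_power [simp]: "cst (a ^ n) = cst a ^ n"
  by (induction n) auto

lemma cst_divide [simp]: "cst (a / b) = cst a / cst b"
proof (cases "b = 0")
  case False
  have "cst (a / b) * cst b = cst (a / b * b)" by (simp only: cst_simps(6))
  also have "\<dots> = cst a" using False by simp
  finally have "cst (a / b) * cst b = cst a" .
  then show ?thesis using False by (simp add: field_simps)
qed simp

lemma ring_hom_cst: "is_ring_hom cst"
  by (simp add: is_ring_hom_def)

lemma ring_hom_poly2_subst: "is_ring_hom (\<lambda>p. poly2_subst p f g)"
  unfolding poly2_subst_def by (intro ring_hom_eval_poly ring_hom_cst)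

lemma poly2_subst_simps [simp]:
  "poly2_subst 0 f g = 0" "poly2_subst 1 f g = 1"
  "poly2_subst (p + q) f g = poly2_subst p f g + poly2_subst q f g"
  "poly2_subst (p - q) f g = poly2_subst p f g - poly2_subst q f g"
  "poly2_subst (p * q) f g = poly2_subst p f g * poly2_subst q f g"
  using ring_hom_poly2_subst[of f g] ring_hom_0[OF ring_hom_poly2_subst[of f g]]
    ring_hom_diff[OF ring_hom_poly2_subst[of f g], of p q]
  by (simp_all add: is_ring_hom_def)

lemma poly2_subst_const [simp]: "poly2_subst [:[:c:]:] f g = cst c"
  by (simp add: poly2_subst_def map_poly_pCons)

lemma poly2_subst_y [simp]: "poly2_subst [:[:0, 1:]:] f g = f"
  by (simp add: poly2_subst_def map_poly_pCons)

lemma poly2_subst_z [simp]: "poly2_subst [:0, 1:] f g = g"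
  by (simp add: poly2_subst_def map_poly_pCons)

lemma poly2_simps [simp]:
  "poly2 0 a b = 0" "poly2 1 a b = 1"
  "poly2 (p + q) a b = poly2 p a b + poly2 q a b"
  "poly2 (p - q) a b = poly2 p a b - poly2 q a b"
  "poly2 (- p) a b = - poly2 p a b"
  "poly2 (p * q) a b = poly2 p a b * poly2 q a b"
  "poly2 (p ^ n) a b = poly2 p a b ^ n"
  "poly2 [:[:c:]:] a b = c" "poly2 [:[:0, 1:]:] a b = a" "poly2 [:0, 1:] a b = b"
  by (simp_all add: poly2_def)

text \<open>The constants and the two variables generate the polynomial ring, so a property that is
  stable under sums and products has to be checked on them only.\<close>

lemma poly2_induct [case_names const y z add mult]:
  fixes p :: "'k::field_gcd poly poly"
  assumes "\<And>c. P [:[:c:]:]" "P [:[:0, 1:]:]" "P [:0, 1:]"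
    "\<And>p q. P p \<Longrightarrow> P q \<Longrightarrow> P (p + q)" "\<And>p q. P p \<Longrightarrow> P q \<Longrightarrow> P (p * q)"
  shows "P p"
proof -
  have inner: "P [:p:]" for p :: "'k poly"
  proof (induction p)
    case 0
    then show ?case using assms(1)[of 0] by simp
  next
    case (pCons a p)
    have "P ([:[:a:]:] + [:[:0, 1:]:] * [:p:])"
      using assms pCons by blast
    then show ?case by simp
  qed
  show ?thesis
  proof (induction p)
    case 0
    then show ?case using inner[of 0] by simp
  next
    case (pCons a p)
    have "P ([:a:] + [:0, 1:] * p)"
      using assms pCons inner by blast
    then show ?case by simp
  qed
qed

section \<open>Numerators and denominators\<close>

lemma den_nonzero [simp]: "den f \<noteq> 0"
  by (simp add: den_def)

lemma num_div_den: "to_fract (num f) / to_fract (den f) = f"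
  unfolding num_def den_def by (simp flip: Fract_conv_to_fract)

lemma coprime_num_den: "coprime (num f) (den f)"
  by (simp add: num_def den_def coprime_quot_of_fract)

text \<open>Coprimality makes \<open>den f\<close> divide q. The common factor r is the bridge
  between the lowest terms of the definitions and whatever fraction is at hand.\<close>

lemma num_den_reduced:
  assumes "f = to_fract p / to_fract q" "q \<noteq> 0"
  obtains r where "p = num f * r" "q = den f * r" "r \<noteq> 0"
proof -
  have "to_fract (num f) / to_fract (den f) = to_fract p / to_fract q"
    using assms num_div_den by metis
  then have "to_fract (num f * q) = to_fract (p * den f)"
    using assms(2) by (simp add: field_simps)
  then have eq: "num f * q = p * den f"
    by (simp only: to_fract_eq_iff)
  then have "den f dvd num f * q" by simp
  then have "den f dvd q"
    using coprime_num_den[of f] by (simp add: coprime_commute coprime_dvd_mult_right_iff)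
  then obtain r where r: "q = den f * r" ..
  have "num f * r * den f = p * den f" using eq r by (simp add: mult_ac)
  then have "p = num f * r" by simp
  with r assms(2) that show thesis by auto
qed

section \<open>Local rings of rational functions\<close>

text \<open>Membership in the local ring at (a, b). The closure rules below allow regularity and
  values to be read off from any expression, reduced or not.\<close>

definition defined_at :: "'k::field_gcd ratfun \<Rightarrow> 'k \<Rightarrow> 'k \<Rightarrow> bool" where
  "defined_at f a b \<longleftrightarrow> poly2 (den f) a b \<noteq> 0"

definition value_at :: "'k::field_gcd ratfun \<Rightarrow> 'k \<Rightarrow> 'k \<Rightarrow> 'k" where
  "value_at f a b = poly2 (num f) a b / poly2 (den f) a b"

lemma defined_atI:
  assumes f: "f = to_fract p / to_fract q" and q: "poly2 q a b \<noteq> 0"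
  shows "defined_at f a b" "value_at f a b = poly2 p a b / poly2 q a b"
proof -
  have "q \<noteq> 0" using q by auto
  then obtain r where "p = num f * r" "q = den f * r" using num_den_reduced f by blast
  with q show "defined_at f a b" "value_at f a b = poly2 p a b / poly2 q a b"
    by (auto simp: defined_at_def value_at_def)
qed

lemma defined_at_to_fract [simp]: "defined_at (to_fract p) a b"
  and value_at_to_fract [simp]: "value_at (to_fract p) a b = poly2 p a b"
  using defined_atI[of "to_fract p" p 1 a b] by simp_all

lemma defined_at_basic [simp]:
  "defined_at (cst c) a b" "defined_at var_y a b" "defined_at var_z a b"
  "defined_at 0 a b" "defined_at 1 a b" "defined_at (numeral n) a b"
  "value_at (cst c) a b = c" "value_at var_y a b = a" "value_at var_z a b = b"
  "value_at 0 a b = 0" "value_at 1 a b = 1" "value_at (numeral n) a b = numeral n"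
proof -
  show *: "defined_at (cst c) a b" "value_at (cst c) a b = c" for c by (auto simp: cst_def)
  show "defined_at var_y a b" "defined_at var_z a b"
    "value_at var_y a b = a" "value_at var_z a b = b" by (auto simp: var_y_def var_z_def)
  show "defined_at 0 a b" "defined_at 1 a b" "defined_at (numeral n) a b"
    "value_at 0 a b = 0" "value_at 1 a b = 1" "value_at (numeral n) a b = numeral n"
    using *[of 0] *[of 1] *[of "numeral n"] by simp_all
qed

lemma
  assumes "defined_at f a b" "defined_at g a b"
  shows defined_at_add [simp]: "defined_at (f + g) a b"
    and value_at_add [simp]: "value_at (f + g) a b = value_at f a b + value_at g a b"
    and defined_at_diff [simp]: "defined_at (f - g) a b"
    and value_at_diff [simp]: "value_at (f - g) a b = value_at f a b - value_at g a b"
    and defined_at_mult [simp]: "defined_at (f * g) a b"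
    and value_at_mult [simp]: "value_at (f * g) a b = value_at f a b * value_at g a b"
proof -
  define n d n' d' where nd: "n = num f" "d = den f" "n' = num g" "d' = den g"
  have f: "f = to_fract n / to_fract d" and g: "g = to_fract n' / to_fract d'"
    by (simp_all add: nd num_div_den)
  have d: "poly2 d a b \<noteq> 0" "poly2 d' a b \<noteq> 0" using assms by (auto simp: nd defined_at_def)
  then have nz: "d \<noteq> 0" "d' \<noteq> 0" by auto
  have v: "value_at f a b = poly2 n a b / poly2 d a b" "value_at g a b = poly2 n' a b / poly2 d' a b"
    by (simp_all add: nd value_at_def)
  have "f + g = to_fract (n * d' + n' * d) / to_fract (d * d')"
    using nz by (simp add: f g add_frac_eq)
  from defined_atI[OF this, of a b] show "defined_at (f + g) a b"
    "value_at (f + g) a b = value_at f a b + value_at g a b"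
    using d by (simp_all add: v add_frac_eq diff_frac_eq)
  have "f - g = to_fract (n * d' - n' * d) / to_fract (d * d')"
    using nz by (simp add: f g diff_frac_eq)
  from defined_atI[OF this, of a b] show "defined_at (f - g) a b"
    "value_at (f - g) a b = value_at f a b - value_at g a b"
    using d by (simp_all add: v add_frac_eq diff_frac_eq)
  have "f * g = to_fract (n * n') / to_fract (d * d')"
    by (simp add: f g)
  from defined_atI[OF this, of a b] show "defined_at (f * g) a b"
    "value_at (f * g) a b = value_at f a b * value_at g a b"
    using d by (simp_all add: v add_frac_eq diff_frac_eq)
qed

lemma
  assumes "defined_at f a b"
  shows defined_at_uminus [simp]: "defined_at (- f) a b"
    and value_at_uminus [simp]: "value_at (- f) a b = - value_at f a b"
    and defined_at_power [simp]: "defined_at (f ^ n) a b"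
    and value_at_power [simp]: "value_at (f ^ n) a b = value_at f a b ^ n"
proof -
  show "defined_at (- f) a b" "value_at (- f) a b = - value_at f a b"
    using defined_at_diff[of 0 a b f] value_at_diff[of 0 a b f] assms by simp_all
  have "defined_at (f ^ n) a b \<and> value_at (f ^ n) a b = value_at f a b ^ n"
    by (induction n) (use assms in auto)
  then show "defined_at (f ^ n) a b" "value_at (f ^ n) a b = value_at f a b ^ n" by auto
qed

lemma
  assumes "defined_at f a b" "defined_at g a b" "value_at g a b \<noteq> 0"
  shows defined_at_divide [simp]: "defined_at (f / g) a b"
    and value_at_divide [simp]: "value_at (f / g) a b = value_at f a b / value_at g a b"
proof -
  define n d n' d' where nd: "n = num f" "d = den f" "n' = num g" "d' = den g"
  have f: "f = to_fract n / to_fract d" and g: "g = to_fract n' / to_fract d'"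
    by (simp_all add: nd num_div_den)
  have v: "value_at f a b = poly2 n a b / poly2 d a b" "value_at g a b = poly2 n' a b / poly2 d' a b"
    by (simp_all add: nd value_at_def)
  have d: "poly2 d a b \<noteq> 0" "poly2 d' a b \<noteq> 0" "poly2 n' a b \<noteq> 0"
    using assms v by (auto simp: nd defined_at_def)
  have "f / g = to_fract (n * d') / to_fract (d * n')"
    by (simp add: f g)
  from defined_atI[OF this, of a b] show "defined_at (f / g) a b"
    "value_at (f / g) a b = value_at f a b / value_at g a b"
    using d by (simp_all add: v add_frac_eq diff_frac_eq)
qed

lemma not_defined_atI:
  assumes "defined_at f a b" "defined_at g a b" "value_at f a b \<noteq> 0" "value_at g a b = 0"
    and "g \<noteq> 0"
  shows "\<not> defined_at (f / g) a b"
proof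
  assume *: "defined_at (f / g) a b"
  have "value_at f a b = value_at (f / g * g) a b" using assms(5) by simp
  also have "\<dots> = 0" using * assms by (simp del: times_divide_eq_left)
  finally show False using assms by simp
qed

lemma indeterminate_atD: "indeterminate_at f a b \<Longrightarrow> \<not> defined_at f a b"
  by (simp add: indeterminate_at_def defined_at_def)

text \<open>The reduced numerator divides any other numerator. If f is nonzero at the point, so is
  the reduced numerator of \<open>f / g\<close>; if g is nonzero there, the quotient is
  defined.\<close>

lemma determinate_fraction:
  assumes "defined_at f a b" "defined_at g a b" "value_at f a b \<noteq> 0 \<or> value_at g a b \<noteq> 0"
  shows "\<not> indeterminate_at (f / g) a b"
proof (cases "value_at g a b = 0 \<and> g \<noteq> 0")
  case False
  \<comment> \<open>For g = 0 the quotient is 0 by the convention on division, which is defined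
    everywhere.\<close>
  then have "defined_at (f / g) a b" using assms by (cases "g = 0") auto
  then show ?thesis using indeterminate_atD by blast
next
  case True
  then have vf: "value_at f a b \<noteq> 0" using assms by auto
  then have "num f \<noteq> 0" by (auto simp: value_at_def)
  define n d n' d' where nd: "n = num f" "d = den f" "n' = num g" "d' = den g"
  have f: "f = to_fract n / to_fract d" and g: "g = to_fract n' / to_fract d'"
    by (simp_all add: nd num_div_den)
  have "n' \<noteq> 0" using True g by auto
  then have nz: "d \<noteq> 0" "d' \<noteq> 0" "n' \<noteq> 0" by (auto simp: nd)
  have "f / g = to_fract (n * d') / to_fract (d * n')"
    by (simp add: f g)
  moreover have "d * n' \<noteq> 0" using nz by simp
  ultimately obtain r where "n * d' = num (f / g) * r" using num_den_reduced by blast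
  then have "poly2 n a b * poly2 d' a b = poly2 (num (f / g)) a b * poly2 r a b"
    by (metis poly2_simps(6))
  moreover have "poly2 n a b * poly2 d' a b \<noteq> 0"
    using vf assms(2) by (auto simp: nd value_at_def defined_at_def)
  ultimately show ?thesis by (auto simp: indeterminate_at_def)
qed

lemma prime_elem_y: "prime_elem ([:[:0, 1:]:] :: 'k::field_gcd poly poly)"
  by (simp add: prime_elem_const_poly_iff prime_elem_linear_field_poly)

lemma prime_elem_z: "prime_elem ([:0, 1:] :: 'k::field_gcd poly poly)"
  by (rule prime_elem_linear_poly) auto

text \<open>The point (a', b') is a witness: f is nonzero there although l vanishes, so the prime l
  does not divide the numerator of f. Hence \<open>l ^ k\<close> survives in the reduced
  denominator, and at (a, b) numerator and denominator both vanish.\<close>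

lemma indeterminate_aux:
  fixes f :: "'k::field_gcd ratfun"
  assumes l: "prime_elem l" "poly2 l a b = 0" "poly2 l a' b' = 0"
    and f: "defined_at f a b" "value_at f a b = 0" "defined_at f a' b'" "value_at f a' b' \<noteq> 0"
    and k: "k \<noteq> 0"
  shows "indeterminate_at (f / to_fract l ^ k) a b"
proof -
  define g where "g = f / to_fract l ^ k"
  define n d where nd: "n = num f" "d = den f"
  have l0: "l \<noteq> 0" using l(1) by auto
  have tfp: "to_fract l ^ k = to_fract (l ^ k)" by (induction k) auto
  have d0: "d \<noteq> 0" by (simp add: nd)
  have f_eq: "f = to_fract n / to_fract d" by (simp add: nd num_div_den)
  have g: "g = to_fract n / to_fract (d * l ^ k)"
    unfolding g_def by (simp add: f_eq tfp)
  obtain r where r: "n = num g * r" "d * l ^ k = den g * r"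
    using num_den_reduced[OF g] l0 d0 by auto
  have n0: "poly2 n a b = 0" and n1: "poly2 n a' b' \<noteq> 0" and d1: "poly2 d a b \<noteq> 0"
    using f by (auto simp: nd value_at_def defined_at_def)
  have "\<not> l dvd n"
    using n1 l(3) by (auto elim!: dvdE)
  then have nr: "\<not> l dvd r" using r(1) by auto
  have "l ^ k dvd den g * r" using r(2) by (metis dvd_triv_right)
  then have "l ^ k dvd den g"
    using prime_elem_imp_coprime[OF l(1) nr]
    by (simp add: coprime_dvd_mult_left_iff coprime_power_left_iff)
  then obtain s where s: "den g = l ^ k * s" ..
  have "l ^ k * d = l ^ k * (s * r)" using r(2) s by (simp add: mult_ac)
  then have "d = s * r" using l0 by simp
  \<comment> \<open>The cancelled factor r divides d, which is nonzero at (a, b); so the zero of n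
    there stays in the reduced numerator.\<close>
  then have "poly2 r a b \<noteq> 0" using d1 by auto
  then have "poly2 (num g) a b = 0" using n0 r(1) by auto
  moreover have "poly2 (den g) a b = 0" using s l(2) k by simp
  ultimately show ?thesis by (simp add: indeterminate_at_def g_def)
qed

lemma indeterminate_over_y:
  assumes "defined_at f 0 b" "value_at f 0 b = 0" "defined_at f 0 b'" "value_at f 0 b' \<noteq> 0" "k \<noteq> 0"
  shows "indeterminate_at (f / var_y ^ k) 0 b"
  unfolding var_y_def using assms by (intro indeterminate_aux[OF prime_elem_y, of _ _ 0 b']) auto

lemma indeterminate_over_z:
  assumes "defined_at f a 0" "value_at f a 0 = 0" "defined_at f a' 0" "value_at f a' 0 \<noteq> 0" "k \<noteq> 0"
  shows "indeterminate_at (f / var_z ^ k) a 0"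
  unfolding var_z_def using assms by (intro indeterminate_aux[OF prime_elem_z, of _ _ a' 0]) auto

section \<open>Substitution of rational functions\<close>

text \<open>Algebraic independence of Y and Z over the coefficients. It keeps every denominator
  nonzero under substitution, which makes \<open>subst\<close> by (Y, Z) a homomorphism of
  fields.\<close>

definition dominant :: "'k::field_gcd ratfun \<Rightarrow> 'k ratfun \<Rightarrow> bool" where
  "dominant Y Z \<longleftrightarrow> (\<forall>p. poly2_subst p Y Z = 0 \<longrightarrow> p = 0)"

lemma subst_fraction:
  assumes f: "f = to_fract p / to_fract q" and q: "poly2_subst q Y Z \<noteq> 0"
  shows "subst f Y Z = poly2_subst p Y Z / poly2_subst q Y Z"
proof -
  have "q \<noteq> 0" using q by auto
  then obtain r where r: "p = num f * r" "q = den f * r" using num_den_reduced f by blast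
  have "poly2_subst r Y Z \<noteq> 0" using q r by auto
  moreover have "poly2_subst p Y Z = poly2_subst (num f) Y Z * poly2_subst r Y Z"
    "poly2_subst q Y Z = poly2_subst (den f) Y Z * poly2_subst r Y Z"
    using r by (metis poly2_subst_simps(5))+
  ultimately show ?thesis
    by (simp add: subst_def)
qed

lemma subst_to_fract [simp]: "subst (to_fract p) Y Z = poly2_subst p Y Z"
  using subst_fraction[of "to_fract p" p 1 Y Z] by simp

lemma subst_basic [simp]:
  "subst (cst c) Y Z = cst c" "subst var_y Y Z = Y" "subst var_z Y Z = Z"
  "subst 0 Y Z = 0" "subst 1 Y Z = 1" "subst (numeral n) Y Z = numeral n"
proof -
  show *: "subst (cst c) Y Z = cst c" for c by (simp add: cst_def[of c] del: poly2_subst_const)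
      (simp add: cst_def)
  show "subst var_y Y Z = Y" "subst var_z Y Z = Z" by (simp_all add: var_y_def var_z_def)
  show "subst 0 Y Z = 0" "subst 1 Y Z = 1" "subst (numeral n) Y Z = numeral n"
    using *[of 0] *[of 1] *[of "numeral n"] by simp_all
qed

lemma
  assumes "dominant Y Z"
  shows subst_add [simp]: "subst (f + g) Y Z = subst f Y Z + subst g Y Z"
    and subst_diff [simp]: "subst (f - g) Y Z = subst f Y Z - subst g Y Z"
    and subst_mult [simp]: "subst (f * g) Y Z = subst f Y Z * subst g Y Z"
    and subst_divide [simp]: "subst (f / g) Y Z = subst f Y Z / subst g Y Z"
proof -
  define n d n' d' where nd: "n = num f" "d = den f" "n' = num g" "d' = den g"
  have f: "f = to_fract n / to_fract d" and g: "g = to_fract n' / to_fract d'"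
    by (simp_all add: nd num_div_den)
  have nz: "d \<noteq> 0" "d' \<noteq> 0" by (simp_all add: nd)
  have inj: "poly2_subst p Y Z \<noteq> 0" if "p \<noteq> 0" for p
    using assms that by (auto simp: dominant_def)
  have sf: "subst f Y Z = poly2_subst n Y Z / poly2_subst d Y Z"
    and sg: "subst g Y Z = poly2_subst n' Y Z / poly2_subst d' Y Z"
    by (simp_all add: subst_def nd)
  have d: "poly2_subst d Y Z \<noteq> 0" "poly2_subst d' Y Z \<noteq> 0" using inj nz by auto
  have "f + g = to_fract (n * d' + n' * d) / to_fract (d * d')"
    using nz by (simp add: f g add_frac_eq)
  from subst_fraction[OF this, of Y Z] show "subst (f + g) Y Z = subst f Y Z + subst g Y Z"
    using d by (simp add: sf sg add_frac_eq)
  have "f - g = to_fract (n * d' - n' * d) / to_fract (d * d')"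
    using nz by (simp add: f g diff_frac_eq)
  from subst_fraction[OF this, of Y Z] show "subst (f - g) Y Z = subst f Y Z - subst g Y Z"
    using d by (simp add: sf sg diff_frac_eq)
  have "f * g = to_fract (n * n') / to_fract (d * d')"
    by (simp add: f g)
  from subst_fraction[OF this, of Y Z] show "subst (f * g) Y Z = subst f Y Z * subst g Y Z"
    using d by (simp add: sf sg)
  show "subst (f / g) Y Z = subst f Y Z / subst g Y Z"
  proof (cases "n' = 0")
    case True
    then show ?thesis by (simp add: g)
  next
    case False
    have "f / g = to_fract (n * d') / to_fract (d * n')"
      by (simp add: f g)
    from subst_fraction[OF this, of Y Z] show ?thesis
      using d inj[OF False] by (simp add: sf sg)
  qed
qed

lemma
  assumes "dominant Y Z"
  shows subst_uminus [simp]: "subst (- f) Y Z = - subst f Y Z"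
    and subst_power [simp]: "subst (f ^ n) Y Z = subst f Y Z ^ n"
  using subst_diff[OF assms, of 0 f] subst_mult[OF assms]
  by (simp, induction n) simp_all

text \<open>A rational left inverse recovers p from p(Y, Z), so p(Y, Z) = 0 forces p = 0.\<close>

lemma dominantI:
  assumes Y: "subst Y U V = var_y" and Z: "subst Z U V = var_z"
  shows "dominant Y Z"
proof -
  have vars: "var_y \<noteq> (0 :: 'a ratfun)" "var_z \<noteq> (0 :: 'a ratfun)"
    by (simp_all add: var_y_def var_z_def)
  \<comment> \<open>Substitution of (U, V) is not known to be additive here. The induction therefore
    carries an explicit fraction n / d for p(Y, Z) whose denominator stays nonzero after that
    substitution.\<close>
  have inv: "\<exists>n d. poly2_subst p Y Z = to_fract n / to_fract d \<and> poly2_subst d U V \<noteq> 0 \<and>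
      to_fract p = poly2_subst n U V / poly2_subst d U V" for p
  proof (induction p rule: poly2_induct)
    case (const c)
    then show ?case
      by (intro exI[of _ "[:[:c:]:]"] exI[of _ 1]) (simp add: cst_def)
  next
    case y
    have "poly2_subst (den Y) U V \<noteq> 0" using Y vars by (auto simp: subst_def)
    then show ?case using Y num_div_den[of Y]
      by (intro exI[of _ "num Y"] exI[of _ "den Y"]) (simp add: subst_def var_y_def)
  next
    case z
    have "poly2_subst (den Z) U V \<noteq> 0" using Z vars by (auto simp: subst_def)
    then show ?case using Z num_div_den[of Z]
      by (intro exI[of _ "num Z"] exI[of _ "den Z"]) (simp add: subst_def var_z_def)
  next
    case (add p q)
    then obtain n d n' d' where
      "poly2_subst p Y Z = to_fract n / to_fract d" "poly2_subst d U V \<noteq> 0"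
      "to_fract p = poly2_subst n U V / poly2_subst d U V"
      "poly2_subst q Y Z = to_fract n' / to_fract d'" "poly2_subst d' U V \<noteq> 0"
      "to_fract q = poly2_subst n' U V / poly2_subst d' U V" by blast
    moreover from this have "d \<noteq> 0" "d' \<noteq> 0" by auto
    ultimately show ?case
      by (intro exI[of _ "n * d' + n' * d"] exI[of _ "d * d'"]) (simp add: add_frac_eq)
  next
    case (mult p q)
    then obtain n d n' d' where
      "poly2_subst p Y Z = to_fract n / to_fract d" "poly2_subst d U V \<noteq> 0"
      "to_fract p = poly2_subst n U V / poly2_subst d U V"
      "poly2_subst q Y Z = to_fract n' / to_fract d'" "poly2_subst d' U V \<noteq> 0"
      "to_fract q = poly2_subst n' U V / poly2_subst d' U V" by blast
    then show ?case
      by (intro exI[of _ "n * n'"] exI[of _ "d * d'"]) simp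
  qed
  show ?thesis
    unfolding dominant_def
  proof (intro allI impI)
    fix p assume p: "poly2_subst p Y Z = 0"
    obtain n d where nd: "poly2_subst p Y Z = to_fract n / to_fract d" "poly2_subst d U V \<noteq> 0"
      "to_fract p = poly2_subst n U V / poly2_subst d U V" using inv by blast
    then have "d \<noteq> 0" by auto
    then have "n = 0" using nd(1) p by simp
    then show "p = 0" using nd(3) by simp
  qed
qed

lemma
  assumes YZ: "defined_at Y a b" "defined_at Z a b"
    and f: "defined_at f (value_at Y a b) (value_at Z a b)"
  shows defined_at_subst: "defined_at (subst f Y Z) a b"
    and value_at_subst: "value_at (subst f Y Z) a b = value_at f (value_at Y a b) (value_at Z a b)"
proof -
  have p: "defined_at (poly2_subst p Y Z) a b \<and>
      value_at (poly2_subst p Y Z) a b = poly2 p (value_at Y a b) (value_at Z a b)" for p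
    by (induction p rule: poly2_induct) (use YZ in auto)
  then show "defined_at (subst f Y Z) a b"
    "value_at (subst f Y Z) a b = value_at f (value_at Y a b) (value_at Z a b)"
    using f by (auto simp: subst_def defined_at_def[of f] value_at_def[of f])
qed

lemma var_nonzero [simp]: "var_y \<noteq> (0 :: 'k::field_gcd ratfun)" "var_z \<noteq> (0 :: 'k ratfun)"
  by (simp_all add: var_y_def var_z_def)

lemma var_y_neq_cst [simp]: "var_y \<noteq> cst c"
  using defined_at_basic(8)[of "c + 1" 0] by (metis add_cancel_left_right defined_at_basic(7) zero_neq_one)

lemma var_z_neq_cst [simp]: "var_z \<noteq> cst c"
  using defined_at_basic(9)[of 0 "c + 1"] by (metis add_cancel_left_right defined_at_basic(7) zero_neq_one)

lemma subst_poly_fraction: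
  assumes "poly2_subst q Y Z \<noteq> 0"
  shows "subst (to_fract p / to_fract q) Y Z = poly2_subst p Y Z / poly2_subst q Y Z"
  using subst_fraction[OF refl assms] .

text \<open>The rules for \<open>subst\<close> presuppose dominance. To prove dominance of the
  coordinate changes, their components are written as explicit fractions of polynomials, for which
  \<open>subst\<close> can be evaluated directly.\<close>

lemma vars_as_to_fract:
  "var_y + cst a = to_fract ([:[:0, 1:]:] + [:[:a:]:])"
  "var_z + cst a = to_fract ([:0, 1:] + [:[:a:]:])"
  "var_y - cst a = to_fract ([:[:0, 1:]:] - [:[:a:]:])"
  "var_z - cst a = to_fract ([:0, 1:] - [:[:a:]:])"
  "var_y * var_z + cst b = to_fract ([:[:0, 1:]:] * [:0, 1:] + [:[:b:]:])"
  "1 / var_y = to_fract 1 / to_fract [:[:0, 1:]:]"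
  "1 / var_z = to_fract 1 / to_fract [:0, 1:]"
  "var_y / var_z = to_fract [:[:0, 1:]:] / to_fract [:0, 1:]"
  "var_z / var_y = to_fract [:0, 1:] / to_fract [:[:0, 1:]:]"
  unfolding to_fract_add to_fract_diff to_fract_mult to_fract_1
  unfolding var_y_def var_z_def cst_def by (rule refl)+

lemma dominant_uv [simp]: "dominant (var_y + cst a) (var_y * var_z + cst b)"
  unfolding vars_as_to_fract
  by (rule dominantI[of _ "var_y - cst a" "(var_z - cst b) / (var_y - cst a)"];
      simp only: subst_to_fract poly2_subst_simps poly2_subst_const poly2_subst_y poly2_subst_z; simp)

lemma dominant_UV [simp]: "dominant (var_y * var_z + cst a) (var_z + cst b)"
  unfolding vars_as_to_fract
  by (rule dominantI[of _ "(var_y - cst a) / (var_z - cst b)" "var_z - cst b"];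
      simp only: subst_to_fract poly2_subst_simps poly2_subst_const poly2_subst_y poly2_subst_z; simp)

text \<open>These special cases match the terms that remain after \<open>cst 0\<close> has been
  simplified away.\<close>

lemma dominant_uv0 [simp]: "dominant var_y (var_y * var_z + cst b)"
  using dominant_uv[of 0 b] by simp

lemma dominant_uv00 [simp]: "dominant var_y (var_y * var_z)"
  using dominant_uv[of 0 0] by simp

lemma dominant_UV0 [simp]: "dominant (var_y * var_z) (var_z + cst b)"
  using dominant_UV[of 0 b] by simp

lemma dominant_UV00 [simp]: "dominant (var_y * var_z) var_z"
  using dominant_UV[of 0 0] by simp

lemma dominant_infinity_y [simp]: "dominant (1 / var_y) (var_z / var_y)"
  unfolding vars_as_to_fract
  by (rule dominantI[of _ "1 / var_y" "var_z / var_y"]; subst subst_poly_fraction; simp)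

lemma dominant_infinity_z [simp]: "dominant (var_y / var_z) (1 / var_z)"
  unfolding vars_as_to_fract
  by (rule dominantI[of _ "var_y / var_z" "1 / var_z"]; subst subst_poly_fraction; simp)

section \<open>Derivations\<close>

definition derivation :: "('a::comm_ring_1 \<Rightarrow> 'a) \<Rightarrow> bool" where
  "derivation d \<longleftrightarrow> (\<forall>a b. d (a + b) = d a + d b \<and> d (a * b) = d a * b + a * d b)"

lemma
  assumes "derivation d"
  shows derivation_add: "d (a + b) = d a + d b"
    and derivation_mult: "d (a * b) = d a * b + a * d b"
    and derivation_0: "d 0 = 0"
    and derivation_1: "d 1 = 0"
    and derivation_uminus: "d (- a) = - d a"
    and derivation_diff: "d (a - b) = d a - d b"
    and derivation_of_nat: "d (of_nat n) = 0"
    and derivation_numeral: "d (numeral m) = 0"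
    and derivation_power2: "d (a\<^sup>2) = 2 * a * d a"
    and derivation_power3: "d (a ^ 3) = 3 * a\<^sup>2 * d a"
proof -
  show add: "d (a + b) = d a + d b" and mult: "d (a * b) = d a * b + a * d b" for a b
    using assms by (auto simp: derivation_def)
  show d0: "d 0 = 0" using add[of 0 0] by simp
  show d1: "d 1 = 0" using mult[of 1 1] by simp
  have "d a + d (- a) = 0" for a using add[of a "- a"] d0 by simp
  then show um: "d (- a) = - d a" for a by (simp add: add_eq_0_iff)
  show "d (a - b) = d a - d b" using add[of a "- b"] um by simp
  show n: "d (of_nat n) = 0" for n by (induction n) (simp_all add: d0 add d1)
  show "d (numeral m) = 0" using n[of "numeral m"] by simp
  show "d (a\<^sup>2) = 2 * a * d a" by (simp add: power2_eq_square mult algebra_simps)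
  show "d (a ^ 3) = 3 * a\<^sup>2 * d a"
    by (simp add: power2_eq_square power3_eq_cube mult algebra_simps)
qed

lemma derivation_divide:
  fixes d :: "'a::field \<Rightarrow> 'a"
  assumes d: "derivation d"
  shows "d (a / b) = (d a * b - a * d b) / b\<^sup>2"
proof (cases "b = 0")
  case False
  have "d a = d (a / b * b)" using False by simp
  also have "\<dots> = d (a / b) * b + a / b * d b" by (rule derivation_mult[OF d])
  finally show ?thesis using False by (simp add: field_simps power2_eq_square)
qed (simp add: derivation_0[OF d])

lemmas derivation_simps = derivation_add derivation_mult derivation_0 derivation_1
  derivation_uminus derivation_diff derivation_of_nat derivation_numeral derivation_power2 derivation_power3

lemma derivation_pderiv: "derivation pderiv"
  by (simp add: derivation_def pderiv_add pderiv_mult algebra_simps)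

lemma derivation_map_poly:
  assumes d: "derivation d"
  shows "derivation (map_poly d)"
proof -
  have d0: "d 0 = 0" using derivation_0[OF d] .
  have sum: "d (sum f A) = (\<Sum>i\<in>A. d (f i))" for f :: "nat \<Rightarrow> 'a" and A
    by (induction A rule: infinite_finite_induct) (simp_all add: d0 derivation_add[OF d])
  show ?thesis
    unfolding derivation_def
  proof (intro allI conjI poly_eqI)
    fix p q n
    show "coeff (map_poly d (p + q)) n = coeff (map_poly d p + map_poly d q) n"
      by (simp add: coeff_map_poly d0 derivation_add[OF d])
    show "coeff (map_poly d (p * q)) n = coeff (map_poly d p * q + p * map_poly d q) n"
      by (simp add: coeff_map_poly d0 coeff_mult sum derivation_mult[OF d] sum.distrib)
  qed
qed

text \<open>For p = n r and q = m r the two terms with d r cancel, and what remains is r^2 times the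
  reduced expression; so the quotient rule does not depend on the chosen fraction.\<close>

lemma quotient_rule_fraction:
  assumes d: "derivation d" and q: "q \<noteq> 0"
  shows "quotient_rule d (to_fract p / to_fract q) = to_fract (d p * q - p * d q) / to_fract q ^ 2"
proof -
  define f where "f = to_fract p / to_fract q"
  obtain r where r: "p = num f * r" "q = den f * r" "r \<noteq> 0"
    using num_den_reduced[OF f_def q] by blast
  have m: "den f \<noteq> 0" by simp
  have dp: "d p = d (num f) * r + num f * d r" and dq: "d q = d (den f) * r + den f * d r"
    using r derivation_mult[OF d] by metis+
  have "(d p * q - p * d q) = (d (num f) * den f - num f * d (den f)) * r ^ 2"
    unfolding dp dq by (simp only: r(1,2)) (simp add: algebra_simps power2_eq_square)
  moreover have "to_fract q ^ 2 = to_fract (den f) ^ 2 * to_fract (r ^ 2)"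
    by (subst r(2)) (simp add: power2_eq_square)
  ultimately show ?thesis
    using m r(3) unfolding quotient_rule_def f_def[symmetric] Fract_conv_to_fract
    by (simp add: power2_eq_square)
qed

lemma derivation_quotient_rule:
  assumes d: "derivation d"
  shows "derivation (quotient_rule d)"
  unfolding derivation_def
proof (intro allI)
  fix f g :: "'a ratfun"
  define n m n' m' where nd: "n = num f" "m = den f" "n' = num g" "m' = den g"
  have f: "f = to_fract n / to_fract m" and g: "g = to_fract n' / to_fract m'"
    by (simp_all add: nd num_div_den)
  have nz: "m \<noteq> 0" "m' \<noteq> 0" by (simp_all add: nd)
  have df: "quotient_rule d f = to_fract (d n * m - n * d m) / to_fract m ^ 2"
    and dg: "quotient_rule d g = to_fract (d n' * m' - n' * d m') / to_fract m' ^ 2"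
    unfolding f g using quotient_rule_fraction[OF d] nz by blast+
  have e1: "f + g = to_fract (n * m' + n' * m) / to_fract (m * m')"
    using nz by (simp add: f g add_frac_eq)
  have e2: "f * g = to_fract (n * n') / to_fract (m * m')"
    by (simp add: f g)
  have mm: "m * m' \<noteq> 0" using nz by simp
  have id1: "((dn * m' + n * dm' + (dn' * m + n' * dm)) * (m * m')
      - (n * m' + n' * m) * (dm * m' + m * dm')) / (m * m') ^ 2
      = (dn * m - n * dm) / m ^ 2 + (dn' * m' - n' * dm') / m' ^ 2"
    if "m \<noteq> 0" "m' \<noteq> 0" for n m n' m' dn dm dn' dm' :: "'a ratfun"
    using that by (simp add: divide_simps power2_eq_square) (simp add: algebra_simps)
  have id2: "((dn * n' + n * dn') * (m * m') - n * n' * (dm * m' + m * dm')) / (m * m') ^ 2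
      = (dn * m - n * dm) / m ^ 2 * (n' / m') + n / m * ((dn' * m' - n' * dm') / m' ^ 2)"
    if "m \<noteq> 0" "m' \<noteq> 0" for n m n' m' dn dm dn' dm' :: "'a ratfun"
    using that by (simp add: divide_simps power2_eq_square) (simp add: algebra_simps)
  have tm: "to_fract m \<noteq> 0" "to_fract m' \<noteq> 0" using nz by simp_all
  have "quotient_rule d (f + g) = to_fract (d (n * m' + n' * m) * (m * m')
      - (n * m' + n' * m) * d (m * m')) / to_fract (m * m') ^ 2"
    unfolding e1 by (rule quotient_rule_fraction[OF d mm])
  also have "\<dots> = quotient_rule d f + quotient_rule d g"
    unfolding df dg derivation_add[OF d] derivation_mult[OF d] to_fract_add to_fract_diff to_fract_mult
    by (rule id1[OF tm])
  finally have "quotient_rule d (f + g) = quotient_rule d f + quotient_rule d g" .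
  moreover have "quotient_rule d (f * g) = to_fract (d (n * n') * (m * m')
      - n * n' * d (m * m')) / to_fract (m * m') ^ 2"
    unfolding e2 by (rule quotient_rule_fraction[OF d mm])
  then have "quotient_rule d (f * g) = quotient_rule d f * g + f * quotient_rule d g"
    unfolding df dg derivation_mult[OF d] to_fract_add to_fract_diff to_fract_mult id2[OF tm]
    by (simp only: f[symmetric] g[symmetric])
  ultimately show "quotient_rule d (f + g) = quotient_rule d f + quotient_rule d g \<and>
    quotient_rule d (f * g) = quotient_rule d f * g + f * quotient_rule d g" ..
qed

lemma derivation_D_y: "derivation D_y"
  unfolding D_y_def by (intro derivation_quotient_rule derivation_map_poly derivation_pderiv)

lemma derivation_D_z: "derivation D_z"
  unfolding D_z_def by (intro derivation_quotient_rule derivation_pderiv)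

lemma derivation_D_x: "derivation \<delta> \<Longrightarrow> derivation (D_x \<delta>)"
  unfolding D_x_def by (intro derivation_quotient_rule derivation_map_poly)

lemma quotient_rule_to_fract:
  assumes d: "derivation d"
  shows "quotient_rule d (to_fract p) = to_fract (d p)"
  using quotient_rule_fraction[OF d, of 1 p] by (simp add: derivation_1[OF d])

lemma D_y_basic [simp]: "D_y (cst c) = 0" "D_y var_y = 1" "D_y var_z = 0"
  by (simp_all add: D_y_def cst_def var_y_def var_z_def map_poly_pCons map_poly_1 pderiv_pCons
      quotient_rule_to_fract[OF derivation_map_poly[OF derivation_pderiv]] flip: one_pCons)

lemma D_z_basic [simp]: "D_z (cst c) = 0" "D_z var_y = 0" "D_z var_z = 1"
  by (simp_all add: D_z_def cst_def var_y_def var_z_def pderiv_pCons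
      quotient_rule_to_fract[OF derivation_pderiv] flip: one_pCons)

lemmas D_y_simps = derivation_simps[OF derivation_D_y] derivation_divide[OF derivation_D_y]
lemmas D_z_simps = derivation_simps[OF derivation_D_z] derivation_divide[OF derivation_D_z]

lemma D_x_basic:
  assumes \<delta>: "derivation \<delta>"
  shows "D_x \<delta> (cst c) = cst (\<delta> c)" "D_x \<delta> var_y = 0" "D_x \<delta> var_z = 0"
  using derivation_0[OF \<delta>] derivation_1[OF \<delta>]
  by (simp_all add: D_x_def cst_def var_y_def var_z_def map_poly_pCons map_poly_1
      quotient_rule_to_fract[OF derivation_map_poly[OF derivation_map_poly[OF \<delta>]]])

lemma
  assumes \<delta>: "derivation \<delta>"
  shows derivation_derivative_along: "derivation (derivative_along \<delta> S)"
    and derivative_along_basic: "derivative_along \<delta> S (cst c) = cst (\<delta> c)"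
      "derivative_along \<delta> S var_y = fst S" "derivative_along \<delta> S var_z = snd S"
  by (simp_all add: derivation_def derivative_along_def D_x_basic[OF \<delta>]
      derivation_simps[OF derivation_D_x[OF \<delta>]] D_y_simps D_z_simps algebra_simps)

section \<open>Changes of charts\<close>

text \<open>Differentiating z - b = u v gives v' = (z' - b' - v u') / u. This division by the
  equation of the exceptional curve and the velocities of the centre drive all the cascades.\<close>

lemma blowup_uv_eq:
  fixes P Q :: "'k::field_gcd ratfun" and a b :: 'k
  assumes \<delta>: "derivation \<delta>"
  defines "P' \<equiv> subst P (var_y + cst a) (var_y * var_z + cst b) - cst (\<delta> a)"
  shows "blowup_uv \<delta> (P, Q) a b =
    (P', (subst Q (var_y + cst a) (var_y * var_z + cst b) - cst (\<delta> b) - var_z * P') / var_y)"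
  unfolding blowup_uv_def in_coordinates_def P'_def
  by (simp add: derivation_derivative_along[OF \<delta>] derivation_simps derivation_divide
      derivative_along_basic[OF \<delta>]) (simp add: field_simps power2_eq_square)

lemma blowup_UV_eq:
  fixes P Q :: "'k::field_gcd ratfun" and a b :: 'k
  assumes \<delta>: "derivation \<delta>"
  defines "Q' \<equiv> subst Q (var_y * var_z + cst a) (var_z + cst b) - cst (\<delta> b)"
  shows "blowup_UV \<delta> (P, Q) a b =
    ((subst P (var_y * var_z + cst a) (var_z + cst b) - cst (\<delta> a) - var_y * Q') / var_z, Q')"
  unfolding blowup_UV_def in_coordinates_def Q'_def
  by (simp add: derivation_derivative_along[OF \<delta>] derivation_simps derivation_divide
      derivative_along_basic[OF \<delta>]) (simp add: field_simps power2_eq_square)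

lemma in_coordinates_infinity_y:
  fixes P Q :: "'k::field_gcd ratfun"
  assumes \<delta>: "derivation \<delta>"
  shows "in_coordinates \<delta> (P, Q) (1 / var_y, var_z / var_y) (1 / var_y, var_z / var_y) =
    (- (var_y ^ 2 * subst P (1 / var_y) (var_z / var_y)),
     var_y * (subst Q (1 / var_y) (var_z / var_y) - var_z * subst P (1 / var_y) (var_z / var_y)))"
  unfolding in_coordinates_def
  by (simp add: derivation_derivative_along[OF \<delta>] derivation_simps derivation_divide
      derivative_along_basic[OF \<delta>]) (simp add: field_simps power2_eq_square)

lemma in_coordinates_infinity_z:
  fixes P Q :: "'k::field_gcd ratfun"
  assumes \<delta>: "derivation \<delta>"
  shows "in_coordinates \<delta> (P, Q) (var_y / var_z, 1 / var_z) (var_y / var_z, 1 / var_z) =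
    (var_z * (subst P (var_y / var_z) (1 / var_z) - var_y * subst Q (var_y / var_z) (1 / var_z)),
     - (var_z ^ 2 * subst Q (var_y / var_z) (1 / var_z)))"
  unfolding in_coordinates_def
  by (simp add: derivation_derivative_along[OF \<delta>] derivation_simps derivation_divide
      derivative_along_basic[OF \<delta>]) (simp add: field_simps power2_eq_square)

section \<open>Taylor expansion of rational functions\<close>

lemma
  assumes "defined_at f a b"
  shows defined_at_D_y [simp]: "defined_at (D_y f) a b"
    and defined_at_D_z [simp]: "defined_at (D_z f) a b"
proof -
  have d: "poly2 (den f * den f) a b \<noteq> 0" using assms by (simp add: defined_at_def)
  have *: "defined_at (quotient_rule d f) a b" if "derivation d" for d
    using defined_atI(1)[OF _ d, of "quotient_rule d f" "d (num f) * den f - num f * d (den f)"]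
    by (simp add: quotient_rule_def Fract_conv_to_fract power2_eq_square)
  show "defined_at (D_y f) a b" "defined_at (D_z f) a b"
    unfolding D_y_def D_z_def by (intro * derivation_map_poly derivation_pderiv)+
qed

text \<open>f lies in the square of the maximal ideal of the local ring at (a, b).\<close>

definition vanishes_to_second_order :: "'k::field_gcd ratfun \<Rightarrow> 'k \<Rightarrow> 'k \<Rightarrow> bool" where
  "vanishes_to_second_order f a b \<longleftrightarrow> (\<exists>A B C.
     defined_at A a b \<and> defined_at B a b \<and> defined_at C a b \<and>
     f = (var_y - cst a)\<^sup>2 * A + (var_y - cst a) * (var_z - cst b) * B + (var_z - cst b)\<^sup>2 * C)"

lemma vanishes_to_second_orderI:
  assumes "defined_at A a b" "defined_at B a b" "defined_at C a b"
    "f = (var_y - cst a)\<^sup>2 * A + (var_y - cst a) * (var_z - cst b) * B + (var_z - cst b)\<^sup>2 * C"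
  shows "vanishes_to_second_order f a b"
  using assms unfolding vanishes_to_second_order_def by blast

lemma vanishes_to_second_order_add:
  assumes "vanishes_to_second_order f a b" "vanishes_to_second_order g a b"
  shows "vanishes_to_second_order (f + g) a b"
proof -
  obtain A B C where 1: "defined_at A a b" "defined_at B a b" "defined_at C a b"
    "f = (var_y - cst a)\<^sup>2 * A + (var_y - cst a) * (var_z - cst b) * B + (var_z - cst b)\<^sup>2 * C"
    using assms(1) unfolding vanishes_to_second_order_def by blast
  obtain A' B' C' where 2: "defined_at A' a b" "defined_at B' a b" "defined_at C' a b"
    "g = (var_y - cst a)\<^sup>2 * A' + (var_y - cst a) * (var_z - cst b) * B' + (var_z - cst b)\<^sup>2 * C'"
    using assms(2) unfolding vanishes_to_second_order_def by blast
  show ?thesis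
    by (rule vanishes_to_second_orderI[of "A + A'" _ _ "B + B'" "C + C'"])
      (simp_all add: 1 2 algebra_simps)
qed

lemma vanishes_to_second_order_mult:
  assumes "vanishes_to_second_order f a b" "defined_at g a b"
  shows "vanishes_to_second_order (g * f) a b"
proof -
  obtain A B C where 1: "defined_at A a b" "defined_at B a b" "defined_at C a b"
    "f = (var_y - cst a)\<^sup>2 * A + (var_y - cst a) * (var_z - cst b) * B + (var_z - cst b)\<^sup>2 * C"
    using assms(1) unfolding vanishes_to_second_order_def by blast
  show ?thesis
    by (rule vanishes_to_second_orderI[of "g * A" _ _ "g * B" "g * C"])
      (simp_all add: 1 assms(2) algebra_simps)
qed

definition linear_part :: "'k::field_gcd \<Rightarrow> 'k \<Rightarrow> 'k \<Rightarrow> 'k \<Rightarrow> 'k \<Rightarrow> 'k ratfun" where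
  "linear_part a b v p r = cst v + cst p * (var_y - cst a) + cst r * (var_z - cst b)"

lemma vanishes_to_second_order_linear_mult:
  "vanishes_to_second_order
     (linear_part a b v p r * linear_part a b v' p' r'
      - linear_part a b (v * v') (v * p' + p * v') (v * r' + r * v')) a b"
  by (rule vanishes_to_second_orderI[of "cst (p * p')" _ _ "cst (p * r' + r * p')" "cst (r * r')"])
    (simp_all add: linear_part_def algebra_simps power2_eq_square)

lemma defined_at_linear_part [simp]: "defined_at (linear_part a b v p r) a' b'"
  by (simp add: linear_part_def)

lemma taylor_poly:
  "\<exists>v p r. vanishes_to_second_order (to_fract f - linear_part a b v p r) a b"
proof (induction f rule: poly2_induct)
  case (const c)
  have "vanishes_to_second_order (to_fract [:[:c:]:] - linear_part a b c 0 0) a b"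
    by (rule vanishes_to_second_orderI[of 0 _ _ 0 0]) (simp_all add: linear_part_def cst_def)
  then show ?case by blast
next
  case y
  have "vanishes_to_second_order (to_fract [:[:0, 1:]:] - linear_part a b a 1 0) a b"
    unfolding var_y_def[symmetric]
    by (rule vanishes_to_second_orderI[of 0 _ _ 0 0]) (simp_all add: linear_part_def)
  then show ?case by blast
next
  case z
  have "vanishes_to_second_order (to_fract [:0, 1:] - linear_part a b b 0 1) a b"
    unfolding var_z_def[symmetric]
    by (rule vanishes_to_second_orderI[of 0 _ _ 0 0]) (simp_all add: linear_part_def)
  then show ?case by blast
next
  case (add f g)
  then obtain v p r v' p' r' where
    "vanishes_to_second_order (to_fract f - linear_part a b v p r) a b"
    "vanishes_to_second_order (to_fract g - linear_part a b v' p' r') a b" by blast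
  from vanishes_to_second_order_add[OF this]
  have "vanishes_to_second_order (to_fract (f + g) - linear_part a b (v + v') (p + p') (r + r')) a b"
    by (simp add: linear_part_def algebra_simps)
  then show ?case by blast
next
  case (mult f g)
  then obtain v p r v' p' r' where
    1: "vanishes_to_second_order (to_fract f - linear_part a b v p r) a b" and
    2: "vanishes_to_second_order (to_fract g - linear_part a b v' p' r') a b" by blast
  let ?l = "linear_part a b v p r" and ?l' = "linear_part a b v' p' r'"
    and ?l'' = "linear_part a b (v * v') (v * p' + p * v') (v * r' + r * v')"
  have "vanishes_to_second_order (to_fract g * (to_fract f - ?l)) a b"
    by (rule vanishes_to_second_order_mult[OF 1]) simp
  moreover have "vanishes_to_second_order (?l * (to_fract g - ?l')) a b"
    by (rule vanishes_to_second_order_mult[OF 2]) simp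
  moreover note vanishes_to_second_order_linear_mult[of a b v p r v' p' r']
  ultimately have "vanishes_to_second_order (to_fract g * (to_fract f - ?l)
      + ?l * (to_fract g - ?l') + (?l * ?l' - ?l'')) a b"
    by (intro vanishes_to_second_order_add)
  also have "to_fract g * (to_fract f - ?l) + ?l * (to_fract g - ?l') + (?l * ?l' - ?l'')
      = to_fract (f * g) - ?l''"
    by (simp add: algebra_simps)
  finally show ?case by blast
qed

lemma taylor:
  assumes f: "defined_at f a b"
  obtains A B C where "defined_at A a b" "defined_at B a b" "defined_at C a b"
    "f = cst (value_at f a b) + cst (value_at (D_y f) a b) * (var_y - cst a)
       + cst (value_at (D_z f) a b) * (var_z - cst b)
       + ((var_y - cst a)\<^sup>2 * A + (var_y - cst a) * (var_z - cst b) * B + (var_z - cst b)\<^sup>2 * C)"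
proof -
  define n d where nd: "n = num f" "d = den f"
  have f_eq: "f = to_fract n / to_fract d" by (simp add: nd num_div_den)
  have d: "poly2 d a b \<noteq> 0" using f by (simp add: nd defined_at_def)
  then have d0: "to_fract d \<noteq> 0" by auto
  obtain v p r where n: "vanishes_to_second_order (to_fract n - linear_part a b v p r) a b"
    using taylor_poly by blast
  obtain v' p' r' where d': "vanishes_to_second_order (to_fract d - linear_part a b v' p' r') a b"
    using taylor_poly by blast
  obtain A' B' C' where "defined_at A' a b" "defined_at B' a b" "defined_at C' a b"
    "to_fract d - linear_part a b v' p' r'
      = (var_y - cst a)\<^sup>2 * A' + (var_y - cst a) * (var_z - cst b) * B' + (var_z - cst b)\<^sup>2 * C'"
    using d' unfolding vanishes_to_second_order_def by blast
  then have "value_at (to_fract d - linear_part a b v' p' r') a b = 0" by simp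
  then have v': "v' \<noteq> 0" using d by (auto simp: linear_part_def)
  \<comment> \<open>(V, P, R) is the quotient of the 1-jets (v, p, r) and (v', p', r') of numerator
    and denominator. Then n - l d vanishes to second order, and d is a unit of the local
    ring.\<close>
  define V P R where "V = v / v'" and "P = (p - V * p') / v'" and "R = (r - V * r') / v'"
  let ?l = "linear_part a b V P R"
  have l: "linear_part a b v p r
      = linear_part a b (v' * V) (v' * P + p' * V) (v' * R + r' * V)"
  proof -
    have "v = v' * V" "p = v' * P + p' * V" "r = v' * R + r' * V"
      using v' by (simp_all add: V_def P_def R_def)
    then show ?thesis by (rule arg_cong3[of _ _ _ _ _ _ "linear_part a b"])
  qed
  have "vanishes_to_second_order (- ?l * (to_fract d - linear_part a b v' p' r')) a b"
    by (intro vanishes_to_second_order_mult[OF d']) simp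
  from vanishes_to_second_order_add[OF this
      vanishes_to_second_order_mult[OF vanishes_to_second_order_linear_mult, of "- 1" a b v' p' r' V P R]]
  have "vanishes_to_second_order (linear_part a b v p r - ?l * to_fract d) a b"
    unfolding l by (simp add: algebra_simps)
  from vanishes_to_second_order_add[OF n this]
  have "vanishes_to_second_order (to_fract n - ?l * to_fract d) a b" by simp
  then have "vanishes_to_second_order (1 / to_fract d * (to_fract n - ?l * to_fract d)) a b"
    by (rule vanishes_to_second_order_mult) (use d in simp)
  also have "1 / to_fract d * (to_fract n - ?l * to_fract d) = f - ?l"
    using d0 by (simp add: f_eq field_simps)
  finally obtain A B C where *: "defined_at A a b" "defined_at B a b" "defined_at C a b"
    "f - ?l = (var_y - cst a)\<^sup>2 * A + (var_y - cst a) * (var_z - cst b) * B + (var_z - cst b)\<^sup>2 * C"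
    unfolding vanishes_to_second_order_def by blast
  have **: "f = ?l + ((var_y - cst a)\<^sup>2 * A + (var_y - cst a) * (var_z - cst b) * B
      + (var_z - cst b)\<^sup>2 * C)"
    unfolding *(4)[symmetric] by simp
  have "value_at f a b = V" "value_at (D_y f) a b = P" "value_at (D_z f) a b = R"
    using *(1-3) unfolding ** by (simp_all add: linear_part_def D_y_simps D_z_simps)
  with ** that[OF *(1-3)] show thesis by (simp add: linear_part_def)
qed

section \<open>Following a cascade of blow-ups\<close>

lemma not_base_pointI:
  assumes "\<not> indeterminate_at P a b" "\<not> indeterminate_at Q a b"
  shows "\<not> base_point (P, Q) a b"
  using assms by (simp add: base_point_def)

lemma not_base_point_defined:
  assumes "defined_at P a b" "defined_at Q a b"
  shows "\<not> base_point (P, Q) a b"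
  using assms indeterminate_atD by (auto simp: base_point_def)

lemma regular_at_iff: "regular_at (P, Q) a b \<longleftrightarrow> defined_at P a b \<and> defined_at Q a b"
  by (simp add: regular_at_def defined_at_def)

text \<open>As soon as one base point lies on the new curve, only the rule \<open>blow_up\<close>
  can apply. The result is an equivalence, which is what transports failure of regularity back along
  the cascade.\<close>

lemma regularised_at_uv:
  assumes "blowup_uv \<delta> S a b = T" "C \<noteq> {}" "\<And>c. base_point T 0 c \<longleftrightarrow> c \<in> C"
    and "\<not> base_point (blowup_UV \<delta> S a b) 0 0"
  shows "regularised_at \<delta> S a b \<longleftrightarrow> (\<forall>c\<in>C. regularised_at \<delta> T 0 c)"
proof -
  have "\<not> determinate_on_exceptional_curve \<delta> S a b"
    using assms by (auto simp: determinate_on_exceptional_curve_def)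
  then show ?thesis
    using assms by (subst regularised_at.simps) metis
qed

lemma regularised_at_UV:
  assumes "blowup_UV \<delta> S a b = T" "base_point T 0 0"
    and "\<And>c. \<not> base_point (blowup_uv \<delta> S a b) 0 c"
  shows "regularised_at \<delta> S a b \<longleftrightarrow> regularised_at \<delta> T 0 0"
proof -
  have "\<not> determinate_on_exceptional_curve \<delta> S a b"
    using assms by (auto simp: determinate_on_exceptional_curve_def)
  then show ?thesis
    using assms by (subst regularised_at.simps) metis
qed

text \<open>The point c' witnesses that G is not divisible by y.\<close>

lemma base_point_over_y:
  assumes "\<And>c. defined_at A 0 c" "\<And>c. defined_at G 0 c" "value_at G 0 c' \<noteq> 0"
  shows "base_point (A, G / var_y) 0 c \<longleftrightarrow> value_at G 0 c = 0"
  using indeterminate_over_y[of G c c' 1] determinate_fraction[of G 0 c var_y]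
    indeterminate_atD[of A 0 c] assms by (auto simp: base_point_def)

lemma blowup_uvI:
  assumes "derivation \<delta>" "subst P var_y (var_y * var_z + cst b) = P'"
    "subst Q var_y (var_y * var_z + cst b) - cst (\<delta> b) = Q1" "(Q1 - var_z * P') / var_y = Q'"
  shows "blowup_uv \<delta> (P, Q) 0 b = (P', Q')"
  using blowup_uv_eq[of \<delta> P Q 0 b] assms by (simp add: derivation_0)

lemma blowup_UVI:
  assumes "derivation \<delta>" "subst P (var_y * var_z) (var_z + cst b) = P1"
    "subst Q (var_y * var_z) (var_z + cst b) - cst (\<delta> b) = Q'" "(P1 - var_y * Q') / var_z = P'"
  shows "blowup_UV \<delta> (P, Q) 0 b = (P', Q')"
  using blowup_UV_eq[of \<delta> P Q 0 b] assms by (simp add: derivation_0)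

text \<open>The exceptional curve is contracted to the centre, so the pullback of a function defined
  there is constant along the curve.\<close>

lemma subst_poly_uv [simp]:
  assumes "defined_at f 0 b"
  shows "defined_at (subst f var_y (var_y * var_z + cst b)) 0 c"
    "value_at (subst f var_y (var_y * var_z + cst b)) 0 c = value_at f 0 b"
  using assms defined_at_subst[of var_y 0 c "var_y * var_z + cst b" f]
    value_at_subst[of var_y 0 c "var_y * var_z + cst b" f] by simp_all

lemma subst_poly_UV [simp]:
  assumes "defined_at f 0 b"
  shows "defined_at (subst f (var_y * var_z) (var_z + cst b)) c 0"
    "value_at (subst f (var_y * var_z) (var_z + cst b)) c 0 = value_at f 0 b"
  using assms defined_at_subst[of "var_y * var_z" c 0 "var_z + cst b" f]
    value_at_subst[of "var_y * var_z" c 0 "var_z + cst b" f] by simp_all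

text \<open>In the last step but one of a cascade the system is \<open>u' = A\<close>, \<open>v' = G / u\<close> near the base
  point \<open>(0, n)\<close>. Since the linearisation of \<open>G\<close> in \<open>v\<close> has the same eigenvalue as \<open>A\<close>, the next
  blow-up turns the second equation into \<open>v' = \<omega> / u + \<dots>\<close> with a resonance coefficient \<open>\<omega>\<close> that
  depends on \<open>x\<close> only. If \<open>\<omega> \<noteq> 0\<close>, one further blow-up removes the indeterminacy but not the pole.\<close>

lemma regularised_at_resonance:
  fixes A G :: "'k::field_gcd ratfun"
  assumes \<delta>: "derivation \<delta>"
    and A: "defined_at A 0 n" "value_at A 0 n = a" "a \<noteq> 0"
    and G: "defined_at G 0 n" "value_at G 0 n = 0" "value_at (D_z G) 0 n = a"
  shows "regularised_at \<delta> (A, G / var_y) 0 n \<longleftrightarrow> value_at (D_y G) 0 n = \<delta> n"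
proof -
  define d where "d = value_at (D_y G) 0 n"
  \<comment> \<open>With z = n + u v, G / u has the leading part d + a v. Subtracting \<delta> n and
    v A removes a v, because the eigenvalues agree, and leaves d - \<delta> n over u.\<close>
  define \<omega> where "\<omega> = d - \<delta> n"
  have \<delta>0: "\<delta> 0 = 0" using derivation_0[OF \<delta>] .
  obtain A1 A2 where A12: "defined_at A1 0 n" "defined_at A2 0 n"
    and A_eq: "A = cst a + var_y * A1 + (var_z - cst n) * A2"
  proof -
    obtain A' B' C' where *: "defined_at A' 0 n" "defined_at B' 0 n" "defined_at C' 0 n"
      "A = cst (value_at A 0 n) + cst (value_at (D_y A) 0 n) * (var_y - cst 0)
       + cst (value_at (D_z A) 0 n) * (var_z - cst n)
       + ((var_y - cst 0)\<^sup>2 * A' + (var_y - cst 0) * (var_z - cst n) * B' + (var_z - cst n)\<^sup>2 * C')"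
      using taylor[OF A(1)] by blast
    define p r where "p = cst (value_at (D_y A) 0 n)" "r = cst (value_at (D_z A) 0 n)"
    have "A = cst a + p * var_y + r * (var_z - cst n)
        + (var_y\<^sup>2 * A' + var_y * (var_z - cst n) * B' + (var_z - cst n)\<^sup>2 * C')"
      using *(4) A(2) by (simp add: p_r_def)
    then have "A = cst a + var_y * (p + var_y * A' + (var_z - cst n) * B')
        + (var_z - cst n) * (r + (var_z - cst n) * C')"
      by (simp add: algebra_simps power2_eq_square)
    then show thesis
      by (rule that[rotated 2]) (use *(1-3) in \<open>simp_all add: p_r_def\<close>)
  qed
  obtain G1 G2 G3 where G123: "defined_at G1 0 n" "defined_at G2 0 n" "defined_at G3 0 n"
    and G_eq: "G = cst d * var_y + cst a * (var_z - cst n)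
      + (var_y\<^sup>2 * G1 + var_y * (var_z - cst n) * G2 + (var_z - cst n)\<^sup>2 * G3)"
    using taylor[OF G(1)] G(2,3) by (auto simp: d_def)

  define P1 R1 where "P1 = subst A var_y (var_y * var_z + cst n)"
    and "R1 = subst G1 var_y (var_y * var_z + cst n)
      + var_z * subst G2 var_y (var_y * var_z + cst n)
      + var_z\<^sup>2 * subst G3 var_y (var_y * var_z + cst n)
      - var_z * (subst A1 var_y (var_y * var_z + cst n)
      + var_z * subst A2 var_y (var_y * var_z + cst n))"
  have defP1: "defined_at P1 0 c" for c
    using A by (simp add: P1_def)
  have defR1: "defined_at R1 0 c" for c
    using A12 G123 by (simp add: R1_def)
  have uv: "blowup_uv \<delta> (A, G / var_y) 0 n = (P1, cst \<omega> / var_y + R1)"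
    unfolding blowup_uv_eq[OF \<delta>] P1_def R1_def \<omega>_def \<delta>0
    by (simp add: A_eq G_eq) (simp add: field_simps power2_eq_square)

  \<comment> \<open>In the other chart the same cancellation leaves -\<omega> U / V as the only
    singular term of the first equation. The second one is \<Psi> / U with \<Psi> = a at the origin:
    a pole, but not 0/0.\<close>
  define \<Phi> where "\<Phi> = var_y * subst A1 (var_y * var_z) (var_z + cst n)
      + subst A2 (var_y * var_z) (var_z + cst n)
      - (var_y\<^sup>2 * subst G1 (var_y * var_z) (var_z + cst n)
        + var_y * subst G2 (var_y * var_z) (var_z + cst n)
        + subst G3 (var_y * var_z) (var_z + cst n))"
  define \<Psi> where "\<Psi> = cst a + cst \<omega> * var_y
      + var_z * (var_y\<^sup>2 * subst G1 (var_y * var_z) (var_z + cst n)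
        + var_y * subst G2 (var_y * var_z) (var_z + cst n)
        + subst G3 (var_y * var_z) (var_z + cst n))"
  have \<Phi>_def': "defined_at \<Phi> c 0" for c using A12 G123 by (simp add: \<Phi>_def)
  have \<Psi>_def': "defined_at \<Psi> 0 0" "value_at \<Psi> 0 0 = a" using A12 G123 by (simp_all add: \<Psi>_def)
  have UV: "blowup_UV \<delta> (A, G / var_y) 0 n = ((var_z * \<Phi> - cst \<omega> * var_y) / var_z, \<Psi> / var_y)"
    unfolding blowup_UV_eq[OF \<delta>] \<Phi>_def \<Psi>_def \<omega>_def \<delta>0
    by (simp add: A_eq G_eq) (simp add: field_simps power2_eq_square)
  have nobase_\<Psi>: "\<not> indeterminate_at (\<Psi> / var_y) 0 0"
    by (rule determinate_fraction) (use \<Psi>_def' A in auto)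
  show ?thesis
  proof (cases "\<omega> = 0")
    case True
    have "\<not> base_point (blowup_uv \<delta> (A, G / var_y) 0 n) 0 c" for c
      unfolding uv by (rule not_base_point_defined) (use defP1 defR1 True in auto)
    moreover have "\<not> base_point (blowup_UV \<delta> (A, G / var_y) 0 n) 0 0"
    proof -
      have "defined_at ((var_z * \<Phi> - cst \<omega> * var_y) / var_z) 0 0"
        using \<Phi>_def' True by simp
      then have "\<not> indeterminate_at ((var_z * \<Phi> - cst \<omega> * var_y) / var_z) 0 0"
        by (metis indeterminate_atD)
      then show ?thesis
        unfolding UV using nobase_\<Psi> by (rule not_base_pointI)
    qed
    ultimately have "determinate_on_exceptional_curve \<delta> (A, G / var_y) 0 n"
      by (simp add: determinate_on_exceptional_curve_def)
    moreover have "\<forall>c. regular_at (blowup_uv \<delta> (A, G / var_y) 0 n) 0 c"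
      unfolding uv regular_at_iff using defP1 defR1 True by simp
    ultimately have "regularised_at \<delta> (A, G / var_y) 0 n"
      by (intro regularised_at.final disjI1)
    then show ?thesis using True by (simp add: \<omega>_def d_def)
  next
    case False
    define T where "T = ((var_z * \<Phi> - cst \<omega> * var_y) / var_z, \<Psi> / var_y)"
    \<comment> \<open>On V = 0 the numerator is -\<omega> U, which vanishes at the origin but not at
      U = 1.\<close>
    have "indeterminate_at ((var_z * \<Phi> - cst \<omega> * var_y) / var_z ^ 1) 0 0"
      by (rule indeterminate_over_z[of _ _ 1]) (use \<Phi>_def' False in auto)
    then have bp: "base_point T 0 0" by (simp add: T_def base_point_def)
    define \<Phi>1 \<Psi>1 where "\<Phi>1 = subst \<Phi> var_y (var_y * var_z + cst 0)"
      and "\<Psi>1 = subst \<Psi> var_y (var_y * var_z + cst 0)"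
    have 1: "defined_at \<Phi>1 0 c" "defined_at \<Psi>1 0 c" "value_at \<Psi>1 0 c = a" for c
      unfolding \<Phi>1_def \<Psi>1_def using \<Phi>_def' \<Psi>_def' by (simp_all del: cst_simps)
    have uv': "blowup_uv \<delta> T 0 0 = ((var_z * \<Phi>1 - cst \<omega>) / var_z,
        (\<Psi>1 - var_y * (var_z * \<Phi>1 - cst \<omega>)) / var_y\<^sup>2)"
      unfolding T_def blowup_uv_eq[OF \<delta>] \<Phi>1_def \<Psi>1_def \<delta>0
      by (simp) (simp add: field_simps power2_eq_square)
    define \<Phi>2 \<Psi>2 where "\<Phi>2 = subst \<Phi> (var_y * var_z) (var_z + cst 0)"
      and "\<Psi>2 = subst \<Psi> (var_y * var_z) (var_z + cst 0)"
    have 2: "defined_at \<Phi>2 0 0" "defined_at \<Psi>2 0 0" "value_at \<Psi>2 0 0 = a"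
      unfolding \<Phi>2_def \<Psi>2_def using \<Phi>_def' \<Psi>_def' by (simp_all del: cst_simps)
    have UV': "blowup_UV \<delta> T 0 0 =
        ((var_z * (\<Phi>2 - cst \<omega> * var_y) - \<Psi>2) / var_z\<^sup>2, \<Psi>2 / (var_y * var_z))"
      unfolding T_def blowup_UV_eq[OF \<delta>] \<Phi>2_def \<Psi>2_def \<delta>0
      by (simp) (simp add: field_simps power2_eq_square)
    have "\<not> base_point (blowup_uv \<delta> T 0 0) 0 c" for c
      unfolding uv'
      by (intro not_base_pointI determinate_fraction; cases "c = 0")
        (use 1 A False in auto)
    moreover have "\<not> base_point (blowup_UV \<delta> T 0 0) 0 0"
      unfolding UV' by (intro not_base_pointI determinate_fraction) (use 2 A in auto)
    ultimately have det: "determinate_on_exceptional_curve \<delta> T 0 0"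
      by (simp add: determinate_on_exceptional_curve_def)
    \<comment> \<open>At the origin of either final chart one right-hand side has a numerator with
      value a \<noteq> 0 over a vanishing denominator. Both alternatives of the rule
      \<open>final\<close> fail, and determinacy excludes the rule \<open>blow_up\<close>.\<close>
    have "\<not> defined_at ((\<Psi>1 - var_y * (var_z * \<Phi>1 - cst \<omega>)) / var_y\<^sup>2) 0 0"
      by (rule not_defined_atI) (use 1 A in auto)
    then have "\<not> regular_at (blowup_uv \<delta> T 0 0) 0 0"
      unfolding uv' regular_at_iff by blast
    moreover have "\<not> defined_at (\<Psi>2 / (var_y * var_z)) 0 0"
      by (rule not_defined_atI) (use 2 A in auto)
    then have "\<not> regular_at (blowup_UV \<delta> T 0 0) 0 0"
      unfolding UV' regular_at_iff by blast
    ultimately have "\<not> regularised_at \<delta> T 0 0"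
      using det by (subst regularised_at.simps) blast
    moreover have "\<not> determinate_on_exceptional_curve \<delta> (A, G / var_y) 0 n"
      using bp UV by (auto simp: determinate_on_exceptional_curve_def T_def)
    ultimately have "\<not> regularised_at \<delta> (A, G / var_y) 0 n"
      using bp UV by (subst regularised_at.simps) (auto simp: T_def)
    then show ?thesis using False by (simp add: \<omega>_def d_def)
  qed
qed

section \<open>The cascades of the rescaled system\<close>

lemma dominant_uv_minus [simp]: "dominant var_y (var_y * var_z - cst b)"
  using dominant_uv[of 0 "- b"] by simp

lemma dominant_UV_minus [simp]: "dominant (var_y * var_z) (var_z - cst b)"
  using dominant_UV[of 0 "- b"] by simp

text \<open>This identity and the next three are stated over an abstract field, so that the Groebner
  basis computation sees variables instead of rational functions. The equation for S is kept
  separate, as S also occurs in denominators.\<close>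

lemma zc3_identity:
  fixes F :: "'a::field"
  assumes "F \<noteq> 0" "S \<noteq> 0" and S: "S = Z + F"
  shows "(S\<^sup>2 * ((16 * Q * (1 / F) + 2 * K) * (Y * Z) - 4 * (1 / F)\<^sup>2) + 12 * (1 / F) * S
      - 4 * (Q * (Y * Z) * S + 1) * (Q * (Y * Z) * S + 2)) / S\<^sup>2
    = (16 * Q / F + 2 * K) * Y * Z - 4 * Q\<^sup>2 * Y\<^sup>2 * Z\<^sup>2 - 12 * Q * Y * Z / S
      + 4 * Z * (F - Z) / (F\<^sup>2 * S\<^sup>2)"
  using assms(1,2) by (simp add: divide_simps) (use S in algebra)

lemma zc3_identity':
  fixes F :: "'a::field"
  assumes "F \<noteq> 0" "S \<noteq> 0" "Y \<noteq> 0" "Z \<noteq> 0" and S: "S = Z + F"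
  shows "(4 * (1 / F * S - 1)\<^sup>2 / S + Y * Z * (4 * Q - K * S - 8 * Q * (1 / F) * S)) / (Y * Z) ^ 1
      - (2 * m / F ^ 3 - 4 * Q - K * F)
    = (4 * Z / (F\<^sup>2 * S) - Y * ((K + 8 * Q / F) * Z + 2 * m / F ^ 3)) / Y ^ 1"
  using assms(1-4) by (simp add: divide_simps) (use S in algebra)

lemma \<delta>_f_identity:
  fixes f :: "'a::field"
  assumes "f \<noteq> 0" "e = 1 / f" "\<kappa> = - 2 * m / f ^ 5"
  shows "- (\<kappa> + 4 * q * e\<^sup>2 + k * e) / e\<^sup>2 = 2 * m / f ^ 3 - 4 * q - k * f"
  unfolding assms(2,3) using assms(1) by (simp add: divide_simps) algebra

lemma \<delta>_m3_identity:
  fixes f :: "'a::field"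
  assumes "f \<noteq> 0"
  shows "2 * lam * m + 10 * m / f * (2 * m / f ^ 3 - 4 * q - k * f)
    = 2 * (m * (lam + 10 * m / f ^ 4 - 20 * q / f - 5 * k))"
  using assms by (simp add: divide_simps) algebra

text \<open>Here \<open>\<delta> = x d/dx\<close>, \<open>z\<^sub>3 = y z - e\<close>, \<open>h = 2 \<eta>\<^sub>0 x\<close> and \<open>k = 2 \<kappa>\<^sub>0 + 1\<close>. The equation for \<open>\<delta> e\<close> defines
  \<open>\<kappa>\<close>, which is \<open>\<kappa>\<^sub>\<infinity> x\<close> if \<open>q\<close> solves the Painleve equation with parameter \<open>\<kappa>\<^sub>\<infinity>\<close>. The names \<open>yc\<close> and
  \<open>zc\<close> refer to the successive blow-ups at the points \<open>[0 : 1 : 0]\<close> and \<open>[0 : 0 : 1]\<close> at infinity.\<close>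

locale cascade =
  fixes \<delta> :: "'k::{field_gcd, field_char_0} \<Rightarrow> 'k" and e q h k \<kappa> lam :: 'k
  assumes \<delta>: "derivation \<delta>"
    and nonzero: "e \<noteq> 0" "q \<noteq> 0" "h \<noteq> 0" "\<kappa> \<noteq> 0"
    and \<delta>_e: "\<delta> e = \<kappa> + 4 * q * e\<^sup>2 + k * e"
    and \<delta>_q: "\<delta> q = h - 4 * q\<^sup>2 * e - k * q"
    and \<delta>_h: "\<delta> h = h" and \<delta>_k: "\<delta> k = 0" and \<delta>_\<kappa>: "\<delta> \<kappa> = lam * \<kappa>"
begin

abbreviation Y :: "'k ratfun" where "Y \<equiv> var_y"
abbreviation Z :: "'k ratfun" where "Z \<equiv> var_z"
abbreviation E :: "'k ratfun" where "E \<equiv> cst e"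
abbreviation Q :: "'k ratfun" where "Q \<equiv> cst q"
abbreviation H :: "'k ratfun" where "H \<equiv> cst h"
abbreviation K :: "'k ratfun" where "K \<equiv> cst k"

text \<open>By \<open>bg_identities\<close> this is x times the Bureau-Guillot system, with q'
  expressed through e. It is polynomial in y and z, so the affine chart has no base points.\<close>

definition sys :: "'k system" where
  "sys = (16 * Q * E * Y + 2 * K * Y + 12 * E * Y * Z - 4 * Y\<^sup>2 * (Q + Z) * (Q + 2 * Z) - 4 * E\<^sup>2,
          4 * Y * Z * (Q + Z)\<^sup>2 - K * Z - 4 * E * Z * (Z + 2 * Q))"

definition sys_y :: "'k system" where
  "sys_y = ((4 * (Q * Y + Z) * (Q * Y + 2 * Z) + Y\<^sup>2 * (4 * E\<^sup>2 * Y\<^sup>2 - (16 * Q * E + 2 * K) * Y - 12 * E * Z)) / Y ^ 2,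
      (4 * Z * (Q * Y + Z) * (2 * Q * Y + 3 * Z) + Y\<^sup>2 * Z * (4 * E\<^sup>2 * Y\<^sup>2 - (3 * K + 24 * Q * E) * Y - 16 * E * Z)) / Y ^ 3)"

definition sys_z :: "'k system" where
  "sys_z = ((Z\<^sup>2 * ((24 * Q * E + 3 * K) * Y * Z + 16 * E * Y - 4 * E\<^sup>2 * Z\<^sup>2) - 4 * Y\<^sup>2 * (Q * Z + 1) * (2 * Q * Z + 3)) / Z ^ 3,
      (Z\<^sup>2 * (K * Z + 4 * E * (1 + 2 * Q * Z)) - 4 * Y * (Q * Z + 1)\<^sup>2) / Z ^ 2)"

lemmas unit_simps = power2_eq_square power3_eq_cube field_simps

lemma charts: "projective_charts \<delta> sys = {sys, sys_y, sys_z}"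
  unfolding projective_charts_def sys_def sys_y_def sys_z_def in_coordinates_infinity_y[OF \<delta>]
    in_coordinates_infinity_z[OF \<delta>]
  by (intro arg_cong2[where f = insert] arg_cong2[where f = Pair] refl)
    (simp, simp add: unit_simps)+

section \<open>Closed forms of the charts over [0 : 1 : 0]\<close>

definition "yc1 = ((4 * (Q + Z) * (Q + 2 * Z) + Y * (4 * E\<^sup>2 * Y - 16 * Q * E - 2 * K - 12 * E * Z)),
      (4 * Z * (Q + Z)\<^sup>2 - Y * (K * Z + 4 * E * Z * (Z + 2 * Q))) / Y ^ 1)"

lemma yc1: "blowup_uv \<delta> sys_y 0 0 = yc1"
  and yc1': "blowup_UV \<delta> sys_y 0 0 =
    (((Y\<^sup>2 * Z) * ((8 * Q * E + K) * Y + 4 * E) - 4 * (Q * Y + 1)\<^sup>2) / (Y\<^sup>2 * Z),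
     (4 * (Q * Y + 1) * (2 * Q * Y + 3) + Y\<^sup>2 * Z * (4 * E\<^sup>2 * Y\<^sup>2 * Z - (3 * K + 24 * Q * E) * Y - 16 * E)) / Y ^ 3)"
  unfolding yc1_def sys_y_def blowup_uv_eq[OF \<delta>] blowup_UV_eq[OF \<delta>] derivation_0[OF \<delta>]
  by (intro arg_cong2[where f = Pair]; simp; simp add: unit_simps)+

lemma yz: "blowup_uv \<delta> yc1 0 0 = (4 * (Q + Y * Z) * (Q + 2 * Y * Z) + Y * (4 * E\<^sup>2 * Y - 16 * Q * E - 2 * K - 12 * E * Y * Z),
     (K + 8 * Q * E) * Z + 8 * E * Y * Z\<^sup>2 - 4 * E\<^sup>2 * Y * Z - 4 * Z\<^sup>2 * (Q + Y * Z))"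
  and yz': "blowup_UV \<delta> yc1 0 0 =
    (4 * (Q + Z) + 4 * E\<^sup>2 * Y\<^sup>2 * Z - (8 * Q * E + K) * Y - 8 * E * Y * Z,
     (4 * (Q + Z)\<^sup>2 - Y * (K * Z + 4 * E * Z * (Z + 2 * Q))) / Y)"
  unfolding yc1_def blowup_uv_eq[OF \<delta>] blowup_UV_eq[OF \<delta>] derivation_0[OF \<delta>]
  by (intro arg_cong2[where f = Pair]; simp; simp add: unit_simps)+

definition "yc2 = ((Z * (4 * Z + 4 * E\<^sup>2 * Y\<^sup>2 * Z - (4 * Q * E + K) * Y - 8 * E * Y * Z) - H * Y) / Z ^ 1,
    (4 * (Z - Q) * Z + Y * (H - K * Z - 4 * E * Z\<^sup>2)) / Y ^ 1)"

lemma yc2: "blowup_UV \<delta> yc1 0 (- q) = yc2"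
  and yc2': "blowup_uv \<delta> yc1 0 (- q) =
    (4 * Y * Z * (2 * Y * Z - Q) + Y * (4 * E\<^sup>2 * Y - 4 * Q * E - 2 * K - 12 * E * Y * Z),
     (4 * (Y * Z - Q) * Y * Z\<^sup>2 - K * Y * Z - 4 * E * Y\<^sup>2 * Z\<^sup>2 + H
       - Z * (4 * Y * Z * (2 * Y * Z - Q) + Y * (4 * E\<^sup>2 * Y - 4 * Q * E - 2 * K - 12 * E * Y * Z))) / Y)"
  unfolding yc1_def yc2_def blowup_uv_eq[OF \<delta>] blowup_UV_eq[OF \<delta>] derivation_0[OF \<delta>]
    derivation_uminus[OF \<delta>] \<delta>_q
  by (intro arg_cong2[where f = Pair]; simp; simp add: unit_simps)+

definition "yc3 = ((Z * (4 * Y * Z + 4 * E\<^sup>2 * Y ^ 3 * Z - (4 * Q * E + K) * Y - 8 * E * Y\<^sup>2 * Z) - H) / Z,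
    (2 * H - 4 * Q * Z + Y * (4 * Q * E * Z + 4 * E * Y * Z\<^sup>2 - 4 * E\<^sup>2 * Y\<^sup>2 * Z\<^sup>2)) / Y ^ 1)"

lemma yc3: "blowup_uv \<delta> yc2 0 0 = yc3"
  and yc3': "blowup_UV \<delta> yc2 0 0 =
    ((4 * Q - 2 * H * Y + Z * (4 * E\<^sup>2 * Y\<^sup>2 * Z\<^sup>2 - 4 * Q * E * Y - 4 * E * Y * Z)) / Z,
     (4 * (Z - Q) + Y * (H - K * Z - 4 * E * Z\<^sup>2)) / Y)"
  unfolding yc2_def yc3_def blowup_uv_eq[OF \<delta>] blowup_UV_eq[OF \<delta>] derivation_0[OF \<delta>]
  by (intro arg_cong2[where f = Pair]; simp; simp add: unit_simps)+

text \<open>The root of 2 h - 4 q c, the leading coefficient of the second equation of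
  \<open>yc3\<close> on the exceptional curve.\<close>

definition "m2 = h / (2 * q)"
text \<open>M is the second coordinate of the preceding chart. Keeping it as a unit, with value m2
  on the exceptional curve, avoids expanding H / M.\<close>

definition "yc4_y = (let M = Y * Z + cst m2 in
   4 * Y * M + 4 * E\<^sup>2 * Y ^ 3 * M - (4 * Q * E + K) * Y - 8 * E * Y\<^sup>2 * M - H / M)"
definition "yc4_z = (let M = Y * Z + cst m2 in
   - 4 * Q * Z + 4 * Q * E * M + 4 * E * Y * M\<^sup>2 - 4 * E\<^sup>2 * Y\<^sup>2 * M\<^sup>2 - cst (\<delta> m2) - Z * yc4_y)"

text \<open>It turns 2 H - 4 Q M into -4 Q Y Z, so that the division by Y in the next chart is
  exact.\<close>

lemma H_eq: "H = 2 * Q * cst m2"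
proof -
  have "h = 2 * q * m2" using nonzero by (simp add: m2_def)
  then show ?thesis by (metis cst_simps(6) cst_numeral)
qed

lemma nonzeroI: "defined_at g a b \<Longrightarrow> value_at g a b \<noteq> 0 \<Longrightarrow> g \<noteq> 0"
  by auto

lemma Z_plus_nonzero: "Z + cst m \<noteq> 0"
  using var_z_neq_cst[of "- m"] by (simp add: add_eq_0_iff2)

lemma m2_nonzero: "m2 \<noteq> 0"
  using nonzero by (simp add: m2_def)

lemma yc4: "blowup_uv \<delta> yc3 0 m2 = (yc4_y, yc4_z / Y)"
proof -
  \<comment> \<open>M is made opaque so that simplification treats it as one nonzero atom; its
    definition is given back only to \<open>algebra\<close>. The same device serves for S, R, J and
    V below.\<close>
  obtain M where M: "M = Y * Z + cst m2" by blast
  have M0: "M \<noteq> 0" unfolding M by (rule nonzeroI[of _ 0 0]) (simp_all add: m2_nonzero)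
  have dom: "dominant Y M" by (simp add: M)
  show ?thesis
    unfolding yc3_def
  proof (rule blowup_uvI[OF \<delta>], unfold M[symmetric])
    show "subst ((Z * (4 * Y * Z + 4 * E\<^sup>2 * Y ^ 3 * Z - (4 * Q * E + K) * Y - 8 * E * Y\<^sup>2 * Z) - H) / Z)
        Y M = yc4_y"
      unfolding yc4_y_def M[symmetric] Let_def
      by (simp add: dom) (simp add: divide_simps M0)
    show "subst ((2 * H - 4 * Q * Z + Y * (4 * Q * E * Z + 4 * E * Y * Z\<^sup>2 - 4 * E\<^sup>2 * Y\<^sup>2 * Z\<^sup>2)) / Y ^ 1) Y M - cst (\<delta> m2)
       = - 4 * Q * Z + (4 * Q * E * M + 4 * E * Y * M\<^sup>2 - 4 * E\<^sup>2 * Y\<^sup>2 * M\<^sup>2) - cst (\<delta> m2)"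
      by (simp add: dom H_eq, simp add: divide_simps) (use M in algebra)
  qed (simp add: yc4_z_def Let_def M[symmetric])
qed

lemma yc4': "blowup_UV \<delta> yc3 0 m2 = (let M = Z + cst m2; R = Y * Z;
       J = 4 * Q * E * M + 4 * E * R * M\<^sup>2 - 4 * E\<^sup>2 * R\<^sup>2 * M\<^sup>2 - cst (\<delta> m2) in
    ((4 * R * M + 4 * E\<^sup>2 * R ^ 3 * M - (4 * Q * E + K) * R - 8 * E * R\<^sup>2 * M - H / M + 4 * Q - Y * J) / Z,
     (Y * J - 4 * Q) / Y))"
proof -
  obtain M where M: "M = Z + cst m2" by blast
  obtain R where R: "R = Y * Z" by blast
  have M0: "M \<noteq> 0" unfolding M by (rule Z_plus_nonzero)
  have R0: "R \<noteq> 0" unfolding R by simp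
  have dom: "dominant R M" by (simp add: M R)
  obtain J where J: "J = 4 * Q * E * M + 4 * E * R * M\<^sup>2 - 4 * E\<^sup>2 * R\<^sup>2 * M\<^sup>2 - cst (\<delta> m2)" by blast
  show ?thesis
    unfolding yc3_def Let_def M[symmetric] R[symmetric] J[symmetric]
  proof (rule blowup_UVI[OF \<delta>], unfold M[symmetric] R[symmetric])
    show "subst ((Z * (4 * Y * Z + 4 * E\<^sup>2 * Y ^ 3 * Z - (4 * Q * E + K) * Y - 8 * E * Y\<^sup>2 * Z) - H) / Z) R M
      = 4 * R * M + 4 * E\<^sup>2 * R ^ 3 * M - (4 * Q * E + K) * R - 8 * E * R\<^sup>2 * M - H / M"
      by (simp add: dom) (simp add: divide_simps M0)
    show "subst ((2 * H - 4 * Q * Z + Y * (4 * Q * E * Z + 4 * E * Y * Z\<^sup>2 - 4 * E\<^sup>2 * Y\<^sup>2 * Z\<^sup>2)) / Y ^ 1) R M - cst (\<delta> m2)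
      = (Y * J - 4 * Q) / Y"
      by (simp add: dom H_eq, simp add: divide_simps R0) (use M R J in algebra)
  qed (simp add: divide_simps)
qed

section \<open>Closed forms of the charts over [0 : 0 : 1]\<close>

definition "zc1 = ((Z\<^sup>2 * (16 * Q * E * Y + 2 * K * Y - 4 * E\<^sup>2) + 12 * E * Y * Z - 4 * Y\<^sup>2 * (Q * Z + 1) * (Q * Z + 2)) / Z ^ 2,
    (Z * (K * Z + 4 * E * (1 + 2 * Q * Z)) - 4 * Y * (Q * Z + 1)\<^sup>2) / Z ^ 1)"

lemma zc1: "blowup_UV \<delta> sys_z 0 0 = zc1"
  and zc1': "blowup_uv \<delta> sys_z 0 0 =
   ((Y * Z\<^sup>2 * ((24 * Q * E + 3 * K) * Y * Z + 16 * E - 4 * E\<^sup>2 * Y * Z\<^sup>2) - 4 * (Q * Y * Z + 1) * (2 * Q * Y * Z + 3)) / (Y * Z ^ 3),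
    (4 * (Q * Y * Z + 1) * (Q * Y * Z + 2) + Y * Z\<^sup>2 * (4 * E\<^sup>2 * Y * Z\<^sup>2 - 12 * E - (16 * Q * E + 2 * K) * Y * Z)) / (Y\<^sup>2 * Z\<^sup>2))"
  unfolding zc1_def sys_z_def blowup_uv_eq[OF \<delta>] blowup_UV_eq[OF \<delta>] derivation_0[OF \<delta>]
  by (intro arg_cong2[where f = Pair]; simp; simp add: unit_simps)+

definition "zc2 = ((Z\<^sup>2 * ((16 * Q * E + 2 * K) * Y - 4 * E\<^sup>2) + 12 * E * Z - 4 * (Q * Y * Z + 1) * (Q * Y * Z + 2)) / Z\<^sup>2,
    (4 * (E * Z - 1)\<^sup>2 / Z + Y * (4 * Q - K * Z - 8 * Q * E * Z)) / Y ^ 1)"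

lemma zc2: "blowup_uv \<delta> zc1 0 0 = zc2"
  and zc2': "blowup_UV \<delta> zc1 0 0 =
    ((Z * ((K + 8 * Q * E) * Y - 4 * Q * Y\<^sup>2) - 4 * (E - Y)\<^sup>2) / Z,
     K * Z + 4 * E * (1 + 2 * Q * Z) - 4 * Y * (Q * Z + 1)\<^sup>2)"
  unfolding zc1_def zc2_def blowup_uv_eq[OF \<delta>] blowup_UV_eq[OF \<delta>] derivation_0[OF \<delta>]
  by (intro arg_cong2[where f = Pair]; simp; simp add: unit_simps)+

text \<open>The double root of the leading coefficient 4 (e c - 1)^2 / c in
  \<open>zc2\<close>.\<close>

definition "f = 1 / e"
text \<open>The coordinate of a later base point, over the origin of \<open>zc3\<close>. As a
  nonzero multiple of \<kappa> it replaces \<kappa>, just as f replaces e: the derivatives of f and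
  m3 are rational in f, m3, q, k and \<open>lam\<close>.\<close>

definition "m3 = - \<kappa> * f ^ 5 / 2"
abbreviation F :: "'k ratfun" where "F \<equiv> cst f"
abbreviation M3 :: "'k ratfun" where "M3 \<equiv> cst m3"

lemma f_nonzero: "f \<noteq> 0" and m3_nonzero: "m3 \<noteq> 0"
  using nonzero by (simp_all add: f_def m3_def)

lemma e_eq: "e = 1 / f" and E_eq: "E = 1 / F"
  by (simp_all add: f_def)

lemma \<kappa>_eq: "\<kappa> = - 2 * m3 / f ^ 5"
  using f_nonzero by (simp add: m3_def)

lemma \<delta>_f: "\<delta> f = 2 * m3 / f ^ 3 - 4 * q - k * f"
proof -
  have "\<delta> f = - \<delta> e / e\<^sup>2"
    unfolding f_def derivation_divide[OF \<delta>] derivation_1[OF \<delta>] by (simp only: mult_zero_left mult_1 diff_0)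
  then show ?thesis
    unfolding \<delta>_e by (simp only: \<delta>_f_identity[OF f_nonzero e_eq \<kappa>_eq])
qed

text \<open>Logarithmic differentiation: \<delta> m3 / m3 = lam + 5 \<delta> f / f. Here
  \<open>lam\<close>, the logarithmic derivative of \<kappa>, enters the cascade.\<close>

lemma \<delta>_m3: "\<delta> m3 = m3 * (lam + 10 * m3 / f ^ 4 - 20 * q / f - 5 * k)"
proof -
  have f5: "f ^ 5 = f\<^sup>2 * f\<^sup>2 * f"
    by (simp add: eval_nat_numeral)
  have d: "\<delta> (f ^ 5) = 5 * f ^ 4 * \<delta> f"
    unfolding f5 derivation_mult[OF \<delta>] derivation_power2[OF \<delta>] by algebra
  have \<kappa>4: "\<kappa> * f ^ 4 = - 2 * m3 / f"
    using f_nonzero by (simp add: m3_def eval_nat_numeral)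
  have "2 * m3 = - (\<kappa> * f ^ 5)"
    by (simp add: m3_def)
  then have "\<delta> (2 * m3) = \<delta> (- (\<kappa> * f ^ 5))"
    by (rule arg_cong)
  then have "2 * \<delta> m3 = - (lam * (\<kappa> * f ^ 5) + 5 * (\<kappa> * f ^ 4) * \<delta> f)"
    by (simp only: derivation_simps[OF \<delta>] \<delta>_\<kappa> d) (simp add: algebra_simps)
  also have "\<dots> = 2 * lam * m3 + 10 * m3 / f * \<delta> f"
    unfolding \<kappa>4 by (simp add: m3_def)
  also have "\<dots> = 2 * (m3 * (lam + 10 * m3 / f ^ 4 - 20 * q / f - 5 * k))"
    unfolding \<delta>_f by (rule \<delta>_m3_identity[OF f_nonzero])
  finally show ?thesis by simp
qed

lemma F_nonzero: "F \<noteq> 0"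
  using f_nonzero by simp

definition "zc3 = (let S = Z + F in
   ((24 * Q / F + 3 * K) * Y - 4 * Q\<^sup>2 * Y\<^sup>2 * Z - 12 * Q * Y / S - 8 * Z / (F\<^sup>2 * S\<^sup>2) + 2 * M3 * Y / (F ^ 3 * Z),
    (4 * Z / (F\<^sup>2 * S) - Y * ((K + 8 * Q / F) * Z + 2 * M3 / F ^ 3)) / Y ^ 1))"

text \<open>The first appearance of \<kappa>, hidden in M3: it comes from subtracting \<delta> f,
  the velocity of the centre, whose other terms -4 q - k f cancel the value of the right-hand side
  at Z = 0.\<close>

lemma zc3: "blowup_UV \<delta> zc2 0 f = zc3"
proof -
  obtain S where S: "S = Z + F" by blast
  have S0: "S \<noteq> 0" unfolding S by (rule Z_plus_nonzero)
  have dF: "cst (\<delta> f) = 2 * M3 / F ^ 3 - 4 * Q - K * F" by (simp add: \<delta>_f)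
  have dom: "dominant (Y * Z) S" by (simp add: S)
  show ?thesis
    unfolding zc2_def zc3_def Let_def S[symmetric]
  proof (rule blowup_UVI[OF \<delta>], unfold S[symmetric] dF)
    show "subst ((Z\<^sup>2 * ((16 * Q * E + 2 * K) * Y - 4 * E\<^sup>2) + 12 * E * Z - 4 * (Q * Y * Z + 1) * (Q * Y * Z + 2)) / Z\<^sup>2) (Y * Z) S
      = (16 * Q / F + 2 * K) * Y * Z - 4 * Q\<^sup>2 * Y\<^sup>2 * Z\<^sup>2 - 12 * Q * Y * Z / S
        + 4 * Z * (F - Z) / (F\<^sup>2 * S\<^sup>2)"
      unfolding E_eq
      by (simp only: subst_add[OF dom] subst_diff[OF dom] subst_mult[OF dom] subst_divide[OF dom]
          subst_power[OF dom] subst_basic)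
        (rule zc3_identity[OF F_nonzero S0 S])
    show "subst ((4 * (E * Z - 1)\<^sup>2 / Z + Y * (4 * Q - K * Z - 8 * Q * E * Z)) / Y ^ 1) (Y * Z) S
        - (2 * M3 / F ^ 3 - 4 * Q - K * F)
      = (4 * Z / (F\<^sup>2 * S) - Y * ((K + 8 * Q / F) * Z + 2 * M3 / F ^ 3)) / Y ^ 1"
      unfolding E_eq
      by (simp only: subst_add[OF dom] subst_diff[OF dom] subst_mult[OF dom] subst_divide[OF dom]
          subst_power[OF dom] subst_basic)
        (rule zc3_identity'[OF F_nonzero S0 var_nonzero S])
  qed (simp add: divide_simps S0 f_nonzero, use S in algebra)
qed

lemma zc3': "blowup_uv \<delta> zc2 0 f = (let S = Y * Z + F;
    P = (16 * Q / F + 2 * K) * Y - 4 * Q\<^sup>2 * Y\<^sup>2 - 12 * Q * Y / S + 4 * Y * Z * (F - Y * Z) / (F\<^sup>2 * S\<^sup>2) in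
    (P, (4 * Z\<^sup>2 * Y / (F\<^sup>2 * S) - (K + 8 * Q / F) * Y * Z - 2 * M3 / F ^ 3 - Z * P) / Y))"
proof -
  obtain S where S: "S = Y * Z + F" by blast
  have S0: "S \<noteq> 0" unfolding S by (rule nonzeroI[of _ 0 0]) (simp_all add: f_nonzero)
  have dF: "cst (\<delta> f) = 2 * M3 / F ^ 3 - 4 * Q - K * F" by (simp add: \<delta>_f)
  have dom: "dominant Y S" by (simp add: S)
  show ?thesis
    unfolding zc2_def Let_def S[symmetric]
  proof (rule blowup_uvI[OF \<delta>], unfold S[symmetric] dF)
    show "subst ((Z\<^sup>2 * ((16 * Q * E + 2 * K) * Y - 4 * E\<^sup>2) + 12 * E * Z - 4 * (Q * Y * Z + 1) * (Q * Y * Z + 2)) / Z\<^sup>2) Y S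
      = (16 * Q / F + 2 * K) * Y - 4 * Q\<^sup>2 * Y\<^sup>2 - 12 * Q * Y / S + 4 * Y * Z * (F - Y * Z) / (F\<^sup>2 * S\<^sup>2)"
      unfolding E_eq
      by (simp add: dom, simp add: divide_simps S0 f_nonzero) (use S in algebra)
    show "subst ((4 * (E * Z - 1)\<^sup>2 / Z + Y * (4 * Q - K * Z - 8 * Q * E * Z)) / Y ^ 1) Y S
        - (2 * M3 / F ^ 3 - 4 * Q - K * F)
      = 4 * Z\<^sup>2 * Y / (F\<^sup>2 * S) - (K + 8 * Q / F) * Y * Z - 2 * M3 / F ^ 3"
      unfolding E_eq
      by (simp add: dom, simp add: divide_simps S0 f_nonzero) (use S in algebra)
  qed simp
qed

definition "zc4_y = (let S = Y * Z + F in
   (24 * Q / F + 3 * K) * Y - 4 * Q\<^sup>2 * Y ^ 3 * Z - 12 * Q * Y / S - 8 * Y * Z / (F\<^sup>2 * S\<^sup>2) + 2 * M3 / (F ^ 3 * Z))"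
definition "zc4_z = (let S = Y * Z + F in
   4 * (Z * F - M3 * S) / (F ^ 3 * S)
   + Y * (12 * Q * Z / S + 8 * Z\<^sup>2 / (F\<^sup>2 * S\<^sup>2) + 4 * Q\<^sup>2 * Y\<^sup>2 * Z\<^sup>2 - (32 * Q / F + 4 * K) * Z))"

lemma zc4: "blowup_uv \<delta> zc3 0 0 = (zc4_y, zc4_z / Y)"
proof -
  obtain S where S: "S = Y * Z + F" by blast
  have S0: "S \<noteq> 0" unfolding S by (rule nonzeroI[of _ 0 0]) (simp_all add: f_nonzero)
  show ?thesis
    unfolding zc3_def Let_def
  proof (rule blowup_uvI[OF \<delta>])
    show "subst ((24 * Q / F + 3 * K) * Y - 4 * Q\<^sup>2 * Y\<^sup>2 * Z - 12 * Q * Y / (Z + F) - 8 * Z / (F\<^sup>2 * (Z + F)\<^sup>2) + 2 * M3 * Y / (F ^ 3 * Z)) Y (Y * Z + cst 0) = zc4_y"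
      unfolding zc4_y_def Let_def S[symmetric]
      by (simp add: S[symmetric], simp add: divide_simps S0 f_nonzero)
        (simp add: power2_eq_square power3_eq_cube)
    show "subst ((4 * Z / (F\<^sup>2 * (Z + F)) - Y * ((K + 8 * Q / F) * Z + 2 * M3 / F ^ 3)) / Y ^ 1) Y (Y * Z + cst 0) - cst (\<delta> 0)
      = 4 * Z / (F\<^sup>2 * S) - (K + 8 * Q / F) * Y * Z - 2 * M3 / F ^ 3"
      by (simp add: S[symmetric] derivation_0[OF \<delta>], simp add: divide_simps S0 f_nonzero) algebra
  next
    show "(4 * Z / (F\<^sup>2 * S) - (K + 8 * Q / F) * Y * Z - 2 * M3 / F ^ 3 - Z * zc4_y) / Y = zc4_z / Y"
      unfolding zc4_y_def zc4_z_def Let_def S[symmetric]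
      by (simp add: divide_simps S0 f_nonzero) algebra
  qed
qed

lemma zc4': "blowup_UV \<delta> zc3 0 0 = (let S = Z + F in
    ((Z * ((32 * Q / F + 4 * K) * Y - 4 * Q\<^sup>2 * Y\<^sup>2 * Z\<^sup>2 - 12 * Q * Y / S - 8 / (F\<^sup>2 * S\<^sup>2)) + 4 * M3 * Y / F ^ 3 - 4 / (F\<^sup>2 * S)) / Z,
     (4 / (F\<^sup>2 * S) - Y * ((K + 8 * Q / F) * Z + 2 * M3 / F ^ 3)) / Y))"
proof -
  obtain S where S: "S = Z + F" by blast
  have S0: "S \<noteq> 0" unfolding S by (rule Z_plus_nonzero)
  show ?thesis
    unfolding zc3_def Let_def S[symmetric]
  proof (rule blowup_UVI[OF \<delta>])
    show "subst ((24 * Q / F + 3 * K) * Y - 4 * Q\<^sup>2 * Y\<^sup>2 * Z - 12 * Q * Y / S - 8 * Z / (F\<^sup>2 * S\<^sup>2) + 2 * M3 * Y / (F ^ 3 * Z)) (Y * Z) (Z + cst 0)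
      = (24 * Q / F + 3 * K) * Y * Z - 4 * Q\<^sup>2 * Y\<^sup>2 * Z ^ 3 - 12 * Q * Y * Z / S - 8 * Z / (F\<^sup>2 * S\<^sup>2) + 2 * M3 * Y / F ^ 3"
      unfolding S by (simp, unfold S[symmetric], simp add: divide_simps S0 f_nonzero)
        (simp add: power2_eq_square power3_eq_cube)
    show "subst ((4 * Z / (F\<^sup>2 * S) - Y * ((K + 8 * Q / F) * Z + 2 * M3 / F ^ 3)) / Y ^ 1) (Y * Z) (Z + cst 0) - cst (\<delta> 0)
      = (4 / (F\<^sup>2 * S) - Y * ((K + 8 * Q / F) * Z + 2 * M3 / F ^ 3)) / Y"
      unfolding S by (simp add: derivation_0[OF \<delta>], unfold S[symmetric], simp add: divide_simps S0 f_nonzero) algebra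
  qed (simp add: divide_simps S0 f_nonzero, algebra)
qed

definition "zc5_y = (let M = Y * Z + M3; S = Y * M + F in
   (24 * Q / F + 3 * K) * Y - 4 * Q\<^sup>2 * Y ^ 3 * M - 12 * Q * Y / S - 8 * Y * M / (F\<^sup>2 * S\<^sup>2) + 2 * M3 / (F ^ 3 * M))"
definition "zc5_z = (let M = Y * Z + M3; S = Y * M + F in
   4 * (Z * F - M3 * M) / (F ^ 3 * S)
   + (12 * Q * M / S + 8 * M\<^sup>2 / (F\<^sup>2 * S\<^sup>2) + 4 * Q\<^sup>2 * Y\<^sup>2 * M\<^sup>2 - (32 * Q / F + 4 * K) * M)
   - cst (\<delta> m3) - Z * zc5_y)"

lemma zc5: "blowup_uv \<delta> (zc4_y, zc4_z / Y) 0 m3 = (zc5_y, zc5_z / Y)"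
proof -
  obtain M where M: "M = Y * Z + M3" by blast
  obtain S where S: "S = Y * M + F" by blast
  have S0: "S \<noteq> 0" unfolding S M by (rule nonzeroI[of _ 0 0]) (simp_all add: f_nonzero)
  have dom: "dominant Y M" by (simp add: M)
  show ?thesis
  proof (rule blowup_uvI[OF \<delta>], unfold M[symmetric])
    show "subst zc4_y Y M = zc5_y"
      unfolding zc4_y_def zc5_y_def Let_def M[symmetric] by (simp add: dom)
    show "subst (zc4_z / Y) Y M - cst (\<delta> m3) = 4 * (Z * F - M3 * M) / (F ^ 3 * S)
   + (12 * Q * M / S + 8 * M\<^sup>2 / (F\<^sup>2 * S\<^sup>2) + 4 * Q\<^sup>2 * Y\<^sup>2 * M\<^sup>2 - (32 * Q / F + 4 * K) * M) - cst (\<delta> m3)"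
      unfolding zc4_z_def Let_def
      by (simp add: dom S[symmetric], simp add: divide_simps S0 f_nonzero) (use M S in algebra)
  qed (simp add: zc5_z_def Let_def M[symmetric] S[symmetric])
qed

lemma zc5': "blowup_UV \<delta> (zc4_y, zc4_z / Y) 0 m3 = (let M = Z + M3; R = Y * Z; S = R * M + F;
    J = 12 * Q * M / S + 8 * M\<^sup>2 / (F\<^sup>2 * S\<^sup>2) + 4 * Q\<^sup>2 * R\<^sup>2 * M\<^sup>2 - (32 * Q / F + 4 * K) * M;
    V = 4 * (F - M3 * Y * M) / (F ^ 3 * S) + Y * (J - cst (\<delta> m3)) in
    (((24 * Q / F + 3 * K) * R - 4 * Q\<^sup>2 * R ^ 3 * M - 12 * Q * R / S - 8 * R * M / (F\<^sup>2 * S\<^sup>2) + 2 * M3 / (F ^ 3 * M) - V) / Z,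
     V / Y))"
proof -
  obtain M where M: "M = Z + M3" by blast
  obtain R where R: "R = Y * Z" by blast
  obtain S where S: "S = R * M + F" by blast
  have S0: "S \<noteq> 0" unfolding S M R by (rule nonzeroI[of _ 0 0]) (simp_all add: f_nonzero)
  have R0: "R \<noteq> 0" by (simp add: R)
  have dom: "dominant R M" by (simp add: M R)
  obtain J where J: "J = 12 * Q * M / S + 8 * M\<^sup>2 / (F\<^sup>2 * S\<^sup>2) + 4 * Q\<^sup>2 * R\<^sup>2 * M\<^sup>2 - (32 * Q / F + 4 * K) * M"
    by blast
  obtain V where V: "V = 4 * (F - M3 * Y * M) / (F ^ 3 * S) + Y * (J - cst (\<delta> m3))" by blast
  show ?thesis
    unfolding Let_def M[symmetric] R[symmetric] S[symmetric] J[symmetric] V[symmetric]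
  proof (rule blowup_UVI[OF \<delta>], unfold M[symmetric] R[symmetric])
    show "subst zc4_y R M = (24 * Q / F + 3 * K) * R - 4 * Q\<^sup>2 * R ^ 3 * M - 12 * Q * R / S
        - 8 * R * M / (F\<^sup>2 * S\<^sup>2) + 2 * M3 / (F ^ 3 * M)"
      unfolding zc4_y_def Let_def by (simp add: dom S[symmetric])
    have "subst (zc4_z / Y) R M = 4 * (M * F - M3 * S) / (F ^ 3 * S) / R + J"
      unfolding zc4_z_def Let_def J
      by (simp add: dom S[symmetric]) (simp add: add_divide_distrib R0)
    also have "\<dots> - cst (\<delta> m3) = V / Y"
      unfolding V by (simp add: divide_simps R0 S0 f_nonzero) (use M S R in algebra)
    finally show "subst (zc4_z / Y) R M - cst (\<delta> m3) = V / Y" .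
  qed simp
qed

end

section \<open>Scalar identities for the positions of the centres, their derivatives and the
  resonance coefficients\<close>

lemma yc_identities:
  fixes q :: "'a::field_char_0"
  assumes "q \<noteq> 0"
  shows "2 * h - 4 * q * c = 0 \<longleftrightarrow> c = h / (2 * q)"
    and "h - 2 * (h - 4 * q\<^sup>2 * e - k * q) * (h / (2 * q))
      = 2 * q * (h / (2 * q) * (1 + 4 * q * e + k - 2 * (h / (2 * q))))"
    and "2 * d * n + 2 * q * x = 4 * m * y - y * (1 + k) \<Longrightarrow> x = ((4 * m - 1 - k) * y - 2 * n * d) / (2 * q)"
    and "4 * q * e * m - m * (1 + 4 * q * e + k - 2 * m) + 2 * q * c - 4 * q * c
      = 2 * q * ((2 * m\<^sup>2 - m * (1 + k)) / (2 * q) - c)"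
  subgoal using assms by (auto simp: field_simps)
  subgoal using assms by (simp add: divide_simps) algebra
  subgoal using assms by (simp add: divide_simps) algebra
  subgoal using assms by (simp add: divide_simps) algebra
  done

text \<open>The left side is the y-derivative of \<open>yc4_z\<close> at n2, the right side is
  \<delta> n2 after insertion of \<delta> m2 and \<delta> q. Their equality says that the resonance
  coefficient over [0 : 1 : 0] is zero.\<close>

lemma n2_identity:
  fixes q :: "'a::field_char_0"
  assumes "q \<noteq> 0" "m \<noteq> 0" and n: "n = (2 * m\<^sup>2 - m * (1 + k)) / (2 * q)" and h: "h = 2 * q * m"
  shows "4 * q * e * n + 4 * e * m\<^sup>2 - n * (4 * m - 4 * q * e - k + 2 * q * n / m)
    = ((4 * m - 1 - k) * (m * (1 + 4 * q * e + k - 2 * m)) - 2 * n * (h - 4 * q\<^sup>2 * e - k * q)) / (2 * q)"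
proof -
  have *: "2 * q * n / m = 2 * m - (1 + k)"
    unfolding n using assms(1,2) by (simp add: divide_simps) algebra
  show ?thesis
    unfolding * unfolding n h using assms(1,2) by (simp add: divide_simps) algebra
qed

lemma zc_identities:
  fixes f :: "'a::field_char_0"
  assumes "f \<noteq> 0" "m \<noteq> 0"
  shows "4 * (c * f - m * f) / (f ^ 3 * f) = 4 * (c - m) / f ^ 3"
    and "4 * (c * f - m * m) / (f ^ 3 * f)
      + (12 * q * m / f + 8 * m\<^sup>2 / (f\<^sup>2 * f\<^sup>2) - (32 * q / f + 4 * k) * m)
      - m * (lam + 10 * m / f ^ 4 - 20 * q / f - 5 * k) - c * (2 / f ^ 3)
      = 2 * (c - (3 * m\<^sup>2 / f + f ^ 3 * (lam - k) * m / 2)) / f ^ 3"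
    and "2 * f * (3 * m\<^sup>2 / f + f ^ 3 * (lam - k) * m / 2) = 6 * m\<^sup>2 + f\<^sup>2 * f\<^sup>2 * (lam - k) * m"
    and "2 * df * n + 2 * f * x = y \<Longrightarrow> x = (y - 2 * df * n) / (2 * f)"
    and "24 * q / f + (- (8 * m * f ^ 4 / f ^ 8) - 2 * m * (f ^ 3 * c) / (f ^ 3 * m)\<^sup>2 - 12 * q * f / f\<^sup>2)
      = 12 * q / f + (- (8 * m / f ^ 4) - 2 * c / (f ^ 3 * m))"
    and "4 * f * (f ^ 3 * f) / (f ^ 3 * f)\<^sup>2 = 4 / f ^ 3"
    and "(- (4 * (m * n) * (f ^ 3 * f)) - (4 * (n * f) - 4 * (m * m)) * (f ^ 3 * m)) / (f ^ 3 * f)\<^sup>2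
      + ((12 * q * n * f - 12 * q * m * m) / f\<^sup>2
        + (16 * (m * n) * f ^ 4 - 16 * (m\<^sup>2 * (f\<^sup>2 * (f * m)))) / f ^ 8)
      = 8 * (m * n) / f ^ 4 + (12 * q * n / f + (- (12 * m ^ 3 / f ^ 5) - 12 * q * m\<^sup>2 / f\<^sup>2))"
  subgoal using assms by (simp add: divide_simps) algebra
  subgoal using assms by (simp add: divide_simps) algebra
  subgoal using assms by (simp add: divide_simps) algebra
  subgoal using assms by (simp add: field_simps)
  subgoal using assms by (simp add: divide_simps) algebra
  subgoal using assms by (simp add: divide_simps) algebra
  subgoal using assms by (simp add: divide_simps) algebra
  done

text \<open>The analogue over [0 : 0 : 1], where n contains the term f^3 lam m / 2. Its derivative
  produces f^3 m / 2 times \<delta> lam, which nothing on the left can match; this defect is the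
  regularising condition.\<close>

lemma n3_identity:
  fixes f :: "'a::field_char_0"
  assumes "f \<noteq> 0" "m \<noteq> 0" and n: "n = 3 * m\<^sup>2 / f + f ^ 3 * (lam - k) * m / 2"
    and df: "df = 2 * m / f ^ 3 - 4 * q - k * f"
    and dm: "dm = m * (lam + 10 * m / f ^ 4 - 20 * q / f - 5 * k)"
  shows "4 * m ^ 3 / f ^ 5 - 8 * m * n / f ^ 4
        + 12 * q * n / f - 12 * q * m\<^sup>2 / f\<^sup>2 + 16 * m * n / f ^ 4 - 16 * m ^ 3 / f ^ 5
        - (32 * q / f + 4 * k) * n
        - n * (12 * q / f + 3 * k - 8 * m / f ^ 4 - 2 * n / (f ^ 3 * m))
      = (12 * m * dm + (4 * f ^ 3 * df * (lam - k) + f ^ 4 * dlam) * m + f ^ 4 * (lam - k) * dm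
        - 2 * df * n) / (2 * f) - f ^ 3 * m / 2 * dlam"
  unfolding n df dm using assms(1,2) by (simp add: divide_simps) algebra

context cascade
begin

section \<open>Base points of the three charts of the projective plane\<close>

lemma no_base_point_sys: "\<not> base_point sys a b"
  unfolding sys_def by (rule not_base_point_defined) simp_all

text \<open>On the line at infinity y = 0 the numerators are 8 z^2 and 12 z^3: everywhere but at the
  origin the line is polar without being indeterminate.\<close>

lemma base_point_sys_y: "base_point sys_y a b \<longleftrightarrow> a = 0 \<and> b = 0"
proof (cases "a = 0 \<and> b = 0")
  case True
  have "indeterminate_at (fst sys_y) 0 0"
    unfolding sys_y_def fst_conv by (rule indeterminate_over_y[of _ _ 1]) simp_all
  then show ?thesis using True by (simp add: base_point_def)
next
  case False
  then have "\<not> base_point sys_y a b"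
    unfolding sys_y_def
    by (intro not_base_pointI determinate_fraction) (cases "a = 0"; simp)+
  then show ?thesis using False by simp
qed

text \<open>On z = 0 the numerators are -12 y^2 and -4 y.\<close>

lemma base_point_sys_z: "base_point sys_z a b \<longleftrightarrow> a = 0 \<and> b = 0"
proof (cases "a = 0 \<and> b = 0")
  case True
  have "indeterminate_at (snd sys_z) 0 0"
    unfolding sys_z_def snd_conv by (rule indeterminate_over_z[of _ _ 1]) simp_all
  then show ?thesis using True by (simp add: base_point_def)
next
  case False
  then have "\<not> base_point sys_z a b"
    unfolding sys_z_def
    by (intro not_base_pointI determinate_fraction) (cases "b = 0"; simp)+
  then show ?thesis using False by simp
qed

lemma regularised_sys_iff:
  "regularised \<delta> sys \<longleftrightarrow> regularised_at \<delta> sys_y 0 0 \<and> regularised_at \<delta> sys_z 0 0"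
  unfolding regularised_def charts
  using no_base_point_sys base_point_sys_y base_point_sys_z by auto

text \<open>The leading coefficient on the exceptional curve is 4 c (c + q)^2. The cascade forks:
  its simple root 0 is settled at once, its double root -q is followed further.\<close>

lemma step_yc1: "regularised_at \<delta> sys_y 0 0 \<longleftrightarrow> (\<forall>c\<in>{0, - q}. regularised_at \<delta> yc1 0 c)"
proof (rule regularised_at_uv[OF yc1])
  show "base_point yc1 0 c \<longleftrightarrow> c \<in> {0, - q}" for c
    unfolding yc1_def power_one_right
    by (subst base_point_over_y[of _ _ q])
      (use nonzero in \<open>auto simp: power2_eq_square add_eq_0_iff\<close>)
  show "\<not> base_point (blowup_UV \<delta> sys_y 0 0) 0 0"
    unfolding yc1' by (intro not_base_pointI determinate_fraction) simp_all
qed simp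

text \<open>In the chart (u, v) the system is polynomial, and regularity in one of the two charts
  suffices. The other chart only contributes a pole with numerator 4 q^2 at the origin.\<close>

lemma regularised_yc1_0: "regularised_at \<delta> yc1 0 0"
proof (rule regularised_at.final)
  show "determinate_on_exceptional_curve \<delta> yc1 0 0"
    unfolding determinate_on_exceptional_curve_def yz yz'
  proof (intro allI conjI)
    show "\<not> base_point (4 * (Q + Z) + 4 * E\<^sup>2 * Y\<^sup>2 * Z - (8 * Q * E + K) * Y - 8 * E * Y * Z,
       (4 * (Q + Z)\<^sup>2 - Y * (K * Z + 4 * E * Z * (Z + 2 * Q))) / Y) 0 0"
      by (rule not_base_pointI[OF contrapos_nn[OF _ indeterminate_atD] determinate_fraction])
        (use nonzero in simp_all)
  qed (rule not_base_point_defined; simp)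
  show "(\<forall>c. regular_at (blowup_uv \<delta> yc1 0 0) 0 c) \<or> (\<forall>c. regular_at (blowup_UV \<delta> yc1 0 0) c 0)"
    unfolding yz by (simp add: regular_at_iff)
qed

text \<open>At the double root -q the zero curve of the numerator is tangent to the exceptional
  curve, as its term linear in y has the nonzero coefficient h after the shift. So the next base
  point is that tangent direction, the origin of the chart (U, V).\<close>

lemma step_yc2: "regularised_at \<delta> yc1 0 (- q) \<longleftrightarrow> regularised_at \<delta> yc2 0 0"
proof (rule regularised_at_UV[OF yc2])
  have "indeterminate_at (snd yc2) 0 0"
    unfolding yc2_def snd_conv
    \<comment> \<open>On Y = 0 the numerator is 4 c (c - q); the witness 2 q avoids both roots. The
      root q is the other branch of the fork, seen from this chart.\<close>
    by (rule indeterminate_over_y[of _ _ "2 * q"]) (use nonzero in simp_all)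
  then show "base_point yc2 0 0" by (simp add: base_point_def)
  show "\<not> base_point (blowup_uv \<delta> yc1 0 (- q)) 0 c" for c
    unfolding yc2'
    by (subst base_point_over_y[of _ _ 0]) (use nonzero in simp_all)
qed

lemma step_yc3: "regularised_at \<delta> yc2 0 0 \<longleftrightarrow> regularised_at \<delta> yc3 0 m2"
proof -
  have "regularised_at \<delta> yc2 0 0 \<longleftrightarrow> (\<forall>c\<in>{m2}. regularised_at \<delta> yc3 0 c)"
  proof (rule regularised_at_uv[OF yc3])
    show "base_point yc3 0 c \<longleftrightarrow> c \<in> {m2}" for c
    proof -
      have "\<not> indeterminate_at (fst yc3) 0 c"
        unfolding yc3_def fst_conv
        by (rule determinate_fraction) (use nonzero in simp_all)
      \<comment> \<open>The first component has a pole at the origin, so it is treated on its own,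
        and 0 takes its place in \<open>base_point_over_y\<close>.\<close>
      moreover have "base_point (0, snd yc3) 0 c \<longleftrightarrow> c = m2"
        unfolding yc3_def snd_conv power_one_right
        by (subst base_point_over_y[of _ _ 0]) (use nonzero yc_identities(1)[of q h c] in \<open>auto simp: m2_def\<close>)
      moreover have "\<not> indeterminate_at 0 0 c" using indeterminate_atD[of 0 0 c] by auto
      ultimately show ?thesis by (simp add: base_point_def)
    qed
    show "\<not> base_point (blowup_UV \<delta> yc2 0 0) 0 0"
      unfolding yc3' by (intro not_base_pointI determinate_fraction) (use nonzero in simp_all)
  qed simp
  then show ?thesis by simp
qed

lemma \<delta>_m2: "\<delta> m2 = m2 * (1 + 4 * q * e + k - 2 * m2)"
proof -
  have "\<delta> (2 * q * m2) = \<delta> h" using nonzero by (simp add: m2_def)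
  then have "2 * q * \<delta> m2 = h - 2 * (h - 4 * q\<^sup>2 * e - k * q) * m2"
    by (simp add: derivation_simps[OF \<delta>] \<delta>_h \<delta>_q algebra_simps)
  also have "\<dots> = 2 * q * (m2 * (1 + 4 * q * e + k - 2 * m2))"
    unfolding m2_def by (rule yc_identities(2)[OF nonzero(2)])
  finally show ?thesis using nonzero by simp
qed

text \<open>The root of the leading coefficient 2 q (n2 - c) of the second equation after the
  blow-up at m2.\<close>

definition "n2 = (2 * m2\<^sup>2 - m2 * (1 + k)) / (2 * q)"

lemma \<delta>_n2: "\<delta> n2 = ((4 * m2 - 1 - k) * \<delta> m2 - 2 * n2 * \<delta> q) / (2 * q)"
proof -
  have "\<delta> (2 * q * n2) = \<delta> (2 * m2\<^sup>2 - m2 * (1 + k))"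
    using nonzero by (simp add: n2_def)
  then have "2 * \<delta> q * n2 + 2 * q * \<delta> n2 = 4 * m2 * \<delta> m2 - \<delta> m2 * (1 + k)"
    by (simp add: derivation_simps[OF \<delta>] \<delta>_k)
  then show ?thesis by (rule yc_identities(3)[OF nonzero(2)])
qed

lemma yc4_y_value: "defined_at yc4_y 0 c" "value_at yc4_y 0 c = - 2 * q"
  using nonzero m2_nonzero by (simp_all add: yc4_y_def Let_def) (simp add: m2_def)

lemma yc4_z_value: "defined_at yc4_z 0 c" "value_at yc4_z 0 c = 2 * q * (n2 - c)"
  using nonzero m2_nonzero yc4_y_value[of c] yc_identities(4)[OF nonzero(2), of e m2 k c]
  by (simp_all add: yc4_z_def Let_def) (simp add: \<delta>_m2 n2_def algebra_simps)

lemma D_yc4_y: "value_at (D_y yc4_y) 0 c = 4 * m2 - 4 * q * e - k + 2 * q * c / m2"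
  using nonzero m2_nonzero
  by (simp add: yc4_y_def Let_def D_y_simps H_eq power2_eq_square mult_ac)

text \<open>The centres -q, m2 and n2 are built from q, h and k. Their derivatives contain e but not
  \<kappa>, and the resonance coefficient cancels identically, so no condition arises over
  [0 : 1 : 0].\<close>

lemma step_yc4: "regularised_at \<delta> yc3 0 m2"
proof -
  have "regularised_at \<delta> yc3 0 m2 \<longleftrightarrow> (\<forall>c\<in>{n2}. regularised_at \<delta> (yc4_y, yc4_z / Y) 0 c)"
  proof (rule regularised_at_uv[OF yc4])
    show "base_point (yc4_y, yc4_z / Y) 0 c \<longleftrightarrow> c \<in> {n2}" for c
      by (subst base_point_over_y[of _ _ "n2 + 1"])
        (use nonzero in \<open>auto simp: yc4_z_value yc4_y_value\<close>)
    show "\<not> base_point (blowup_UV \<delta> yc3 0 m2) 0 0"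
      unfolding yc4' Let_def
      by (intro not_base_pointI determinate_fraction)
        (use nonzero m2_nonzero in \<open>simp_all add: m2_def\<close>)
  qed simp
  also have "\<dots> \<longleftrightarrow> value_at (D_y yc4_z) 0 n2 = \<delta> n2"
  proof -
    \<comment> \<open>The same value as that of \<open>yc4_y\<close>; this coincidence of
      eigenvalues is the hypothesis of the resonance lemma.\<close>
    have "value_at (D_z yc4_z) 0 n2 = - 2 * q"
      using yc4_y_value m2_nonzero
      by (simp add: yc4_z_def Let_def D_z_simps, simp add: yc4_y_def Let_def D_z_simps)
    then show ?thesis
      using regularised_at_resonance[OF \<delta> yc4_y_value[of n2] _ yc4_z_value(1)[of n2]]
        nonzero by (simp add: yc4_z_value)
  qed
  also have "value_at (D_y yc4_z) 0 n2 = \<delta> n2"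
  proof -
    have "value_at (D_y yc4_z) 0 n2 = 4 * q * e * n2 + 4 * e * m2\<^sup>2
        - n2 * (4 * m2 - 4 * q * e - k + 2 * q * n2 / m2)"
      using yc4_y_value[of n2] m2_nonzero
      by (simp add: yc4_z_def Let_def D_y_simps D_yc4_y)
    also have "\<dots> = \<delta> n2"
    proof -
      have h: "h = 2 * q * m2" using nonzero by (simp add: m2_def)
      show ?thesis
        unfolding \<delta>_n2 \<delta>_m2 \<delta>_q by (rule n2_identity[OF nonzero(2) m2_nonzero n2_def h])
    qed
    finally show ?thesis .
  qed
  finally show ?thesis by simp
qed

lemma regularised_at_sys_y: "regularised_at \<delta> sys_y 0 0"
  using step_yc1 regularised_yc1_0 step_yc2 step_yc3 step_yc4 by simp

section \<open>The cascade over [0 : 0 : 1]\<close>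

lemma step_zc1: "regularised_at \<delta> sys_z 0 0 \<longleftrightarrow> regularised_at \<delta> zc1 0 0"
proof (rule regularised_at_UV[OF zc1])
  have "indeterminate_at (snd zc1) 0 0"
    unfolding zc1_def snd_conv
    by (rule indeterminate_over_z[of _ _ 1]) simp_all
  then show "base_point zc1 0 0" by (simp add: base_point_def)
  show "\<not> base_point (blowup_uv \<delta> sys_z 0 0) 0 c" for c
    unfolding zc1' by (intro not_base_pointI determinate_fraction) simp_all
qed

lemma ef: "e * f = 1" and ef_eq: "e * c = 1 \<longleftrightarrow> c = f"
  using nonzero by (simp_all add: f_def nonzero_eq_divide_eq mult.commute)

text \<open>On the exceptional curve the leading coefficient of the second equation is 4 (e c - 1)^2
  / c. Since e \<noteq> 0, its zero f is finite, and the origin of the other chart is only a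
  pole.\<close>

lemma step_zc2: "regularised_at \<delta> zc1 0 0 \<longleftrightarrow> regularised_at \<delta> zc2 0 f"
proof -
  have "regularised_at \<delta> zc1 0 0 \<longleftrightarrow> (\<forall>c\<in>{f}. regularised_at \<delta> zc2 0 c)"
  proof (rule regularised_at_uv[OF zc2])
    show "base_point zc2 0 c \<longleftrightarrow> c \<in> {f}" for c
    proof -
      have fst: "\<not> indeterminate_at (fst zc2) 0 c"
        unfolding zc2_def fst_conv by (rule determinate_fraction) (cases "c = 0"; simp)+
      have "indeterminate_at (snd zc2) 0 c \<longleftrightarrow> c = f"
      proof (cases "c = f")
        case True
        have "indeterminate_at (snd zc2) 0 f"
          unfolding zc2_def snd_conv
          \<comment> \<open>At 2 f the square is (2 - 1)^2 = 1, so the numerator is nonzero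
            there.\<close>
          by (rule indeterminate_over_y[of _ _ "2 * f"])
            (use f_nonzero in \<open>simp_all add: ef ef_eq power2_eq_square\<close>)
        with True show ?thesis by simp
      next
        case False
        \<comment> \<open>Moving 1 / Z into the denominator covers c = 0 as well: the new numerator
          has the value 4 there.\<close>
        have "snd zc2 = (4 * (E * Z - 1)\<^sup>2 + Y * Z * (4 * Q - K * Z - 8 * Q * E * Z)) / (Y * Z)"
          unfolding zc2_def by (simp add: divide_simps)
        moreover have "\<not> indeterminate_at \<dots> 0 c"
          by (rule determinate_fraction)
            (use False f_nonzero in \<open>auto simp: ef_eq\<close>)
        ultimately show ?thesis using False by metis
      qed
      with fst show ?thesis by (simp add: base_point_def)
    qed
    show "\<not> base_point (blowup_UV \<delta> zc1 0 0) 0 0"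
      unfolding zc2'
      by (rule not_base_pointI[OF determinate_fraction contrapos_nn[OF _ indeterminate_atD]])
        (use nonzero in simp_all)
  qed simp
  then show ?thesis by simp
qed

text \<open>As at -q before, a double root leads to the chart (U, V). The part of h is played by the
  residual term -2 m3 / f^3, so this step rests on \<kappa> \<noteq> 0.\<close>

lemma step_zc3: "regularised_at \<delta> zc2 0 f \<longleftrightarrow> regularised_at \<delta> zc3 0 0"
proof (rule regularised_at_UV[OF zc3])
  have "indeterminate_at (snd zc3) 0 0"
    unfolding zc3_def snd_conv Let_def
    by (rule indeterminate_over_y[of _ _ f]) (use f_nonzero in simp_all)
  then show "base_point zc3 0 0" by (simp add: base_point_def)
  show "\<not> base_point (blowup_uv \<delta> zc2 0 f) 0 c" for c
    unfolding zc3' Let_def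
    by (subst base_point_over_y[of _ _ 0]) (use f_nonzero m3_nonzero in simp_all)
qed

lemma zc4_z_value: "defined_at zc4_z 0 c" "value_at zc4_z 0 c = 4 * (c - m3) / f ^ 3"
  using f_nonzero zc_identities(1)[OF f_nonzero m3_nonzero, of c]
  by (simp_all add: zc4_z_def Let_def)

lemma step_zc4: "regularised_at \<delta> zc3 0 0 \<longleftrightarrow> regularised_at \<delta> (zc4_y, zc4_z / Y) 0 m3"
proof -
  have "regularised_at \<delta> zc3 0 0 \<longleftrightarrow> (\<forall>c\<in>{m3}. regularised_at \<delta> (zc4_y, zc4_z / Y) 0 c)"
  proof (rule regularised_at_uv[OF zc4])
    show "base_point (zc4_y, zc4_z / Y) 0 c \<longleftrightarrow> c \<in> {m3}" for c
    proof -
      obtain S where S: "S = Y * Z + F" by blast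
      have Sv: "defined_at S 0 c" "value_at S 0 c = f" by (simp_all add: S)
      have S0: "S \<noteq> 0" by (rule nonzeroI[of _ 0 c]) (simp_all add: Sv f_nonzero)
      \<comment> \<open>\<open>zc4_y\<close> has a pole at Z = 0; over the common denominator Z its
        numerator has the value 2 m3 / f^3 \<noteq> 0 there.\<close>
      have "zc4_y = (Z * ((24 * Q / F + 3 * K) * Y - 4 * Q\<^sup>2 * Y ^ 3 * Z - 12 * Q * Y / S
          - 8 * Y * Z / (F\<^sup>2 * S\<^sup>2)) + 2 * M3 / F ^ 3) / Z"
        unfolding zc4_y_def Let_def S[symmetric] by (simp add: divide_simps f_nonzero S0)
      moreover have "\<not> indeterminate_at \<dots> 0 c"
        by (rule determinate_fraction) (use f_nonzero m3_nonzero Sv in simp_all)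
      ultimately have "\<not> indeterminate_at zc4_y 0 c" by metis
      moreover have "base_point (0, zc4_z / Y) 0 c \<longleftrightarrow> c = m3"
        by (subst base_point_over_y[of _ _ 0])
          (use f_nonzero m3_nonzero in \<open>auto simp: zc4_z_value\<close>)
      moreover have "\<not> indeterminate_at 0 0 c" using indeterminate_atD[of 0 0 c] by auto
      ultimately show ?thesis by (simp add: base_point_def)
    qed
    show "\<not> base_point (blowup_UV \<delta> zc3 0 0) 0 0"
      unfolding zc4' Let_def
      by (intro not_base_pointI determinate_fraction) (use f_nonzero in simp_all)
  qed simp
  then show ?thesis by simp
qed

text \<open>The root of the leading coefficient in \<open>zc5_z\<close>. It depends on
  \<open>lam\<close> because \<delta> m3 was subtracted in the blow-up at m3.\<close>

definition "n3 = 3 * m3\<^sup>2 / f + f ^ 3 * (lam - k) * m3 / 2"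

lemma zc5_y_value: "defined_at zc5_y 0 c" "value_at zc5_y 0 c = 2 / f ^ 3"
  using f_nonzero m3_nonzero by (simp_all add: zc5_y_def Let_def)

lemma zc5_z_value: "defined_at zc5_z 0 c" "value_at zc5_z 0 c = 2 * (c - n3) / f ^ 3"
  using f_nonzero m3_nonzero zc5_y_value[of c] zc_identities(2)[OF f_nonzero m3_nonzero, of c q k lam]
  by (simp_all add: zc5_z_def Let_def \<delta>_m3 n3_def)

lemma D_zc5_y: "value_at (D_y zc5_y) 0 c = 12 * q / f + 3 * k - 8 * m3 / f ^ 4 - 2 * c / (f ^ 3 * m3)"
  using f_nonzero m3_nonzero
  by (simp add: zc5_y_def Let_def D_y_simps zc_identities(5)[OF f_nonzero m3_nonzero])

lemma \<delta>_n3: "\<delta> n3 = (12 * m3 * \<delta> m3 + (4 * f ^ 3 * \<delta> f * (lam - k) + f ^ 4 * \<delta> lam) * m3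
    + f ^ 4 * (lam - k) * \<delta> m3 - 2 * \<delta> f * n3) / (2 * f)"
proof (rule zc_identities(4)[OF f_nonzero m3_nonzero])
  have "2 * f * n3 = 6 * m3\<^sup>2 + f\<^sup>2 * f\<^sup>2 * (lam - k) * m3"
    unfolding n3_def by (rule zc_identities(3)[OF f_nonzero m3_nonzero])
  then have "\<delta> (2 * f * n3) = \<delta> (6 * m3\<^sup>2 + f\<^sup>2 * f\<^sup>2 * (lam - k) * m3)"
    by (rule arg_cong)
  then show "2 * \<delta> f * n3 + 2 * f * \<delta> n3 = 12 * m3 * \<delta> m3
      + (4 * f ^ 3 * \<delta> f * (lam - k) + f ^ 4 * \<delta> lam) * m3 + f ^ 4 * (lam - k) * \<delta> m3"
    unfolding derivation_simps[OF \<delta>] \<delta>_k by algebra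
qed

text \<open>The resonance coefficient is -f^3 m3 / 2 times \<delta> lam, and its factor f^3 m3 is
  nonzero.\<close>

lemma step_zc5: "regularised_at \<delta> (zc4_y, zc4_z / Y) 0 m3 \<longleftrightarrow> \<delta> lam = 0"
proof -
  have "regularised_at \<delta> (zc4_y, zc4_z / Y) 0 m3
      \<longleftrightarrow> (\<forall>c\<in>{n3}. regularised_at \<delta> (zc5_y, zc5_z / Y) 0 c)"
  proof (rule regularised_at_uv[OF zc5])
    show "base_point (zc5_y, zc5_z / Y) 0 c \<longleftrightarrow> c \<in> {n3}" for c
      by (subst base_point_over_y[of _ _ "n3 + 1"])
        (use f_nonzero in \<open>auto simp: zc5_z_value zc5_y_value\<close>)
    show "\<not> base_point (blowup_UV \<delta> (zc4_y, zc4_z / Y) 0 m3) 0 0"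
      unfolding zc5' Let_def
      by (intro not_base_pointI determinate_fraction)
        (use f_nonzero m3_nonzero in simp_all)
  qed simp
  also have "\<dots> \<longleftrightarrow> value_at (D_y zc5_z) 0 n3 = \<delta> n3"
  proof -
    \<comment> \<open>This is 4 / f^3 from the first term of \<open>zc5_z\<close> minus the value 2
      / f^3 of \<open>zc5_y\<close>, hence again the eigenvalue of the first equation.\<close>
    have "value_at (D_z zc5_z) 0 n3 = 2 / f ^ 3"
      using zc5_y_value m3_nonzero f_nonzero
      by (simp add: zc5_z_def Let_def D_z_simps,
          simp add: zc5_y_def Let_def D_z_simps zc_identities(6)[OF f_nonzero m3_nonzero])
    then show ?thesis
      using regularised_at_resonance[OF \<delta> zc5_y_value[of n3] _ zc5_z_value(1)[of n3]]
        f_nonzero by (simp add: zc5_z_value)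
  qed
  also have "\<dots> \<longleftrightarrow> \<delta> lam = 0"
  proof -
    have "value_at (D_y zc5_z) 0 n3 = 4 * m3 ^ 3 / f ^ 5 - 8 * m3 * n3 / f ^ 4
        + 12 * q * n3 / f - 12 * q * m3\<^sup>2 / f\<^sup>2 + 16 * m3 * n3 / f ^ 4 - 16 * m3 ^ 3 / f ^ 5
        - (32 * q / f + 4 * k) * n3
        - n3 * (12 * q / f + 3 * k - 8 * m3 / f ^ 4 - 2 * n3 / (f ^ 3 * m3))"
      using zc5_y_value[of n3] m3_nonzero f_nonzero
      by (simp add: zc5_z_def Let_def D_y_simps D_zc5_y zc_identities(7)[OF f_nonzero m3_nonzero])
    moreover have "\<dots> = \<delta> n3 - f ^ 3 * m3 / 2 * \<delta> lam"
      unfolding \<delta>_n3 by (rule n3_identity[OF f_nonzero m3_nonzero n3_def \<delta>_f \<delta>_m3])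
    ultimately have "value_at (D_y zc5_z) 0 n3 = \<delta> n3 - f ^ 3 * m3 / 2 * \<delta> lam" by (rule trans)
    then show ?thesis using f_nonzero m3_nonzero by auto
  qed
  finally show ?thesis .
qed

theorem regularised_sys: "regularised \<delta> sys \<longleftrightarrow> \<delta> lam = 0"
  using regularised_sys_iff regularised_at_sys_y step_zc1 step_zc2 step_zc3 step_zc4 step_zc5 by simp

end

section \<open>Rescaling the derivation\<close>

text \<open>The cancelled factor r divides both the numerator and the denominator of f, which are
  coprime; so it is a unit and has no zeros.\<close>

lemma
  assumes c: "c \<noteq> 0"
  shows poly2_num_scale: "poly2 (num (cst c * f)) a b = 0 \<longleftrightarrow> poly2 (num f) a b = 0"
    and poly2_den_scale: "poly2 (den (cst c * f)) a b = 0 \<longleftrightarrow> poly2 (den f) a b = 0"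
proof -
  have "cst c * f = to_fract ([:[:c:]:] * num f) / to_fract (den f)"
    unfolding to_fract_mult times_divide_eq_right[symmetric] by (simp only: num_div_den cst_def)
  then obtain r where r: "[:[:c:]:] * num f = num (cst c * f) * r" "den f = den (cst c * f) * r"
    using num_den_reduced[OF _ den_nonzero] by blast
  have "[:[:1 / c:]:] * [:[:c:]:] = (1 :: 'a poly poly)"
    using c by (simp add: one_pCons)
  then have "[:[:1 / c:]:] * ([:[:c:]:] * num f) = num f"
    by (simp only: mult.assoc[symmetric] mult_1)
  then have "r dvd num f" using r(1) by (metis dvd_mult dvd_triv_right)
  moreover have "r dvd den f" using r(2) by (metis dvd_triv_right)
  ultimately have "r dvd 1" using coprime_num_den coprime_common_divisor by blast
  then obtain s where "1 = r * s" ..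
  then have "poly2 1 a b = poly2 r a b * poly2 s a b" by (metis poly2_simps(6))
  then have r0: "poly2 r a b \<noteq> 0" by auto
  have "c * poly2 (num f) a b = poly2 (num (cst c * f)) a b * poly2 r a b"
    using r(1) by (metis poly2_simps(6) poly2_simps(8))
  then show "poly2 (num (cst c * f)) a b = 0 \<longleftrightarrow> poly2 (num f) a b = 0" using r0 c by auto
  have "poly2 (den f) a b = poly2 (den (cst c * f)) a b * poly2 r a b"
    using r(2) by (metis poly2_simps(6))
  then show "poly2 (den (cst c * f)) a b = 0 \<longleftrightarrow> poly2 (den f) a b = 0" using r0 by auto
qed

text \<open>Replacing d/dx by c d/dx multiplies the right-hand sides by c. The process is invariant
  under this, which allows x d/dx to be used in the cascades.\<close>

definition scale_system :: "'k::field_gcd \<Rightarrow> 'k system \<Rightarrow> 'k system" where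
  "scale_system c S = (cst c * fst S, cst c * snd S)"

lemma base_point_scale: "c \<noteq> 0 \<Longrightarrow> base_point (scale_system c S) a b \<longleftrightarrow> base_point S a b"
  by (simp add: base_point_def indeterminate_at_def scale_system_def poly2_num_scale poly2_den_scale)

lemma regular_at_scale: "c \<noteq> 0 \<Longrightarrow> regular_at (scale_system c S) a b \<longleftrightarrow> regular_at S a b"
  by (simp add: regular_at_def scale_system_def poly2_den_scale)

lemma derivation_scale: "derivation \<delta> \<Longrightarrow> derivation (\<lambda>a. c * \<delta> a)"
  by (simp add: derivation_def algebra_simps)

lemma blowup_uv_scale:
  assumes \<delta>: "derivation \<delta>"
  shows "blowup_uv (\<lambda>a. c * \<delta> a) (scale_system c S) a b = scale_system c (blowup_uv \<delta> S a b)"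
  using blowup_uv_eq[OF \<delta>, of "fst S" "snd S" a b]
    blowup_uv_eq[OF derivation_scale[OF \<delta>, of c], of "cst c * fst S" "cst c * snd S" a b]
  by (simp add: scale_system_def) (simp add: algebra_simps)

lemma blowup_UV_scale:
  assumes \<delta>: "derivation \<delta>"
  shows "blowup_UV (\<lambda>a. c * \<delta> a) (scale_system c S) a b = scale_system c (blowup_UV \<delta> S a b)"
  using blowup_UV_eq[OF \<delta>, of "fst S" "snd S" a b]
    blowup_UV_eq[OF derivation_scale[OF \<delta>, of c], of "cst c * fst S" "cst c * snd S" a b]
  by (simp add: scale_system_def) (simp add: algebra_simps)

lemma determinate_scale:
  assumes "derivation \<delta>" "c \<noteq> 0"
  shows "determinate_on_exceptional_curve (\<lambda>a. c * \<delta> a) (scale_system c S) a b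
    \<longleftrightarrow> determinate_on_exceptional_curve \<delta> S a b"
  using assms
  by (simp add: determinate_on_exceptional_curve_def blowup_uv_scale blowup_UV_scale base_point_scale)

lemma regularised_at_scaleI:
  assumes \<delta>: "derivation \<delta>" and c: "c \<noteq> 0"
  shows "regularised_at \<delta> S a b \<Longrightarrow> regularised_at (\<lambda>a. c * \<delta> a) (scale_system c S) a b"
proof (induction rule: regularised_at.induct)
  case (final S a b)
  then show ?case
    by (intro regularised_at.final)
      (simp_all add: determinate_scale[OF \<delta> c] blowup_uv_scale[OF \<delta>] blowup_UV_scale[OF \<delta>]
        regular_at_scale[OF c])
next
  case (blow_up S a b)
  show ?case
  proof (rule regularised_at.blow_up)
    show "\<not> determinate_on_exceptional_curve (\<lambda>a. c * \<delta> a) (scale_system c S) a b"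
      unfolding determinate_scale[OF \<delta> c] by (rule blow_up.hyps(1))
    show "regularised_at (\<lambda>a. c * \<delta> a) (blowup_uv (\<lambda>a. c * \<delta> a) (scale_system c S) a b) 0 d"
      if "base_point (blowup_uv (\<lambda>a. c * \<delta> a) (scale_system c S) a b) 0 d" for d
      using that unfolding blowup_uv_scale[OF \<delta>] base_point_scale[OF c] by (rule blow_up.IH(1))
    show "regularised_at (\<lambda>a. c * \<delta> a) (blowup_UV (\<lambda>a. c * \<delta> a) (scale_system c S) a b) 0 0"
      if "base_point (blowup_UV (\<lambda>a. c * \<delta> a) (scale_system c S) a b) 0 0"
      using that unfolding blowup_UV_scale[OF \<delta>] base_point_scale[OF c] by (rule blow_up.IH(2))
  qed
qed

lemma scale_system_inverse: "c \<noteq> 0 \<Longrightarrow> scale_system (1 / c) (scale_system c S) = S"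
  by (simp add: scale_system_def)

text \<open>The converse direction is the same implication for the factor 1 / c.\<close>

lemma regularised_at_scale:
  assumes \<delta>: "derivation \<delta>" and c: "c \<noteq> 0"
  shows "regularised_at (\<lambda>a. c * \<delta> a) (scale_system c S) a b \<longleftrightarrow> regularised_at \<delta> S a b"
proof
  assume "regularised_at (\<lambda>a. c * \<delta> a) (scale_system c S) a b"
  from regularised_at_scaleI[OF derivation_scale[OF \<delta>] _ this, of "1 / c"]
  show "regularised_at \<delta> S a b" using c by (simp add: scale_system_inverse)
qed (rule regularised_at_scaleI[OF assms])

lemma projective_charts_scale:
  assumes \<delta>: "derivation \<delta>"
  shows "projective_charts (\<lambda>a. c * \<delta> a) (scale_system c S) = scale_system c ` projective_charts \<delta> S"
proof -
  obtain P Q where S: "S = (P, Q)" by (cases S)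
  show ?thesis
    unfolding S projective_charts_def scale_system_def fst_conv snd_conv image_insert image_empty
      in_coordinates_infinity_y[OF \<delta>] in_coordinates_infinity_z[OF \<delta>]
      in_coordinates_infinity_y[OF derivation_scale[OF \<delta>]]
      in_coordinates_infinity_z[OF derivation_scale[OF \<delta>]]
    by (intro arg_cong2[where f = insert] arg_cong2[where f = Pair] refl; simp add: algebra_simps)
qed

lemma regularised_scale:
  assumes "derivation \<delta>" "c \<noteq> 0"
  shows "regularised (\<lambda>a. c * \<delta> a) (scale_system c S) \<longleftrightarrow> regularised \<delta> S"
  unfolding regularised_def projective_charts_scale[OF assms(1)]
  by (simp add: base_point_scale[OF assms(2)] regularised_at_scale[OF assms])

section \<open>The system attached to an arbitrary function\<close>

text \<open>The differential equations assumed in the locale, for e, q and \<kappa>. With \<kappa> =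
  x K one has g = -4 q^3 K, so the first identity is the definition of K and the factor in the third
  one is 1 + x K'/K.\<close>

lemma painleve_identities:
  fixes x :: "'a::field_char_0"
  assumes "x \<noteq> 0" "q \<noteq> 0"
    and e: "e = (x * (2 * \<eta> - q1) - k * q) / (4 * q\<^sup>2)"
  shows "x * (((2 * \<eta> - q1 - x * q2 - k * q1) * (4 * q\<^sup>2)
        - (x * (2 * \<eta> - q1) - k * q) * (4 * (2 * q * q1))) / (4 * q\<^sup>2)\<^sup>2)
      = - x * (q * q1 + x * q * q2 - x * q1\<^sup>2 + 4 * \<eta>\<^sup>2 * x - 2 * \<eta> * (k + 1) * q) / (4 * q ^ 3)
        + 4 * q * e\<^sup>2 + k * e"
    and "x * q1 = 2 * \<eta> * x - 4 * q\<^sup>2 * e - k * q"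
    and "g \<noteq> 0 \<Longrightarrow> x * ((- (g + x * g1) * (4 * q ^ 3) + x * g * (4 * (3 * q\<^sup>2 * q1))) / (4 * q ^ 3)\<^sup>2)
      = (1 + x * (q * g1 - 3 * g * q1) / (g * q)) * (- x * g / (4 * q ^ 3))"
proof -
  define W where "W = x * (2 * \<eta> - q1) - k * q"
  have 1: "(A * (4 * q\<^sup>2) - W * (4 * (2 * q * q1))) / (4 * q\<^sup>2)\<^sup>2 = (q * A - 2 * W * q1) / (4 * q ^ 3)" for A
    using assms(2) by (simp add: divide_simps) algebra
  have 2: "4 * q * e\<^sup>2 + k * e = (W\<^sup>2 + k * q * W) / (4 * q ^ 3)"
    unfolding e W_def[symmetric] using assms(2) by (simp add: divide_simps) algebra
  have "x * (q * (2 * \<eta> - q1 - x * q2 - k * q1) - 2 * W * q1)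
      = - x * (q * q1 + x * q * q2 - x * q1\<^sup>2 + 4 * \<eta>\<^sup>2 * x - 2 * \<eta> * (k + 1) * q) + (W\<^sup>2 + k * q * W)"
    unfolding W_def by algebra
  then show "x * (((2 * \<eta> - q1 - x * q2 - k * q1) * (4 * q\<^sup>2)
        - (x * (2 * \<eta> - q1) - k * q) * (4 * (2 * q * q1))) / (4 * q\<^sup>2)\<^sup>2)
      = - x * (q * q1 + x * q * q2 - x * q1\<^sup>2 + 4 * \<eta>\<^sup>2 * x - 2 * \<eta> * (k + 1) * q) / (4 * q ^ 3)
        + 4 * q * e\<^sup>2 + k * e"
    unfolding W_def[symmetric] 1 add.assoc 2 times_divide_eq_right add_divide_distrib[symmetric]
    by (rule arg_cong[where f = "\<lambda>t. t / (4 * q ^ 3)"])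
  show "x * q1 = 2 * \<eta> * x - 4 * q\<^sup>2 * e - k * q"
    unfolding e using assms(1,2) by (simp add: divide_simps) algebra
  show "x * ((- (g + x * g1) * (4 * q ^ 3) + x * g * (4 * (3 * q\<^sup>2 * q1))) / (4 * q ^ 3)\<^sup>2)
      = (1 + x * (q * g1 - 3 * g * q1) / (g * q)) * (- x * g / (4 * q ^ 3))" if "g \<noteq> 0"
  proof -
    have "(- (g + x * g1) * (4 * q ^ 3) + x * g * (4 * (3 * q\<^sup>2 * q1))) / (4 * q ^ 3)\<^sup>2
        = (- (g + x * g1) * q + 3 * x * g * q1) / (4 * q ^ 3 * q)"
      using assms(2) by (simp add: divide_simps) algebra
    moreover have "1 + x * (q * g1 - 3 * g * q1) / (g * q) = (g * q + x * (q * g1 - 3 * g * q1)) / (g * q)"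
      using assms(2) that by (simp add: divide_simps)
    moreover have "A / (g * q) * (- x * g / (4 * q ^ 3)) = - x * A / (4 * q ^ 3 * q)" for A
      using assms(2) that by (simp add: divide_simps)
    moreover have "x * (- (g + x * g1) * q + 3 * x * g * q1) = - x * (g * q + x * (q * g1 - 3 * g * q1))"
      by algebra
    ultimately show ?thesis by (simp only: times_divide_eq_right)
  qed
qed

lemma bg_identities:
  fixes x :: "'a::field"
  assumes "x \<noteq> 0" "q \<noteq> 0" "s \<noteq> 0" "2 \<noteq> (0 :: 'a)" and s: "s\<^sup>2 = x"
    and e: "2 * \<eta> - q1 = (4 * q\<^sup>2 * e + (2 * \<kappa>0 + 1) * q) / x"
  shows "x * bg_rhs_y \<eta> \<kappa>0 s x q q1 y z = 16 * q * e * y + 2 * (2 * \<kappa>0 + 1) * y + 12 * e * y * z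
      - 4 * y\<^sup>2 * (q + z) * (q + 2 * z) - 4 * e\<^sup>2"
    and "x * bg_rhs_z \<eta> \<kappa>0 x q q1 y z = 4 * y * z * (q + z)\<^sup>2 - (2 * \<kappa>0 + 1) * z - 4 * e * z * (z + 2 * q)"
proof -
  \<comment> \<open>The base of the square is -2 e / s, so only s^2 = x survives.\<close>
  have "k / (2 * s * q) - s * ((4 * q\<^sup>2 * e + k * q) / s\<^sup>2) / (2 * q\<^sup>2) = - 2 * e / s" for k
    using assms(2-4) by (simp add: divide_simps) algebra
  then have "((2 * \<kappa>0 + 1) / (2 * s * q) - s * ((4 * q\<^sup>2 * e + (2 * \<kappa>0 + 1) * q) / x) / (2 * q\<^sup>2))\<^sup>2
      = (- 2 * e / s)\<^sup>2"
    by (simp only: s)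
  also have "\<dots> = 4 * e\<^sup>2 / x"
    by (simp add: power_divide power_mult_distrib s)
  finally have sq: "((2 * \<kappa>0 + 1) / (2 * s * q)
      - s * ((4 * q\<^sup>2 * e + (2 * \<kappa>0 + 1) * q) / x) / (2 * q\<^sup>2))\<^sup>2 = 4 * e\<^sup>2 / x" .
  have p: "(4 * q\<^sup>2 * e + k * q) / x / q = (4 * q * e + k) / x" for k
    using assms(1,2) by (simp add: divide_simps) algebra
  show "x * bg_rhs_y \<eta> \<kappa>0 s x q q1 y z = 16 * q * e * y + 2 * (2 * \<kappa>0 + 1) * y + 12 * e * y * z
      - 4 * y\<^sup>2 * (q + z) * (q + 2 * z) - 4 * e\<^sup>2"
    unfolding bg_rhs_y_def e sq p using assms(1,2) by (simp add: divide_simps) algebra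
  show "x * bg_rhs_z \<eta> \<kappa>0 x q q1 y z = 4 * y * z * (q + z)\<^sup>2 - (2 * \<kappa>0 + 1) * z - 4 * e * z * (z + 2 * q)"
    unfolding bg_rhs_z_def e p using assms(1,2) by (simp add: divide_simps) algebra
qed

lemma painleve_identity:
  fixes x :: "'a::field_char_0"
  assumes "x \<noteq> 0" "q \<noteq> 0" and e: "e = (x * p - k * q) / (4 * q\<^sup>2)"
  shows "p = (4 * q\<^sup>2 * e + k * q) / x"
  unfolding e using assms(1,2) by (simp add: divide_simps)

text \<open>Since g = -4 q^3 K, the differentiated expression x (g'/g - 3 q'/q) is x K'/K. It
  differs from \<open>lam\<close> by the constant 1, as \<kappa> = x K.\<close>

theorem regularised_bg:
  fixes \<delta> :: "'k::{field_gcd, field_char_0} \<Rightarrow> 'k"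
  assumes \<delta>: "derivation \<delta>" and x: "\<delta> x = 1" "x \<noteq> 0" and q: "q \<noteq> 0"
    and \<eta>: "\<eta> \<noteq> 0" "\<delta> \<eta> = 0" and \<kappa>0: "\<delta> \<kappa>0 = 0" and s: "s\<^sup>2 = x"
    and g: "g = q * \<delta> q + x * q * \<delta> (\<delta> q) - x * (\<delta> q)\<^sup>2 + 4 * \<eta>\<^sup>2 * x - 4 * \<eta> * (\<kappa>0 + 1) * q" "g \<noteq> 0"
  shows "regularised \<delta>
      (bg_rhs_y (cst \<eta>) (cst \<kappa>0) (cst s) (cst x) (cst q) (cst (\<delta> q)) var_y var_z,
       bg_rhs_z (cst \<eta>) (cst \<kappa>0) (cst x) (cst q) (cst (\<delta> q)) var_y var_z)
    \<longleftrightarrow> \<delta> (x * (q * \<delta> g - 3 * g * \<delta> q) / (g * q)) = 0"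
proof -
  define k where "k = 2 * \<kappa>0 + 1"
  define h where "h = 2 * \<eta> * x"
  obtain e where e: "e = (x * (2 * \<eta> - \<delta> q) - k * q) / (4 * q\<^sup>2)" by blast
  obtain \<kappa> where \<kappa>: "\<kappa> = - x * g / (4 * q ^ 3)" by blast
  obtain lam where lam: "lam = 1 + x * (q * \<delta> g - 3 * g * \<delta> q) / (g * q)" by blast
  have \<delta>k: "\<delta> k = 0" by (simp add: k_def derivation_simps[OF \<delta>] \<kappa>0)
  have \<kappa>_nz: "\<kappa> \<noteq> 0" using g(2) x q by (simp add: \<kappa>)
  have g': "q * \<delta> q + x * q * \<delta> (\<delta> q) - x * (\<delta> q)\<^sup>2 + 4 * \<eta>\<^sup>2 * x - 2 * \<eta> * (k + 1) * q = g"
    unfolding g(1) k_def by (simp add: algebra_simps)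
  have \<delta>e: "x * \<delta> e = \<kappa> + 4 * q * e\<^sup>2 + k * e"
  proof -
    have "\<delta> e = ((2 * \<eta> - \<delta> q - x * \<delta> (\<delta> q) - k * \<delta> q) * (4 * q\<^sup>2)
        - (x * (2 * \<eta> - \<delta> q) - k * q) * (4 * (2 * q * \<delta> q))) / (4 * q\<^sup>2)\<^sup>2"
      unfolding e derivation_divide[OF \<delta>] derivation_simps[OF \<delta>] \<delta>k x \<eta> by simp
    then show ?thesis
      using painleve_identities(1)[OF x(2) q e, of "\<delta> (\<delta> q)"] unfolding g' \<kappa> by simp
  qed
  \<comment> \<open>For e = 0 the Riccati equation for e would reduce to 0 = \<kappa>.\<close>
  have e_nz: "e \<noteq> 0"
  proof
    assume "e = 0"
    then show False using \<delta>e derivation_0[OF \<delta>] \<kappa>_nz by simp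
  qed
  have \<delta>\<kappa>: "x * \<delta> \<kappa> = lam * \<kappa>"
  proof -
    have "\<delta> \<kappa> = (- (g + x * \<delta> g) * (4 * q ^ 3) + x * g * (4 * (3 * q\<^sup>2 * \<delta> q))) / (4 * q ^ 3)\<^sup>2"
      unfolding \<kappa> derivation_divide[OF \<delta>] derivation_simps[OF \<delta>] x by (simp add: algebra_simps)
    then show ?thesis
      using painleve_identities(3)[OF x(2) q e g(2), of "\<delta> g"] unfolding \<kappa> lam by simp
  qed
  interpret cascade "\<lambda>a. x * \<delta> a" e q h k \<kappa> lam
  proof
    show "derivation (\<lambda>a. x * \<delta> a)" by (rule derivation_scale[OF \<delta>])
    show "x * \<delta> q = h - 4 * q\<^sup>2 * e - k * q"
      unfolding h_def by (rule painleve_identities(2)[OF x(2) q e])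
    show "h \<noteq> 0" using \<eta> x by (simp add: h_def)
    show "x * \<delta> h = h" unfolding h_def derivation_simps[OF \<delta>] \<eta> x by simp
    show "x * \<delta> k = 0" by (simp only: \<delta>k mult_zero_right)
  qed (rule e_nz q \<kappa>_nz \<delta>e \<delta>\<kappa>)+
  have s_nz: "s \<noteq> 0" using s x by auto
  have E: "2 * cst \<eta> - cst (\<delta> q) = (4 * (cst q)\<^sup>2 * cst e + (2 * cst \<kappa>0 + 1) * cst q) / cst x"
  proof -
    have "cst (2 * \<eta> - \<delta> q) = cst ((4 * q\<^sup>2 * e + k * q) / x)"
      by (rule arg_cong[OF painleve_identity[OF x(2) q e]])
    then show ?thesis by (simp add: k_def)
  qed
  have num: "2 \<noteq> (0 :: 'k ratfun)"
    using cst_eq_0_iff[of "2 :: 'k"] by simp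
  have S: "(cst s)\<^sup>2 = cst x" using s by (metis cst_power)
  let ?S = "(bg_rhs_y (cst \<eta>) (cst \<kappa>0) (cst s) (cst x) (cst q) (cst (\<delta> q)) var_y var_z,
       bg_rhs_z (cst \<eta>) (cst \<kappa>0) (cst x) (cst q) (cst (\<delta> q)) var_y var_z)"
  have sys: "scale_system x ?S = sys"
    unfolding sys_def scale_system_def fst_conv snd_conv
    using bg_identities[OF _ _ _ num S E, of var_y var_z] x q s_nz by (simp add: k_def)
  have "regularised \<delta> ?S \<longleftrightarrow> regularised (\<lambda>a. x * \<delta> a) (scale_system x ?S)"
    by (rule regularised_scale[OF assms(1) x(2), symmetric])
  also have "\<dots> \<longleftrightarrow> x * \<delta> lam = 0"
    unfolding sys by (rule regularised_sys)
  also have "x * \<delta> lam = x * \<delta> (x * (q * \<delta> g - 3 * g * \<delta> q) / (g * q))"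
    unfolding lam derivation_add[OF assms(1)] derivation_1[OF assms(1)] by (simp only: add_0)
  finally show ?thesis
    using x(2) by simp
qed

section \<open>Laurent expansions\<close>

lemma of_nat_fls_eq_iff: "(of_nat m :: 'a::semiring_char_0 fls) = of_nat n \<longleftrightarrow> m = n"
proof
  assume "of_nat m = (of_nat n :: 'a fls)"
  then have "fls_nth (of_nat m :: 'a fls) 0 = fls_nth (of_nat n) 0" by simp
  then show "m = n" by (simp add: fls_of_nat_nth)
qed simp

text \<open>The cascades, which need characteristic 0, are applied over
  \<open>complex fls\<close>.\<close>

instance fls :: (semiring_char_0) semiring_char_0
  by standard (simp add: inj_def of_nat_fls_eq_iff)

instance fls :: (ring_char_0) ring_char_0 ..

instance fls :: (field_char_0) field_char_0 ..

lemma derivation_fls_deriv: "derivation (fls_deriv :: complex fls \<Rightarrow> _)"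
  by (simp add: derivation_def)

lemma laurent_expansion_works:
  assumes "f meromorphic_on {z}"
  shows "(\<lambda>w. f (z + w)) has_laurent_expansion laurent_expansion f z"
proof -
  obtain F where "(\<lambda>w. f (z + w)) has_laurent_expansion F"
    using assms by (auto simp: meromorphic_on_def)
  then show ?thesis using laurent_expansion_eqI by metis
qed

lemma laurent_expansion_const: "laurent_expansion (\<lambda>_. c) z = fls_const c"
  by (rule laurent_expansion_eqI) simp

lemma laurent_expansion_ident: "laurent_expansion (\<lambda>x. x) z = fls_const z + fls_X"
  by (rule laurent_expansion_eqI) (intro laurent_expansion_intros)

lemma
  assumes f: "f meromorphic_on {z}" and g: "g meromorphic_on {z}"
  shows laurent_expansion_add:
      "laurent_expansion (\<lambda>x. f x + g x) z = laurent_expansion f z + laurent_expansion g z"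
    and laurent_expansion_diff:
      "laurent_expansion (\<lambda>x. f x - g x) z = laurent_expansion f z - laurent_expansion g z"
    and laurent_expansion_mult:
      "laurent_expansion (\<lambda>x. f x * g x) z = laurent_expansion f z * laurent_expansion g z"
    and laurent_expansion_divide:
      "laurent_expansion (\<lambda>x. f x / g x) z = laurent_expansion f z / laurent_expansion g z"
  by (rule laurent_expansion_eqI, intro laurent_expansion_intros laurent_expansion_works f g)+

lemma laurent_expansion_power:
  assumes f: "f meromorphic_on {z}"
  shows "laurent_expansion (\<lambda>x. f x ^ n) z = laurent_expansion f z ^ n"
  by (rule laurent_expansion_eqI, intro laurent_expansion_intros laurent_expansion_works f)

lemma laurent_expansion_uminus:
  assumes f: "f meromorphic_on {z}"
  shows "laurent_expansion (\<lambda>x. - f x) z = - laurent_expansion f z"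
  by (rule laurent_expansion_eqI, intro laurent_expansion_intros laurent_expansion_works f)

lemma laurent_expansion_deriv:
  assumes f: "f meromorphic_on {z}"
  shows "laurent_expansion (deriv f) z = fls_deriv (laurent_expansion f z)"
proof (rule laurent_expansion_eqI)
  have "deriv (\<lambda>w. f (z + w)) = (\<lambda>w. deriv f (z + w))"
    by (simp add: deriv_shift_0' fun_eq_iff o_def add_ac)
  then show "(\<lambda>w. deriv f (z + w)) has_laurent_expansion fls_deriv (laurent_expansion f z)"
    using has_laurent_expansion_deriv[OF laurent_expansion_works[OF f]] by simp
qed

lemma laurent_expansion_eq_0_imp_value:
  assumes f: "f analytic_on {z}" and "laurent_expansion f z = 0"
  shows "f z = 0"
proof -
  have "(\<lambda>w. f (z + w)) has_laurent_expansion laurent_expansion f z"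
    by (intro laurent_expansion_works analytic_on_imp_meromorphic_on f)
  then have "eventually (\<lambda>x. f x = 0) (at z)"
    using has_laurent_expansion_eventually_zero_iff assms(2) by blast
  then have "f \<midarrow>z\<rightarrow> 0" by (simp add: tendsto_eventually)
  moreover have "f \<midarrow>z\<rightarrow> f z"
    using analytic_at_imp_isCont[OF f] by (simp add: isCont_def)
  ultimately show ?thesis using LIM_unique by blast
qed

lemma laurent_expansion_eq_0I:
  assumes "open D" "z \<in> D" "\<And>x. x \<in> D \<Longrightarrow> f x = 0"
  shows "laurent_expansion f z = 0"
proof -
  have "eventually (\<lambda>x. f x = 0) (at z)"
    using assms by (auto simp: eventually_at_topological)
  then show ?thesis by (simp add: laurent_expansion_def)
qed

text \<open>The identity theorem: one nonzero value in a connected domain makes the germ nonzero at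
  every point. It turns genericity of q on D into genericity at each expansion point.\<close>

lemma laurent_expansion_nonzero:
  assumes "open D" "connected D" "f holomorphic_on D" "z \<in> D" "w \<in> D" "f w \<noteq> 0"
  shows "laurent_expansion f z \<noteq> 0"
proof
  assume "laurent_expansion f z = 0"
  have an: "f analytic_on {z}"
    using assms by (auto simp: analytic_at)
  have "(\<lambda>w. f (z + w)) has_laurent_expansion laurent_expansion f z"
    by (intro laurent_expansion_works analytic_on_imp_meromorphic_on an)
  then have "eventually (\<lambda>x. f x = 0) (at z)"
    using has_laurent_expansion_eventually_zero_iff \<open>laurent_expansion f z = 0\<close> by blast
  then obtain S where S: "open S" "z \<in> S" "\<And>x. x \<in> S \<Longrightarrow> x \<noteq> z \<Longrightarrow> f x = 0"
    by (auto simp: eventually_at_topological)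
  have "f z = 0" using laurent_expansion_eq_0_imp_value an \<open>laurent_expansion f z = 0\<close> by blast
  then have "f x = 0" if "x \<in> S \<inter> D" for x using S that by (cases "x = z") auto
  moreover have "z islimpt (S \<inter> D)"
    using S assms by (intro interior_limit_point) (simp add: interior_open open_Int)
  ultimately have "f w = 0"
    using analytic_continuation[OF assms(3,1,2) _ assms(4) _ _ assms(5), of "S \<inter> D"] by blast
  then show False using assms by simp
qed

section \<open>Differential polynomials\<close>

primrec total_deriv :: "diff_poly \<Rightarrow> diff_poly" where
  "total_deriv (Const c) = Const 0"
| "total_deriv Indep = Const 1"
| "total_deriv (Jet n) = Jet (Suc n)"
| "total_deriv (Plus F G) = Plus (total_deriv F) (total_deriv G)"
| "total_deriv (Times F G) = Plus (Times (total_deriv F) G) (Times F (total_deriv G))"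

definition power_dp :: "diff_poly \<Rightarrow> nat \<Rightarrow> diff_poly" where
  "power_dp F n = (Times F ^^ n) (Const 1)"

lemma holomorphic_eval_dp:
  assumes "q holomorphic_on D" "open D"
  shows "eval_dp F q holomorphic_on D"
proof (induction F)
  case (Jet n)
  have "eval_dp (Jet n) q = (deriv ^^ n) q" by (simp add: fun_eq_iff)
  then show ?case using holomorphic_higher_deriv[OF assms] by simp
qed (auto intro!: holomorphic_intros simp: fun_eq_iff cong: holomorphic_cong)

lemma eval_total_deriv:
  assumes q: "q holomorphic_on D" "open D" "x \<in> D"
  shows "(eval_dp F q has_field_derivative eval_dp (total_deriv F) q x) (at x)"
proof (induction F)
  case (Jet n)
  have "eval_dp (Jet n) q = (deriv ^^ n) q" by (simp add: fun_eq_iff)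
  moreover have "((deriv ^^ n) q has_field_derivative deriv ((deriv ^^ n) q) x) (at x)"
    using holomorphic_derivI[OF holomorphic_higher_deriv[OF q(1,2)] q(2,3)] .
  ultimately show ?case by simp
next
  case (Const c)
  have "eval_dp (Const c) q = (\<lambda>_. c)" by (simp add: fun_eq_iff)
  then show ?case by simp
next
  case Indep
  have "eval_dp Indep q = (\<lambda>x. x)" by (simp add: fun_eq_iff)
  then show ?case by simp
next
  case (Plus F G)
  have "eval_dp (Plus F G) q = (\<lambda>x. eval_dp F q x + eval_dp G q x)" by (simp add: fun_eq_iff)
  then show ?case using DERIV_add[OF Plus] by simp
next
  case (Times F G)
  have "eval_dp (Times F G) q = (\<lambda>x. eval_dp F q x * eval_dp G q x)" by (simp add: fun_eq_iff)
  then show ?case using DERIV_mult[OF Times] by (simp add: mult.commute)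
qed

definition jet_germ :: "complex \<Rightarrow> (complex \<Rightarrow> complex) \<Rightarrow> diff_poly \<Rightarrow> complex fls" where
  "jet_germ z q F = laurent_expansion (eval_dp F q) z"

text \<open>Expansion at z is a homomorphism of differential rings from differential polynomials to
  Laurent series.\<close>

lemma jet_germ_simps:
  assumes q: "q holomorphic_on D" "open D" "z \<in> D"
  shows "jet_germ z q (Const c) = fls_const c"
    "jet_germ z q Indep = fls_const z + fls_X"
    "jet_germ z q (Jet 0) = laurent_expansion q z"
    "jet_germ z q (Plus F G) = jet_germ z q F + jet_germ z q G"
    "jet_germ z q (Times F G) = jet_germ z q F * jet_germ z q G"
    "jet_germ z q (total_deriv F) = fls_deriv (jet_germ z q F)"
proof -
  have mero: "eval_dp F q meromorphic_on {z}" for F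
    using holomorphic_eval_dp[OF q(1,2), of F] q
    by (intro analytic_on_imp_meromorphic_on) (auto simp: analytic_at)
  have "eval_dp (Const c) q = (\<lambda>_. c)" "eval_dp Indep q = (\<lambda>x. x)" "eval_dp (Jet 0) q = q"
    "eval_dp (Plus F G) q = (\<lambda>x. eval_dp F q x + eval_dp G q x)"
    "eval_dp (Times F G) q = (\<lambda>x. eval_dp F q x * eval_dp G q x)"
    by (simp_all add: fun_eq_iff)
  then show "jet_germ z q (Const c) = fls_const c"
    "jet_germ z q Indep = fls_const z + fls_X"
    "jet_germ z q (Jet 0) = laurent_expansion q z"
    "jet_germ z q (Plus F G) = jet_germ z q F + jet_germ z q G"
    "jet_germ z q (Times F G) = jet_germ z q F * jet_germ z q G"
    by (simp_all add: jet_germ_def laurent_expansion_const laurent_expansion_ident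
        laurent_expansion_add laurent_expansion_mult mero)
  have "eventually (\<lambda>x. x \<in> D) (at z)"
    using q by (auto simp: eventually_at_topological)
  then have "eventually (\<lambda>x. eval_dp (total_deriv F) q x = deriv (eval_dp F q) x) (at z)"
    by eventually_elim (metis DERIV_imp_deriv eval_total_deriv q(1,2))
  then have "laurent_expansion (eval_dp (total_deriv F) q) z = laurent_expansion (deriv (eval_dp F q)) z"
    by (intro laurent_expansion_cong refl)
  then show "jet_germ z q (total_deriv F) = fls_deriv (jet_germ z q F)"
    by (simp add: jet_germ_def laurent_expansion_deriv mero)
qed

lemma vanishes_on_iff_jet_germ:
  assumes q: "q holomorphic_on D" "open D"
  shows "vanishes_on D F q \<longleftrightarrow> (\<forall>z\<in>D. jet_germ z q F = 0)"
proof
  assume "vanishes_on D F q"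
  then show "\<forall>z\<in>D. jet_germ z q F = 0"
    unfolding jet_germ_def vanishes_on_def by (metis laurent_expansion_eq_0I q(2))
next
  assume *: "\<forall>z\<in>D. jet_germ z q F = 0"
  show "vanishes_on D F q"
    unfolding vanishes_on_def
  proof
    fix z assume z: "z \<in> D"
    have "eval_dp F q analytic_on {z}"
      using holomorphic_eval_dp[OF q, of F] q z by (auto simp: analytic_at)
    then show "eval_dp F q z = 0"
      using * z laurent_expansion_eq_0_imp_value unfolding jet_germ_def by blast
  qed
qed

lemma jet_germ_nonzero:
  assumes q: "q holomorphic_on D" "open D" "connected D" "\<not> vanishes_on D F q" "z \<in> D"
  shows "jet_germ z q F \<noteq> 0"
  unfolding jet_germ_def using assms laurent_expansion_nonzero[OF q(2,3) holomorphic_eval_dp[OF q(1,2)]]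
  by (auto simp: vanishes_on_def)

section \<open>The change of variables to the Hamiltonian system\<close>

text \<open>Here c is -e, so \<open>bg_identities\<close> apply. The second equation is the
  z_3-equation after the product rule for y z + c, hence it contains y' multiplied by z.\<close>

lemma transformation_identities:
  fixes x :: "'a::field"
  assumes "x \<noteq> 0" "q \<noteq> 0" "s \<noteq> 0" "2 \<noteq> (0 :: 'a)" "s\<^sup>2 = x"
    and q1: "2 * \<eta> - q1 = (4 * q\<^sup>2 * (- c) + (2 * \<kappa>0 + 1) * q) / x"
    and c1: "c1 = - \<kappa> - (4 * q * c\<^sup>2 - (2 * \<kappa>0 + 1) * c) / x"
  shows "(4 * (z + q)\<^sup>2 * (y * z + c) - (2 * \<kappa>0 + 1) * (z + q) + 2 * \<eta> * x) / x - q1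
      = bg_rhs_z \<eta> \<kappa>0 x q q1 y z"
    and "(- 4 * (z + q) * (y * z + c)\<^sup>2 - \<kappa> * x + (2 * \<kappa>0 + 1) * (y * z + c)) / x - c1
      - y * bg_rhs_z \<eta> \<kappa>0 x q q1 y z = z * bg_rhs_y \<eta> \<kappa>0 s x q q1 y z"
proof -
  have bg: "bg_rhs_y \<eta> \<kappa>0 s x q q1 y z = (16 * q * (- c) * y + 2 * (2 * \<kappa>0 + 1) * y + 12 * (- c) * y * z
      - 4 * y\<^sup>2 * (q + z) * (q + 2 * z) - 4 * (- c)\<^sup>2) / x"
    "bg_rhs_z \<eta> \<kappa>0 x q q1 y z = (4 * y * z * (q + z)\<^sup>2 - (2 * \<kappa>0 + 1) * z - 4 * (- c) * z * (z + 2 * q)) / x"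
    unfolding bg_identities[OF assms(1-6), symmetric] using assms(1) by simp_all
  have q1': "q1 = 2 * \<eta> - (4 * q\<^sup>2 * (- c) + (2 * \<kappa>0 + 1) * q) / x"
    using q1 by (simp add: algebra_simps)
  show "(4 * (z + q)\<^sup>2 * (y * z + c) - (2 * \<kappa>0 + 1) * (z + q) + 2 * \<eta> * x) / x - q1
      = bg_rhs_z \<eta> \<kappa>0 x q q1 y z"
    unfolding bg(2) unfolding q1' using assms(1) by (simp add: divide_simps) algebra
  show "(- 4 * (z + q) * (y * z + c)\<^sup>2 - \<kappa> * x + (2 * \<kappa>0 + 1) * (y * z + c)) / x - c1
      - y * bg_rhs_z \<eta> \<kappa>0 x q q1 y z = z * bg_rhs_y \<eta> \<kappa>0 s x q q1 y z"
    unfolding bg c1 using assms(1) by (simp add: divide_simps) algebra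
qed

text \<open>The assumption on g says that K is the constant \<kappa>. In terms of c, the summand of
  z_3 besides y z, it becomes a Riccati equation with coefficients in q and x.\<close>

lemma painleve_shift_derivative:
  fixes x :: "'a::field_char_0"
  assumes "x \<noteq> 0" "q \<noteq> 0"
    and c: "c = x * (q1 - 2 * \<eta>) / (4 * q\<^sup>2) + (2 * \<kappa>0 + 1) / (4 * q)"
    and g: "q * q1 + x * q * q2 - x * q1\<^sup>2 + 4 * \<eta>\<^sup>2 * x - 4 * \<eta> * (\<kappa>0 + 1) * q = - 4 * \<kappa> * q ^ 3"
  shows "((q1 - 2 * \<eta> + x * q2) * (4 * q\<^sup>2) - x * (q1 - 2 * \<eta>) * (4 * (2 * q * q1))) / (4 * q\<^sup>2)\<^sup>2
      + - (2 * \<kappa>0 + 1) * (4 * q1) / (4 * q)\<^sup>2 = - \<kappa> - (4 * q * c\<^sup>2 - (2 * \<kappa>0 + 1) * c) / x"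
    and "2 * \<eta> - q1 = (4 * q\<^sup>2 * (- c) + (2 * \<kappa>0 + 1) * q) / x"
proof -
  define k where "k = 2 * \<kappa>0 + 1"
  define p where "p = q1 - 2 * \<eta>"
  have c': "c = (x * p + k * q) / (4 * q\<^sup>2)"
    unfolding c k_def[symmetric] p_def[symmetric] using assms(2) by (simp add: divide_simps) algebra
  have "((p + x * q2) * (4 * q\<^sup>2) - x * p * (4 * (2 * q * q1))) / (4 * q\<^sup>2)\<^sup>2 + - k * (4 * q1) / (4 * q)\<^sup>2
      = (q * (p + x * q2) - 2 * x * p * q1 - k * q * q1) / (4 * q ^ 3)"
    using assms(2) by (simp add: divide_simps) algebra
  also have "\<dots> = (- 4 * \<kappa> * q ^ 3 - p * (x * p + k * q)) / (4 * q ^ 3)"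
  proof -
    have "q * (p + x * q2) - 2 * x * p * q1 - k * q * q1 = - 4 * \<kappa> * q ^ 3 - p * (x * p + k * q)"
      using g unfolding k_def p_def by algebra
    then show ?thesis by (rule arg_cong)
  qed
  also have "\<dots> = - \<kappa> - p * (x * p + k * q) / (4 * q ^ 3)"
    using assms(2) by (simp add: diff_divide_distrib)
  also have "p * (x * p + k * q) / (4 * q ^ 3) = (4 * q * c\<^sup>2 - k * c) / x"
    unfolding c' using assms(1,2) by (simp add: divide_simps) algebra
  finally show "((q1 - 2 * \<eta> + x * q2) * (4 * q\<^sup>2) - x * (q1 - 2 * \<eta>) * (4 * (2 * q * q1))) / (4 * q\<^sup>2)\<^sup>2
      + - (2 * \<kappa>0 + 1) * (4 * q1) / (4 * q)\<^sup>2 = - \<kappa> - (4 * q * c\<^sup>2 - (2 * \<kappa>0 + 1) * c) / x"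
    unfolding p_def k_def .
  have "- p = (4 * q\<^sup>2 * (- c) + k * q) / x"
    unfolding c' using assms(1,2) by (simp add: divide_simps)
  then show "2 * \<eta> - q1 = (4 * q\<^sup>2 * (- c) + (2 * \<kappa>0 + 1) * q) / x"
    unfolding p_def k_def by simp
qed

lemma painleve_polynomial:
  fixes x :: "'a::field"
  assumes "x \<noteq> 0" "q \<noteq> 0"
    and "q2 = q1\<^sup>2 / q - q1 / x + (- 4 * \<kappa> * q\<^sup>2 + 4 * \<eta> * (\<kappa>0 + 1)) / x + 0 * q ^ 3 + (- 4 * \<eta>\<^sup>2) / q"
  shows "q * q1 + x * q * q2 - x * q1\<^sup>2 + 4 * \<eta>\<^sup>2 * x - 4 * \<eta> * (\<kappa>0 + 1) * q = - 4 * \<kappa> * q ^ 3"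
  unfolding assms(3) using assms(1,2) by (simp add: divide_simps) algebra

lemma deriv_eq_on_open:
  assumes "open U" "x \<in> U" "\<forall>x\<in>U. f x = g x" "(g has_field_derivative d) (at x)"
  shows "deriv f x = d"
proof (rule DERIV_imp_deriv)
  show "(f has_field_derivative d) (at x)"
    by (rule has_field_derivative_transform_within_open[OF assms(4,1,2)]) (use assms(3) in simp)
qed

lemma solutions_correspond:
  fixes \<eta>0 \<kappa>0 \<kappa>inf :: complex
  assumes U: "open U" "U \<subseteq> D" "0 \<notin> D" and D: "open D" and x: "x \<in> U"
    and hol: "q holomorphic_on D" "y holomorphic_on U" "z holomorphic_on U"
    and nz: "\<forall>x\<in>D. q x \<noteq> 0" "\<forall>x\<in>U. z x \<noteq> 0"
    and P: "painleve_III (-4 * \<kappa>inf) (4 * \<eta>0 * (\<kappa>0 + 1)) 0 (-4 * \<eta>0\<^sup>2) D q"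
    and y3: "\<forall>x\<in>U. y3 x = z x + q x"
    and z3: "\<forall>x\<in>U. z3 x = y x * z x + x * (deriv q x - 2 * \<eta>0) / (4 * (q x)\<^sup>2) + (2 * \<kappa>0 + 1) / (4 * q x)"
  shows "(deriv y3 x = deriv (\<lambda>w. ham_D7 \<eta>0 \<kappa>0 \<kappa>inf x (y3 x) w) (z3 x) \<and>
          deriv z3 x = - deriv (\<lambda>w. ham_D7 \<eta>0 \<kappa>0 \<kappa>inf x w (z3 x)) (y3 x))
    \<longleftrightarrow> (deriv y x = bg_rhs_y \<eta>0 \<kappa>0 (csqrt x) x (q x) (deriv q x) (y x) (z x) \<and>
         deriv z x = bg_rhs_z \<eta>0 \<kappa>0 x (q x) (deriv q x) (y x) (z x))"
proof -
  have xD: "x \<in> D" and x0: "x \<noteq> 0" using U x by auto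
  have q0: "q x \<noteq> 0" and z0: "z x \<noteq> 0" using nz xD x by auto
  define c where "c = x * (deriv q x - 2 * \<eta>0) / (4 * (q x)\<^sup>2) + (2 * \<kappa>0 + 1) / (4 * q x)"
  define c1 where "c1 = - \<kappa>inf - (4 * q x * c\<^sup>2 - (2 * \<kappa>0 + 1) * c) / x"
  have g: "q x * deriv q x + x * q x * deriv (deriv q) x - x * (deriv q x)\<^sup>2 + 4 * \<eta>0\<^sup>2 * x
      - 4 * \<eta>0 * (\<kappa>0 + 1) * q x = - 4 * \<kappa>inf * q x ^ 3"
    using P xD unfolding painleve_III_def by (intro painleve_polynomial[OF x0 q0]) blast
  note shift = painleve_shift_derivative[OF x0 q0 c_def g]
  have dq: "(q has_field_derivative deriv q x) (at x)"
    using holomorphic_derivI[OF hol(1) D xD] .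
  have ddq: "(deriv q has_field_derivative deriv (deriv q) x) (at x)"
    using holomorphic_derivI[OF holomorphic_deriv[OF hol(1) D] D xD] .
  have dy: "(y has_field_derivative deriv y x) (at x)" and dz: "(z has_field_derivative deriv z x) (at x)"
    using holomorphic_derivI[OF hol(2) U(1) x] holomorphic_derivI[OF hol(3) U(1) x] by auto
  have "((\<lambda>x. z x + q x) has_field_derivative deriv z x + deriv q x) (at x)"
    by (intro DERIV_add dz dq)
  then have dy3: "deriv y3 x = deriv z x + deriv q x"
    by (rule deriv_eq_on_open[OF U(1) x y3])
  have "((\<lambda>x. x * (deriv q x - 2 * \<eta>0) / (4 * (q x)\<^sup>2) + (2 * \<kappa>0 + 1) / (4 * q x))
      has_field_derivative c1) (at x)"
  proof -
    have "((\<lambda>x. x * (deriv q x - 2 * \<eta>0)) has_field_derivative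
        deriv q x - 2 * \<eta>0 + x * deriv (deriv q) x) (at x)"
      using DERIV_mult[OF DERIV_ident DERIV_diff[OF ddq DERIV_const[of "2 * \<eta>0"]]]
      by (simp add: mult.commute)
    moreover have "((\<lambda>x. 4 * (q x)\<^sup>2) has_field_derivative 4 * (2 * q x * deriv q x)) (at x)"
      using DERIV_cmult[OF DERIV_power[OF dq, of 2], of 4] by (simp add: mult_ac)
    moreover have "((\<lambda>x. 4 * q x) has_field_derivative 4 * deriv q x) (at x)"
      by (rule DERIV_cmult[OF dq])
    moreover have "((\<lambda>_. 2 * \<kappa>0 + 1) has_field_derivative 0) (at x)"
      by simp
    ultimately have "((\<lambda>x. x * (deriv q x - 2 * \<eta>0) / (4 * (q x)\<^sup>2) + (2 * \<kappa>0 + 1) / (4 * q x))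
      has_field_derivative
        ((deriv q x - 2 * \<eta>0 + x * deriv (deriv q) x) * (4 * (q x)\<^sup>2)
          - x * (deriv q x - 2 * \<eta>0) * (4 * (2 * q x * deriv q x))) / (4 * (q x)\<^sup>2 * (4 * (q x)\<^sup>2))
        + (0 * (4 * q x) - (2 * \<kappa>0 + 1) * (4 * deriv q x)) / (4 * q x * (4 * q x))) (at x)"
      using q0 by (intro DERIV_add DERIV_divide) simp_all
    then show ?thesis
      unfolding c1_def shift(1)[symmetric] by (simp only: power2_eq_square mult_zero_left diff_0 mult_minus_left)
  qed
  from DERIV_add[OF DERIV_mult[OF dy dz] this]
  have "((\<lambda>x. y x * z x + x * (deriv q x - 2 * \<eta>0) / (4 * (q x)\<^sup>2) + (2 * \<kappa>0 + 1) / (4 * q x))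
      has_field_derivative deriv y x * z x + y x * deriv z x + c1) (at x)"
    by (simp add: add_ac mult_ac)
  then have dz3: "deriv z3 x = deriv y x * z x + y x * deriv z x + c1"
    by (rule deriv_eq_on_open[OF U(1) x z3])
  have "((\<lambda>w. ham_D7 \<eta>0 \<kappa>0 \<kappa>inf x a w) has_field_derivative
      (4 * a\<^sup>2 * b - (2 * \<kappa>0 + 1) * a + 2 * \<eta>0 * x) / x) (at b)" for a b
    unfolding ham_D7_def using x0 by (auto intro!: derivative_eq_intros simp: field_simps power2_eq_square)
  then have Hz: "deriv (\<lambda>w. ham_D7 \<eta>0 \<kappa>0 \<kappa>inf x a w) b
      = (4 * a\<^sup>2 * b - (2 * \<kappa>0 + 1) * a + 2 * \<eta>0 * x) / x" for a b
    by (rule DERIV_imp_deriv)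
  have "((\<lambda>w. ham_D7 \<eta>0 \<kappa>0 \<kappa>inf x w b) has_field_derivative
      - ((- 4 * a * b\<^sup>2 - \<kappa>inf * x + (2 * \<kappa>0 + 1) * b) / x)) (at a)" for a b
    unfolding ham_D7_def using x0 by (auto intro!: derivative_eq_intros simp: field_simps power2_eq_square)
  then have Hy: "- deriv (\<lambda>w. ham_D7 \<eta>0 \<kappa>0 \<kappa>inf x w b) a
      = (- 4 * a * b\<^sup>2 - \<kappa>inf * x + (2 * \<kappa>0 + 1) * b) / x" for a b
    by (metis DERIV_imp_deriv minus_minus)
  have y3z3: "y3 x = z x + q x" "z3 x = y x * z x + c"
    using y3 z3 x by (simp_all add: c_def)
  have s: "csqrt x \<noteq> 0" "(2 :: complex) \<noteq> 0" "(csqrt x)\<^sup>2 = x" using x0 by simp_all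
  note ids = transformation_identities[OF x0 q0 s shift(2) c1_def]
  let ?by = "bg_rhs_y \<eta>0 \<kappa>0 (csqrt x) x (q x) (deriv q x) (y x) (z x)"
    and ?bz = "bg_rhs_z \<eta>0 \<kappa>0 x (q x) (deriv q x) (y x) (z x)"
  have "deriv z x + deriv q x = A \<longleftrightarrow> deriv z x = A - deriv q x" for A
    by (auto simp: algebra_simps)
  then have 1: "deriv y3 x = deriv (\<lambda>w. ham_D7 \<eta>0 \<kappa>0 \<kappa>inf x (y3 x) w) (z3 x) \<longleftrightarrow> deriv z x = ?bz"
    unfolding Hz dy3 y3z3 ids(1)[symmetric] .
  \<comment> \<open>The equation for z_3 involves z' through y z; it determines y' once the equation
    for z holds, and then by division by z.\<close>
  have 2: "deriv z3 x = - deriv (\<lambda>w. ham_D7 \<eta>0 \<kappa>0 \<kappa>inf x w (z3 x)) (y3 x)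
      \<longleftrightarrow> deriv y x = ?by" if bz: "deriv z x = ?bz"
  proof -
    let ?A = "(- 4 * (z x + q x) * (y x * z x + c)\<^sup>2 - \<kappa>inf * x + (2 * \<kappa>0 + 1) * (y x * z x + c)) / x"
    have "deriv z3 x = - deriv (\<lambda>w. ham_D7 \<eta>0 \<kappa>0 \<kappa>inf x w (z3 x)) (y3 x)
        \<longleftrightarrow> deriv y x * z x + y x * ?bz + c1 = ?A"
      unfolding Hy dz3 y3z3 bz ..
    also have "\<dots> \<longleftrightarrow> deriv y x * z x = ?A - c1 - y x * ?bz"
      by (auto simp only: eq_diff_eq add_ac)
    also have "\<dots> \<longleftrightarrow> deriv y x = ?by"
      unfolding ids(2) using z0 by (simp add: mult.commute)
    finally show ?thesis .
  qed
  show ?thesis using 1 2 by blast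
qed

section \<open>Birational equivalence\<close>

lemma hamiltonian_system_D7:
  fixes \<eta> \<kappa>0 \<kappa> x :: "'k::field_gcd"
  assumes "x \<noteq> 0"
  shows "hamiltonian_system (ham_D7 (cst \<eta>) (cst \<kappa>0) (cst \<kappa>) (cst x) var_y var_z) =
    ((4 * var_y\<^sup>2 * var_z - (2 * cst \<kappa>0 + 1) * var_y + 2 * cst \<eta> * cst x) / cst x,
     (- 4 * var_y * var_z\<^sup>2 - cst \<kappa> * cst x + (2 * cst \<kappa>0 + 1) * var_z) / cst x)"
  unfolding hamiltonian_system_def ham_D7_def
  by (intro arg_cong2[where f = Pair]; simp add: D_z_simps D_y_simps;
      simp add: assms divide_simps; simp add: algebra_simps power2_eq_square)

text \<open>The transformation is triangular: z is y_3 - q, and then y is (z_3 - c) / z.\<close>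

lemma shift_subst:
  fixes q c :: "'k::field_gcd"
  shows "mutually_inverse (var_z + cst q, var_y * var_z + cst c)
      ((var_z - cst c) / (var_y - cst q), var_y - cst q)"
    and "dominant ((var_z - cst c) / (var_y - cst q)) (var_y - cst q)"
proof -
  let ?Y = "(var_z - cst c) / (var_y - cst q)" and ?Z = "var_y - cst q"
    and ?U = "var_z + cst q" and ?V = "var_y * var_z + cst c"
  have nz: "var_y - cst q \<noteq> 0" by simp
  have YZ: "subst ?Y ?U ?V = var_y" "subst ?Z ?U ?V = var_z"
  proof -
    show "subst ?Z ?U ?V = var_z"
      unfolding vars_as_to_fract(3)
      by (simp only: subst_to_fract poly2_subst_simps poly2_subst_const poly2_subst_y) simp
    show "subst ?Y ?U ?V = var_y"
      unfolding vars_as_to_fract(3,4)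
      by (subst subst_poly_fraction;
          simp only: poly2_subst_simps poly2_subst_const poly2_subst_y poly2_subst_z; simp)
  qed
  have UV: "subst ?U ?Y ?Z = var_y" "subst ?V ?Y ?Z = var_z"
    unfolding vars_as_to_fract(2,5)
    by (simp_all only: subst_to_fract poly2_subst_simps poly2_subst_const poly2_subst_y poly2_subst_z)
      (use nz in simp_all)
  show "mutually_inverse (?U, ?V) (?Y, ?Z)"
    unfolding mutually_inverse_def using YZ UV by simp
  show "dominant ?Y ?Z" by (rule dominantI[OF YZ])
qed

theorem bg_transformation:
  fixes \<delta> :: "'k::{field_gcd, field_char_0} \<Rightarrow> 'k"
  assumes \<delta>: "derivation \<delta>" and x: "\<delta> x = 1" "x \<noteq> 0" and q: "q \<noteq> 0"
    and \<eta>: "\<delta> \<eta> = 0" and \<kappa>0: "\<delta> \<kappa>0 = 0" and s: "s\<^sup>2 = x"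
    and c: "c = x * (\<delta> q - 2 * \<eta>) / (4 * q\<^sup>2) + (2 * \<kappa>0 + 1) / (4 * q)"
    and P: "q * \<delta> q + x * q * \<delta> (\<delta> q) - x * (\<delta> q)\<^sup>2 + 4 * \<eta>\<^sup>2 * x - 4 * \<eta> * (\<kappa>0 + 1) * q
      = - 4 * \<kappa> * q ^ 3"
  shows "in_coordinates \<delta>
      (bg_rhs_y (cst \<eta>) (cst \<kappa>0) (cst s) (cst x) (cst q) (cst (\<delta> q)) var_y var_z,
       bg_rhs_z (cst \<eta>) (cst \<kappa>0) (cst x) (cst q) (cst (\<delta> q)) var_y var_z)
      (var_z + cst q, var_y * var_z + cst c) ((var_z - cst c) / (var_y - cst q), var_y - cst q)
    = hamiltonian_system (ham_D7 (cst \<eta>) (cst \<kappa>0) (cst \<kappa>) (cst x) var_y var_z)"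
proof -
  let ?Y = "(var_z - cst c) / (var_y - cst q)" and ?Z = "var_y - cst q"
  let ?P = "bg_rhs_y (cst \<eta>) (cst \<kappa>0) (cst s) (cst x) (cst q) (cst (\<delta> q))"
    and ?Q = "bg_rhs_z (cst \<eta>) (cst \<kappa>0) (cst x) (cst q) (cst (\<delta> q))"
  note shift = painleve_shift_derivative[OF x(2) q c P]
  note dom = shift_subst(2)[of c q]
  have \<delta>c: "\<delta> c = - \<kappa> - (4 * q * c\<^sup>2 - (2 * \<kappa>0 + 1) * c) / x"
  proof -
    have "\<delta> c = ((\<delta> q - 2 * \<eta> + x * \<delta> (\<delta> q)) * (4 * q\<^sup>2) - x * (\<delta> q - 2 * \<eta>) * (4 * (2 * q * \<delta> q)))
        / (4 * q\<^sup>2)\<^sup>2 + - (2 * \<kappa>0 + 1) * (4 * \<delta> q) / (4 * q)\<^sup>2"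
      unfolding c derivation_add[OF \<delta>] derivation_divide[OF \<delta>] derivation_simps[OF \<delta>] x \<eta> \<kappa>0
      by (simp only: mult_zero_left mult_zero_right add_0_left add_0_right mult_1 diff_zero diff_0
          mult_minus_left)
    then show ?thesis unfolding shift(1) .
  qed
  have s_nz: "s \<noteq> 0" using s x(2) by auto
  have E: "2 * cst \<eta> - cst (\<delta> q) = (4 * (cst q)\<^sup>2 * (- cst c) + (2 * cst \<kappa>0 + 1) * cst q) / cst x"
    using arg_cong[OF shift(2), of cst] by simp
  have C: "cst (\<delta> c) = - cst \<kappa> - (4 * cst q * (cst c)\<^sup>2 - (2 * cst \<kappa>0 + 1) * cst c) / cst x"
    using arg_cong[OF \<delta>c, of cst] by simp
  have num: "2 \<noteq> (0 :: 'k ratfun)"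
    using cst_eq_0_iff[of "2 :: 'k"] by simp
  have S: "(cst s)\<^sup>2 = cst x" using s by (metis cst_power)
  have nz: "cst x \<noteq> 0" "cst q \<noteq> 0" "cst s \<noteq> 0" using x q s_nz by simp_all
  \<comment> \<open>At the inverse transformation y z + c collapses to z_3 and z + q to y_3, so the
    identities display the Hamiltonian right-hand sides.\<close>
  have YZ: "?Y * ?Z = var_z - cst c" by simp
  note ids = transformation_identities[OF nz num S E C, of "?Z" "?Y", unfolded YZ diff_add_cancel]
  have subst_bg: "subst (?P var_y var_z) ?Y ?Z = ?P ?Y ?Z" "subst (?Q var_y var_z) ?Y ?Z = ?Q ?Y ?Z"
    unfolding bg_rhs_y_def bg_rhs_z_def by (simp_all add: dom)
  have "subst (derivative_along \<delta> (?P var_y var_z, ?Q var_y var_z) (var_z + cst q)) ?Y ?Z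
      = ?Q ?Y ?Z + cst (\<delta> q)"
    using subst_add[OF dom] subst_bg
    by (simp only: derivation_add[OF derivation_derivative_along[OF \<delta>]]
        derivative_along_basic[OF \<delta>] subst_basic snd_conv)
  also have "\<dots> = (4 * var_y\<^sup>2 * var_z - (2 * cst \<kappa>0 + 1) * var_y + 2 * cst \<eta> * cst x) / cst x"
    unfolding ids(1)[symmetric] by (rule diff_add_cancel)
  finally have 1: "subst (derivative_along \<delta> (?P var_y var_z, ?Q var_y var_z) (var_z + cst q)) ?Y ?Z
      = (4 * var_y\<^sup>2 * var_z - (2 * cst \<kappa>0 + 1) * var_y + 2 * cst \<eta> * cst x) / cst x" .
  have "subst (derivative_along \<delta> (?P var_y var_z, ?Q var_y var_z) (var_y * var_z + cst c)) ?Y ?Z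
      = ?P ?Y ?Z * ?Z + ?Y * ?Q ?Y ?Z + cst (\<delta> c)"
    using subst_add[OF dom] subst_mult[OF dom] subst_bg
    by (simp only: derivation_add[OF derivation_derivative_along[OF \<delta>]]
        derivation_mult[OF derivation_derivative_along[OF \<delta>]]
        derivative_along_basic[OF \<delta>] subst_basic fst_conv snd_conv)
  also have "\<dots> = (- 4 * var_y * var_z\<^sup>2 - cst \<kappa> * cst x + (2 * cst \<kappa>0 + 1) * var_z) / cst x"
  proof -
    have "?Z * ?P ?Y ?Z = (- 4 * var_y * var_z\<^sup>2 - cst \<kappa> * cst x + (2 * cst \<kappa>0 + 1) * var_z) / cst x
        - cst (\<delta> c) - ?Y * ?Q ?Y ?Z"
      by (rule ids(2)[symmetric])
    then show ?thesis by (simp only: mult.commute[of "?P ?Y ?Z"] diff_add_cancel)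
  qed
  finally have 2: "subst (derivative_along \<delta> (?P var_y var_z, ?Q var_y var_z) (var_y * var_z + cst c)) ?Y ?Z
      = (- 4 * var_y * var_z\<^sup>2 - cst \<kappa> * cst x + (2 * cst \<kappa>0 + 1) * var_z) / cst x" .
  show ?thesis
    unfolding in_coordinates_def hamiltonian_system_D7[OF x(2)] case_prod_conv 1 2 ..
qed

section \<open>Germs of the coefficient functions\<close>

lemma admissibleD:
  assumes "q \<in> admissible D" "open D" "z \<in> D"
  shows "q holomorphic_on D" "q meromorphic_on {z}" "deriv q meromorphic_on {z}"
    "laurent_expansion q z \<noteq> 0" "laurent_expansion (deriv q) z = fls_deriv (laurent_expansion q z)"
proof -
  show hol: "q holomorphic_on D" using assms by (simp add: admissible_def)
  then have an: "q analytic_on {z}" using assms by (auto simp: analytic_at)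
  then show mero: "q meromorphic_on {z}" by (rule analytic_on_imp_meromorphic_on)
  show "deriv q meromorphic_on {z}"
    using holomorphic_deriv[OF hol assms(2)] assms
    by (intro analytic_on_imp_meromorphic_on) (auto simp: analytic_at)
  show "laurent_expansion q z \<noteq> 0"
    using laurent_expansion_eq_0_imp_value[OF an] assms by (auto simp: admissible_def)
  show "laurent_expansion (deriv q) z = fls_deriv (laurent_expansion q z)"
    by (rule laurent_expansion_deriv[OF mero])
qed

definition sqrt_germ :: "complex \<Rightarrow> complex fls" where
  "sqrt_germ z = laurent_expansion (\<lambda>x. csqrt z * csqrt (x / z)) z"

lemma sqrt_germ_square:
  assumes "z \<noteq> 0"
  shows "(sqrt_germ z)\<^sup>2 = laurent_expansion (\<lambda>x. x) z"
proof -
  have "(\<lambda>x. csqrt z * csqrt (x / z)) analytic_on {z}"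
    \<comment> \<open>Near x = z the argument x / z is near 1, away from the branch cut.\<close>
    using assms by (intro analytic_intros) auto
  then have "(sqrt_germ z)\<^sup>2 = laurent_expansion (\<lambda>x. (csqrt z * csqrt (x / z))\<^sup>2) z"
    unfolding sqrt_germ_def by (simp add: laurent_expansion_power analytic_on_imp_meromorphic_on)
  also have "(\<lambda>x. (csqrt z * csqrt (x / z))\<^sup>2) = (\<lambda>x. x)"
    using assms by (simp add: power_mult_distrib fun_eq_iff)
  finally show ?thesis .
qed

lemma ident_germ:
  "fls_deriv (laurent_expansion (\<lambda>x. x) z) = 1" "laurent_expansion (\<lambda>x. x) z \<noteq> 0"
proof -
  show *: "fls_deriv (laurent_expansion (\<lambda>x. x) z) = 1"
    by (simp add: laurent_expansion_ident)
  show "laurent_expansion (\<lambda>x. x) z \<noteq> 0"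
  proof
    assume "laurent_expansion (\<lambda>x. x) z = 0"
    then show False using * by simp
  qed
qed

lemma bg_D7_system_germ:
  assumes "q \<in> admissible D" "open D" "z \<in> D"
  shows "bg_D7_system \<eta>0 \<kappa>0 q z =
    (bg_rhs_y (cst (fls_const \<eta>0)) (cst (fls_const \<kappa>0)) (cst (sqrt_germ z))
       (cst (laurent_expansion (\<lambda>x. x) z)) (cst (laurent_expansion q z))
       (cst (fls_deriv (laurent_expansion q z))) var_y var_z,
     bg_rhs_z (cst (fls_const \<eta>0)) (cst (fls_const \<kappa>0))
       (cst (laurent_expansion (\<lambda>x. x) z)) (cst (laurent_expansion q z))
       (cst (fls_deriv (laurent_expansion q z))) var_y var_z)"
  unfolding bg_D7_system_def germ_def Let_def sqrt_germ_def
  by (simp add: laurent_expansion_const admissibleD[OF assms])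

section \<open>The regularising condition\<close>

text \<open>On solutions of the third Painleve equation with parameter \<open>\<alpha>\<close>, \<open>painleve_dp\<close> equals
  \<open>\<alpha> q\<^sup>3\<close>. As the system does not depend on \<open>\<alpha>\<close>, the regularising condition can only say that
  \<open>painleve_dp / q\<^sup>3\<close> is of the form \<open>a x\<^sup>b\<close>.\<close>

definition painleve_dp :: "complex \<Rightarrow> complex \<Rightarrow> diff_poly" where
  "painleve_dp \<eta> \<kappa>0 =
     Plus (Plus (Times (Jet 0) (Jet 1)) (Times (Times Indep (Jet 0)) (Jet 2)))
       (Plus (Times (Const (- 1)) (Times Indep (Times (Jet 1) (Jet 1))))
         (Plus (Times (Const (4 * \<eta>\<^sup>2)) Indep) (Times (Const (- 4 * \<eta> * (\<kappa>0 + 1))) (Jet 0))))"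

text \<open>With g for \<open>painleve_dp\<close> this is q g' - 3 g q', the numerator of the
  logarithmic derivative of g / q^3, that is, of K.\<close>

definition wronskian_dp :: "complex \<Rightarrow> complex \<Rightarrow> diff_poly" where
  "wronskian_dp \<eta> \<kappa>0 =
     Plus (Times (Jet 0) (total_deriv (painleve_dp \<eta> \<kappa>0)))
       (Times (Const (- 3)) (Times (painleve_dp \<eta> \<kappa>0) (Jet 1)))"

text \<open>The numerator of the derivative of x W / (g q), where W is \<open>wronskian_dp\<close>;
  the quotient itself is x K'/K.\<close>

definition condition_dp :: "complex \<Rightarrow> complex \<Rightarrow> diff_poly" where
  "condition_dp \<eta> \<kappa>0 =
     Plus (Times (total_deriv (Times Indep (wronskian_dp \<eta> \<kappa>0))) (Times (painleve_dp \<eta> \<kappa>0) (Jet 0)))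
       (Times (Const (- 1)) (Times (Times Indep (wronskian_dp \<eta> \<kappa>0))
         (total_deriv (Times (painleve_dp \<eta> \<kappa>0) (Jet 0)))))"

lemma fls_const_numeral_simps: "fls_const (- 1) = - (1 :: complex fls)"
  "fls_const (- 3) = - (3 :: complex fls)"
  by (simp_all flip: fls_const_numeral fls_const_1 add: fls_const_uminus)

lemma jet_germ_Jet_Suc:
  assumes q: "q holomorphic_on D" "open D" "z \<in> D"
  shows "jet_germ z q (Jet (Suc n)) = fls_deriv (jet_germ z q (Jet n))"
  using jet_germ_simps(6)[OF q, of "Jet n"] by simp

lemma jet_germ_painleve_dp:
  fixes z :: complex and q :: "complex \<Rightarrow> complex"
  defines "X \<equiv> laurent_expansion (\<lambda>x. x) z" and "Q \<equiv> laurent_expansion q z"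
  assumes q: "q \<in> admissible D" "open D" "z \<in> D"
  shows "jet_germ z q (painleve_dp \<eta> \<kappa>0) = Q * fls_deriv Q + X * Q * fls_deriv (fls_deriv Q)
    - X * (fls_deriv Q)\<^sup>2 + 4 * (fls_const \<eta>)\<^sup>2 * X - 4 * fls_const \<eta> * (fls_const \<kappa>0 + 1) * Q"
proof -
  note J = jet_germ_simps[OF admissibleD(1)[OF q] q(2,3)]
  note JS = jet_germ_Jet_Suc[OF admissibleD(1)[OF q] q(2,3)]
  have Jx: "jet_germ z q Indep = X" by (simp add: J X_def laurent_expansion_ident)
  have J0: "jet_germ z q (Jet 0) = Q" by (simp add: J Q_def)
  have J1: "jet_germ z q (Jet 1) = fls_deriv Q" using JS[of 0] J0 by simp
  have J2: "jet_germ z q (Jet 2) = fls_deriv (fls_deriv Q)"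
    using JS[of 1] J1 by (simp add: numeral_2_eq_2)
  have coeffs: "fls_const (4 * \<eta>\<^sup>2) = 4 * (fls_const \<eta>)\<^sup>2"
    "fls_const (- 4 * \<eta> * (\<kappa>0 + 1)) = - 4 * fls_const \<eta> * (fls_const \<kappa>0 + 1)"
    by (simp_all add: power2_eq_square fls_plus_const flip: fls_const_mult_const fls_const_numeral fls_const_1)
  show ?thesis
    unfolding painleve_dp_def J(4,5) J0 J1 J2 Jx
    by (simp only: J(1) coeffs fls_const_numeral_simps) (simp add: power2_eq_square)
qed

lemma regularised_bg_D7:
  assumes q: "q \<in> admissible D" "open D" "z \<in> D" and z: "z \<noteq> 0" and \<eta>: "\<eta> \<noteq> 0"
    and g: "jet_germ z q (painleve_dp \<eta> \<kappa>0) \<noteq> 0"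
  shows "regularised fls_deriv (bg_D7_system \<eta> \<kappa>0 q z) \<longleftrightarrow> jet_germ z q (condition_dp \<eta> \<kappa>0) = 0"
proof -
  note J = jet_germ_simps[OF admissibleD(1)[OF q] q(2,3)]
  note JS = jet_germ_Jet_Suc[OF admissibleD(1)[OF q] q(2,3)]
  define X where "X = laurent_expansion (\<lambda>x. x) z"
  define Q where "Q = laurent_expansion q z"
  define g where "g = jet_germ z q (painleve_dp \<eta> \<kappa>0)"
  define \<theta> where "\<theta> = fls_const \<eta>"
  define k where "k = fls_const \<kappa>0"
  have Jx: "jet_germ z q Indep = X" by (simp add: J X_def laurent_expansion_ident)
  have J0: "jet_germ z q (Jet 0) = Q" by (simp add: J Q_def)
  have J1: "jet_germ z q (Jet 1) = fls_deriv Q" using JS[of 0] J0 by simp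
  have g_eq: "g = Q * fls_deriv Q + X * Q * fls_deriv (fls_deriv Q) - X * (fls_deriv Q)\<^sup>2
      + 4 * \<theta>\<^sup>2 * X - 4 * \<theta> * (k + 1) * Q"
    unfolding g_def Q_def X_def \<theta>_def k_def by (rule jet_germ_painleve_dp[OF q])
  define h where "h = jet_germ z q (wronskian_dp \<eta> \<kappa>0)"
  have h_eq: "h = Q * fls_deriv g - 3 * g * fls_deriv Q"
    unfolding h_def wronskian_dp_def J(4,5,6) g_def[symmetric] J0 J1 J(1) fls_const_numeral_simps
    by simp
  have F: "jet_germ z q (condition_dp \<eta> \<kappa>0)
      = fls_deriv (X * h) * (g * Q) - X * h * fls_deriv (g * Q)"
    unfolding condition_dp_def J(4,5,6) g_def[symmetric] h_def[symmetric] J0 Jx J(1) fls_const_numeral_simps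
    by simp
  have nz: "g * Q \<noteq> 0" using g admissibleD(4)[OF q] by (simp add: g_def Q_def)
  have "regularised fls_deriv (bg_D7_system \<eta> \<kappa>0 q z)
      \<longleftrightarrow> fls_deriv (X * (Q * fls_deriv g - 3 * g * fls_deriv Q) / (g * Q)) = 0"
    unfolding bg_D7_system_germ[OF q] X_def[symmetric] Q_def[symmetric] \<theta>_def[symmetric] k_def[symmetric]
  proof (rule regularised_bg[OF derivation_fls_deriv])
    show "fls_deriv X = 1" "X \<noteq> 0" using ident_germ[of z] by (simp_all add: X_def)
    show "Q \<noteq> 0" using nz by simp
    show "\<theta> \<noteq> 0" using \<eta> by (simp add: \<theta>_def)
    show "(sqrt_germ z)\<^sup>2 = X" using sqrt_germ_square[OF z] by (simp add: X_def)
    show "g \<noteq> 0" using nz by simp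
  qed (simp_all only: g_eq \<theta>_def k_def fls_deriv_const)
  also have "\<dots> \<longleftrightarrow> fls_deriv (X * h / (g * Q)) = 0"
    unfolding h_eq ..
  also have "\<dots> \<longleftrightarrow> jet_germ z q (condition_dp \<eta> \<kappa>0) = 0"
    unfolding derivation_divide[OF derivation_fls_deriv] F using nz by simp
  finally show ?thesis .
qed

text \<open>On solutions g is a nonzero constant times q^3. Hence its Wronskian-type combination
  with q vanishes on the open set D, and so does the derivative of that combination.\<close>

lemma painleve_imp_conditions:
  assumes D: "open D" "D \<noteq> {}" "0 \<notin> D" and q: "q \<in> admissible D" and \<kappa>inf: "\<kappa>inf \<noteq> 0"
    and P: "painleve_III (-4 * \<kappa>inf) (4 * \<eta> * (\<kappa>0 + 1)) 0 (-4 * \<eta>\<^sup>2) D q"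
  shows "\<And>x. x \<in> D \<Longrightarrow> eval_dp (painleve_dp \<eta> \<kappa>0) q x = - 4 * \<kappa>inf * q x ^ 3"
    and "\<not> vanishes_on D (painleve_dp \<eta> \<kappa>0) q"
    and "vanishes_on D (condition_dp \<eta> \<kappa>0) q"
proof -
  have hol: "q holomorphic_on D" and nz: "\<And>x. x \<in> D \<Longrightarrow> q x \<noteq> 0"
    using q by (auto simp: admissible_def)
  show g: "eval_dp (painleve_dp \<eta> \<kappa>0) q x = - 4 * \<kappa>inf * q x ^ 3" if x: "x \<in> D" for x
  proof -
    have "x \<noteq> 0" "q x \<noteq> 0" using D x nz by auto
    then have "q x * deriv q x + x * q x * deriv (deriv q) x - x * (deriv q x)\<^sup>2 + 4 * \<eta>\<^sup>2 * x
        - 4 * \<eta> * (\<kappa>0 + 1) * q x = - 4 * \<kappa>inf * q x ^ 3"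
      using P x unfolding painleve_III_def by (intro painleve_polynomial) blast+
    then show ?thesis
      by (simp add: painleve_dp_def power2_eq_square numeral_2_eq_2 algebra_simps)
  qed
  show "\<not> vanishes_on D (painleve_dp \<eta> \<kappa>0) q"
    using g D nz \<kappa>inf by (auto simp: vanishes_on_def)
  have w: "eval_dp (wronskian_dp \<eta> \<kappa>0) q x = 0" if x: "x \<in> D" for x
  proof -
    have "((\<lambda>x. - 4 * \<kappa>inf * q x ^ 3) has_field_derivative - 4 * \<kappa>inf * (3 * q x ^ 2 * deriv q x)) (at x)"
      using DERIV_cmult[OF DERIV_power[OF holomorphic_derivI[OF hol D(1) x], of 3], of "- 4 * \<kappa>inf"]
      by (simp add: mult_ac)
    then have "(eval_dp (painleve_dp \<eta> \<kappa>0) q has_field_derivative - 4 * \<kappa>inf * (3 * q x ^ 2 * deriv q x)) (at x)"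
      by (rule has_field_derivative_transform_within_open[OF _ D(1) x]) (simp add: g)
    then have "eval_dp (total_deriv (painleve_dp \<eta> \<kappa>0)) q x = - 4 * \<kappa>inf * (3 * q x ^ 2 * deriv q x)"
      using eval_total_deriv[OF hol D(1) x] DERIV_unique by blast
    then show ?thesis
      by (simp add: wronskian_dp_def g x power2_eq_square power3_eq_cube)
  qed
  have "eval_dp (total_deriv (wronskian_dp \<eta> \<kappa>0)) q x = 0" if x: "x \<in> D" for x
  proof -
    have "(eval_dp (wronskian_dp \<eta> \<kappa>0) q has_field_derivative 0) (at x)"
      by (rule has_field_derivative_transform_within_open[OF DERIV_const D(1) x]) (simp add: w)
    then show ?thesis using eval_total_deriv[OF hol D(1) x] DERIV_unique by blast
  qed
  with w show "vanishes_on D (condition_dp \<eta> \<kappa>0) q"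
    by (simp add: vanishes_on_def condition_dp_def)
qed

text \<open>The exponentials \<open>q = a e\<^sup>x\<close> do not satisfy the condition for general \<open>a\<close>: both differential
  polynomials are entire functions, which can be evaluated at \<open>x = 0\<close>.\<close>

lemma vanishes_on_entire:
  assumes D: "open D" "D \<noteq> {}" and q: "q holomorphic_on UNIV" and v: "vanishes_on D F q"
  shows "eval_dp F q w = 0"
proof (rule ccontr)
  assume nz: "eval_dp F q w \<noteq> 0"
  obtain z where z: "z \<in> D" using D by blast
  have "laurent_expansion (eval_dp F q) z \<noteq> 0"
    by (rule laurent_expansion_nonzero[of UNIV _ _ w]) (use nz holomorphic_eval_dp[OF q] in auto)
  then show False
    using laurent_expansion_eq_0I[OF D(1) z] v by (auto simp: vanishes_on_def)
qed

lemma exists_generic_not_regularised: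
  assumes D: "open D" "D \<noteq> {}" and \<eta>: "\<eta> \<noteq> 0"
  obtains q where "q \<in> admissible D" "\<not> vanishes_on D (painleve_dp \<eta> \<kappa>0) q"
    "\<not> vanishes_on D (condition_dp \<eta> \<kappa>0) q"
proof -
  \<comment> \<open>At x = 0 the condition reduces to the product W g q of the values there, with g
    for \<open>painleve_dp\<close> and W for \<open>wronskian_dp\<close>. For q = a e^x the factors
    of p are a, g / a and W / a at x = 0.\<close>
  define p where "p = [:0, 1:] * [:- 4 * \<eta> * (\<kappa>0 + 1), 1:] * [:4 * \<eta>\<^sup>2, 8 * \<eta> * (\<kappa>0 + 1), - 1:]"
  have "p \<noteq> 0" using \<eta> by (simp add: p_def)
  then obtain a where a: "poly p a \<noteq> 0" using poly_all_0_iff_0 by blast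
  then have a': "a \<noteq> 0" "a - 4 * \<eta> * (\<kappa>0 + 1) \<noteq> 0" "4 * \<eta>\<^sup>2 + 8 * \<eta> * (\<kappa>0 + 1) * a - a\<^sup>2 \<noteq> 0"
  proof -
    have "poly p a = a * (a - 4 * \<eta> * (\<kappa>0 + 1)) * (4 * \<eta>\<^sup>2 + 8 * \<eta> * (\<kappa>0 + 1) * a - a\<^sup>2)"
      by (simp add: p_def power2_eq_square algebra_simps)
    then show "a \<noteq> 0" "a - 4 * \<eta> * (\<kappa>0 + 1) \<noteq> 0" "4 * \<eta>\<^sup>2 + 8 * \<eta> * (\<kappa>0 + 1) * a - a\<^sup>2 \<noteq> 0"
      using a by (metis mult_zero_left mult_zero_right)+
  qed
  define q where "q = (\<lambda>x::complex. a * exp x)"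
  have q1: "deriv q = q"
    unfolding q_def by (rule ext, rule DERIV_imp_deriv) (auto intro!: derivative_eq_intros)
  then have qn: "(deriv ^^ n) q = q" for n by (induction n) auto
  have q0: "q 0 = a" by (simp add: q_def)
  have hol: "q holomorphic_on A" for A unfolding q_def by (intro holomorphic_intros)
  have g0: "eval_dp (painleve_dp \<eta> \<kappa>0) q 0 = a * (a - 4 * \<eta> * (\<kappa>0 + 1))"
    by (simp add: painleve_dp_def qn q0 q1 algebra_simps)
  have g1: "eval_dp (total_deriv (painleve_dp \<eta> \<kappa>0)) q 0
      = 2 * a\<^sup>2 + 4 * \<eta>\<^sup>2 - 4 * \<eta> * (\<kappa>0 + 1) * a"
    by (simp add: painleve_dp_def qn q0 q1 power2_eq_square algebra_simps)
  have w0: "eval_dp (wronskian_dp \<eta> \<kappa>0) q 0 = a * (4 * \<eta>\<^sup>2 + 8 * \<eta> * (\<kappa>0 + 1) * a - a\<^sup>2)"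
    by (simp add: wronskian_dp_def g0 g1 qn q0 q1 power2_eq_square algebra_simps)
  have "eval_dp (condition_dp \<eta> \<kappa>0) q 0
      = a * (4 * \<eta>\<^sup>2 + 8 * \<eta> * (\<kappa>0 + 1) * a - a\<^sup>2) * (a * (a - 4 * \<eta> * (\<kappa>0 + 1)) * a)"
    by (simp add: condition_dp_def g0 w0 q0)
  then have F0: "eval_dp (condition_dp \<eta> \<kappa>0) q 0 \<noteq> 0" using a' by simp
  show thesis
  proof (rule that)
    show "q \<in> admissible D" using hol a' by (simp add: admissible_def q_def)
    show "\<not> vanishes_on D (painleve_dp \<eta> \<kappa>0) q"
      using vanishes_on_entire[OF D hol, of "painleve_dp \<eta> \<kappa>0" 0] g0 a' by auto
    show "\<not> vanishes_on D (condition_dp \<eta> \<kappa>0) q"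
      using vanishes_on_entire[OF D hol, of "condition_dp \<eta> \<kappa>0" 0] F0 by auto
  qed
qed

text \<open>The genericity polynomial is -4 q^3 K: generic means that K is not identically
  zero.\<close>

lemma bg_regularising_condition:
  assumes D: "open D" "connected D" "D \<noteq> {}" "0 \<notin> D" and nz: "\<eta> \<noteq> 0" "\<kappa>inf \<noteq> 0"
  shows "obtained_as_regularising_condition D
    (painleve_III (-4 * \<kappa>inf) (4 * \<eta> * (\<kappa>0 + 1)) 0 (-4 * \<eta>\<^sup>2) D) (bg_D7_system \<eta> \<kappa>0)"
  unfolding obtained_as_regularising_condition_def
proof (intro exI[of _ "{condition_dp \<eta> \<kappa>0}"] exI[of _ "painleve_dp \<eta> \<kappa>0"] conjI ballI impI)
  fix q assume q: "q \<in> admissible D" and g: "\<not> vanishes_on D (painleve_dp \<eta> \<kappa>0) q"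
  have hol: "q holomorphic_on D" using q by (simp add: admissible_def)
  have "regularised fls_deriv (bg_D7_system \<eta> \<kappa>0 q z) \<longleftrightarrow> jet_germ z q (condition_dp \<eta> \<kappa>0) = 0"
    if z: "z \<in> D" for z
    using regularised_bg_D7[OF q D(1) z _ nz(1)] jet_germ_nonzero[OF hol D(1,2) g z] D(4) z by auto
  then show "regularised_on D (bg_D7_system \<eta> \<kappa>0 q)
      \<longleftrightarrow> (\<forall>F\<in>{condition_dp \<eta> \<kappa>0}. vanishes_on D F q)"
    by (simp add: regularised_on_def vanishes_on_iff_jet_germ[OF hol D(1)])
next
  show "\<exists>q\<in>admissible D. \<not> vanishes_on D (painleve_dp \<eta> \<kappa>0) q
      \<and> (\<exists>F\<in>{condition_dp \<eta> \<kappa>0}. \<not> vanishes_on D F q)"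
    using exists_generic_not_regularised[OF D(1,3) nz(1), of \<kappa>0] by blast
next
  fix q assume q: "q \<in> admissible D"
    and P: "painleve_III (-4 * \<kappa>inf) (4 * \<eta> * (\<kappa>0 + 1)) 0 (-4 * \<eta>\<^sup>2) D q"
  note * = painleve_imp_conditions[OF D(1,3,4) q nz(2) P]
  show "\<not> vanishes_on D (painleve_dp \<eta> \<kappa>0) q" by (rule *(2))
  show "vanishes_on D F q" if "F \<in> {condition_dp \<eta> \<kappa>0}" for F using *(3) that by simp
qed simp

section \<open>Coefficient functions\<close>

text \<open>All four components of the transformation and its inverse have this shape.\<close>

lemma meromorphic_coefficients_bilinear:
  assumes mero: "a meromorphic_on D" "b meromorphic_on D" "c meromorphic_on D" "d meromorphic_on D"
      "a' meromorphic_on D" "b' meromorphic_on D"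
    and nz: "\<And>z. z \<in> D \<Longrightarrow> germ a' z + germ b' z * var_y \<noteq> 0"
    and R: "\<And>z. z \<in> D \<Longrightarrow> R z = (germ a z + germ b z * var_y + germ c z * var_z
        + germ d z * (var_y * var_z)) / (germ a' z + germ b' z * var_y)"
  shows "meromorphic_coefficients D R"
proof -
  define N where "N = (\<lambda>i j. if i = (0 :: nat) then if j = (0 :: nat) then a else c
    else if j = 0 then b else d)"
  define M where "M = (\<lambda>i j. if j = (0 :: nat) then if i = (0 :: nat) then a' else b' else (\<lambda>_. 0))"
  have zero: "germ (\<lambda>_. 0) z = 0" for z
    by (simp add: germ_def laurent_expansion_const)
  have "N i j meromorphic_on D \<and> M i j meromorphic_on D" for i j
    using mero by (auto simp: N_def M_def)
  moreover have "has_coefficients D 1 N M R"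
    unfolding has_coefficients_def using nz R
    by (simp add: N_def M_def zero add_ac mult.assoc)
  ultimately show ?thesis unfolding meromorphic_coefficients_def by blast
qed

lemma fls_const_hom:
  "fls_const (a + b) = fls_const a + (fls_const b :: complex fls)"
  "fls_const (a - b) = fls_const a - (fls_const b :: complex fls)"
  "fls_const (a * b) = fls_const a * (fls_const b :: complex fls)"
  "fls_const (- a) = - (fls_const a :: complex fls)"
  "fls_const 1 = (1 :: complex fls)"
  "fls_const (numeral n) = (numeral n :: complex fls)"
  by (simp_all add: fls_plus_const fls_minus_const fls_const_mult_const fls_const_numeral)

lemma jet_germ_power_dp:
  assumes q: "q holomorphic_on D" "open D" "z \<in> D"
  shows "jet_germ z q (power_dp F n) = jet_germ z q F ^ n"
proof (induction n)
  case 0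
  then show ?case by (simp add: power_dp_def jet_germ_simps[OF q])
next
  case (Suc n)
  have "power_dp F (Suc n) = Times F (power_dp F n)" by (simp add: power_dp_def)
  then show ?case by (simp add: jet_germ_simps[OF q] Suc)
qed

text \<open>All coefficients are taken as differential polynomials over 1; the common denominator m
  is the constant term of the denominator polynomial in y and z.\<close>

lemma coefficients_in_q_polynomial:
  assumes D: "open D" "D \<noteq> {}"
    and m: "\<And>q z. q \<in> admissible D \<Longrightarrow> z \<in> D \<Longrightarrow> jet_germ z q m \<noteq> 0"
    and R: "\<And>q z. q \<in> admissible D \<Longrightarrow> z \<in> D \<Longrightarrow>
      R q z = (\<Sum>i\<le>n. \<Sum>j\<le>n. cst (jet_germ z q (N i j)) * var_y ^ i * var_z ^ j) / cst (jet_germ z q m)"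
  shows "coefficients_in_q D R"
proof -
  define N' where "N' = (\<lambda>i j. (N i j, Const 1))"
  define M' where "M' = (\<lambda>i j. (if i = (0 :: nat) \<and> j = (0 :: nat) then m else Const 0, Const 1))"
  have ev: "eval_dr (F, Const 1) q = eval_dp F q" for F q
    by (simp add: eval_dr_def fun_eq_iff)
  show ?thesis
    unfolding coefficients_in_q_def
  proof (rule exI[of _ n], rule exI[of _ N'], rule exI[of _ M'], rule ballI, rule conjI)
    fix q assume q: "q \<in> admissible D"
    have hol: "q holomorphic_on D" using q by (simp add: admissible_def)
    show "\<forall>c\<in>{N' i j |i j. True} \<union> {M' i j |i j. True}.
        \<not> vanishes_on D (snd c) q \<and> eval_dr c q meromorphic_on D"
    proof
      fix c assume c: "c \<in> {N' i j |i j. True} \<union> {M' i j |i j. True}"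
      obtain F where F: "c = (F, Const 1)" using c by (auto simp: N'_def M'_def)
      have "eval_dp F q analytic_on D"
        using holomorphic_eval_dp[OF hol D(1)] D(1) by (simp add: analytic_on_open)
      then show "\<not> vanishes_on D (snd c) q \<and> eval_dr c q meromorphic_on D"
        unfolding F ev using D by (auto simp: vanishes_on_def intro: analytic_on_imp_meromorphic_on)
    qed
    have germ: "germ (eval_dr (F, Const 1) q) z = cst (jet_germ z q F)" for F z
      unfolding ev germ_def jet_germ_def ..
    have M: "(\<Sum>i\<le>n. \<Sum>j\<le>n. germ (eval_dr (M' i j) q) z * var_y ^ i * var_z ^ j) = cst (jet_germ z q m)"
      if z: "z \<in> D" for z
    proof -
      have "germ (eval_dr (M' i j) q) z * var_y ^ i * var_z ^ j
          = (if j = 0 then if i = 0 then cst (jet_germ z q m) else 0 else 0)" for i j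
        unfolding M'_def germ by (simp add: jet_germ_simps[OF hol D(1) z])
      then show ?thesis by (simp add: sum.delta)
    qed
    show "has_coefficients D n (\<lambda>i j. eval_dr (N' i j) q) (\<lambda>i j. eval_dr (M' i j) q) (R q)"
      unfolding has_coefficients_def M using m[OF q] R[OF q] M by (simp add: N'_def germ)
  qed
qed

text \<open>For k = 2 \<kappa>0 + 1 this is 4 q^2 e, the polynomial multiple of the shift e.\<close>

definition shift_dp :: "complex \<Rightarrow> complex \<Rightarrow> diff_poly" where
  "shift_dp \<eta> k = Plus (Times Indep (Plus (Const (2 * \<eta>)) (Times (Const (- 1)) (Jet 1))))
     (Times (Const (- k)) (Jet 0))"

text \<open>The factor 4 q^4 x clears the worst term: -4 e^2 / x becomes -w^2, with w = 4 q^2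
  e.\<close>

definition denominator_dp :: diff_poly where
  "denominator_dp = Times (Const 4) (Times (power_dp (Jet 0) 4) Indep)"

definition bg_y_dp :: "complex \<Rightarrow> complex \<Rightarrow> nat \<Rightarrow> nat \<Rightarrow> diff_poly" where
  "bg_y_dp \<eta> k i j =
     (let q = power_dp (Jet 0); w = shift_dp \<eta> k in
      if (i, j) = (0, 0) then Times (Const (- 1)) (power_dp w 2)
      else if (i, j) = (1, 0) then Times (Const 4) (Times (q 3) (Plus (Times (Const 4) w) (Times (Const (2 * k)) (q 1))))
      else if (i, j) = (1, 1) then Times (Const 12) (Times (q 2) w)
      else if (i, j) = (2, 0) then Times (Const (- 16)) (q 6)
      else if (i, j) = (2, 1) then Times (Const (- 48)) (q 5)
      else if (i, j) = (2, 2) then Times (Const (- 32)) (q 4)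
      else Const 0)"

definition bg_z_dp :: "complex \<Rightarrow> complex \<Rightarrow> nat \<Rightarrow> nat \<Rightarrow> diff_poly" where
  "bg_z_dp \<eta> k i j =
     (let q = power_dp (Jet 0); w = shift_dp \<eta> k in
      if (i, j) = (0, 1) then Times (Const (- 4)) (Times (q 3) (Plus (Times (Const 2) w) (Times (Const k) (q 1))))
      else if (i, j) = (0, 2) then Times (Const (- 4)) (Times (q 2) w)
      else if (i, j) = (1, 1) then Times (Const 16) (q 6)
      else if (i, j) = (1, 2) then Times (Const 32) (q 5)
      else if (i, j) = (1, 3) then Times (Const 16) (q 4)
      else Const 0)"

lemma bg_coefficient_identities:
  fixes x :: "'a::field"
  assumes "x \<noteq> 0" "q \<noteq> 0" "s \<noteq> 0" "2 \<noteq> (0 :: 'a)" "4 \<noteq> (0 :: 'a)" "s\<^sup>2 = x"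
    and k: "k = 2 * \<kappa>0 + 1" and w: "w = x * (2 * \<eta> - q1) - k * q"
  shows "bg_rhs_y \<eta> \<kappa>0 s x q q1 y z = (- w\<^sup>2 + 4 * (q ^ 3 * (4 * w + 2 * k * q)) * y + 12 * (q\<^sup>2 * w) * y * z
      - 16 * q ^ 6 * y\<^sup>2 - 48 * q ^ 5 * y\<^sup>2 * z - 32 * q ^ 4 * y\<^sup>2 * z\<^sup>2) / (4 * (q ^ 4 * x))"
    and "bg_rhs_z \<eta> \<kappa>0 x q q1 y z = (- 4 * (q ^ 3 * (2 * w + k * q)) * z - 4 * (q\<^sup>2 * w) * z\<^sup>2
      + 16 * q ^ 6 * y * z + 32 * q ^ 5 * y * z\<^sup>2 + 16 * q ^ 4 * y * z ^ 3) / (4 * (q ^ 4 * x))"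
proof -
  obtain e where e: "e = w / (4 * q\<^sup>2)" by blast
  have w': "w = 4 * q\<^sup>2 * e" using assms(2,5) by (simp add: e)
  have E: "2 * \<eta> - q1 = (4 * q\<^sup>2 * e + (2 * \<kappa>0 + 1) * q) / x"
    unfolding w'[symmetric] w k using assms(1) by simp
  note ids = bg_identities[OF assms(1-4,6) E, folded k]
  have nz: "4 * (q ^ 4 * x) \<noteq> 0" using assms by simp
  have eqI: "a = b / (4 * (q ^ 4 * x))" if "4 * q ^ 4 * (x * a) = b" for a b
    using nz that by (simp add: nonzero_eq_divide_eq mult_ac)
  show "bg_rhs_y \<eta> \<kappa>0 s x q q1 y z = (- w\<^sup>2 + 4 * (q ^ 3 * (4 * w + 2 * k * q)) * y + 12 * (q\<^sup>2 * w) * y * z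
      - 16 * q ^ 6 * y\<^sup>2 - 48 * q ^ 5 * y\<^sup>2 * z - 32 * q ^ 4 * y\<^sup>2 * z\<^sup>2) / (4 * (q ^ 4 * x))"
    by (rule eqI, unfold ids w') algebra
  show "bg_rhs_z \<eta> \<kappa>0 x q q1 y z = (- 4 * (q ^ 3 * (2 * w + k * q)) * z - 4 * (q\<^sup>2 * w) * z\<^sup>2
      + 16 * q ^ 6 * y * z + 32 * q ^ 5 * y * z\<^sup>2 + 16 * q ^ 4 * y * z ^ 3) / (4 * (q ^ 4 * x))"
    by (rule eqI, unfold ids w') algebra
qed

lemma bg_coefficients_in_q:
  assumes D: "open D" "D \<noteq> {}" "0 \<notin> D"
  shows "coefficients_in_q D (\<lambda>q z. fst (bg_D7_system \<eta> \<kappa>0 q z))"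
    and "coefficients_in_q D (\<lambda>q z. snd (bg_D7_system \<eta> \<kappa>0 q z))"
proof -
  have *: "jet_germ z q denominator_dp \<noteq> 0"
    "fst (bg_D7_system \<eta> \<kappa>0 q z) = (\<Sum>i\<le>2. \<Sum>j\<le>2. cst (jet_germ z q (bg_y_dp \<eta> (2 * \<kappa>0 + 1) i j))
        * var_y ^ i * var_z ^ j) / cst (jet_germ z q denominator_dp)"
    "snd (bg_D7_system \<eta> \<kappa>0 q z) = (\<Sum>i\<le>3. \<Sum>j\<le>3. cst (jet_germ z q (bg_z_dp \<eta> (2 * \<kappa>0 + 1) i j))
        * var_y ^ i * var_z ^ j) / cst (jet_germ z q denominator_dp)"
    if q': "q \<in> admissible D" and z: "z \<in> D" for q z
  proof -
    note q = q' D(1) z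
    note hol = admissibleD(1)[OF q] D(1) z
    note J = jet_germ_simps[OF hol] jet_germ_power_dp[OF hol]
    define X where "X = laurent_expansion (\<lambda>x. x) z"
    define Q where "Q = laurent_expansion q z"
    define k where "k = 2 * fls_const \<kappa>0 + 1"
    define W where "W = X * (2 * fls_const \<eta> - fls_deriv Q) - k * Q"
    have Jx: "jet_germ z q Indep = X" by (simp add: J X_def laurent_expansion_ident)
    have J0: "jet_germ z q (Jet 0) = Q" by (simp add: J Q_def)
    have J1: "jet_germ z q (Jet 1) = fls_deriv Q" using jet_germ_Jet_Suc[OF hol, of 0] J0 by simp
    have k': "fls_const (2 * \<kappa>0 + 1) = k" and e': "fls_const (2 * \<eta>) = 2 * fls_const \<eta>"
      and k2: "fls_const (2 * (2 * \<kappa>0 + 1)) = 2 * k" and mk: "fls_const (- (2 * \<kappa>0 + 1)) = - k"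
      by (simp_all only: k_def fls_const_hom)
    have num: "fls_const (- numeral n) = - (numeral n :: complex fls)"
      "fls_const (numeral n) = (numeral n :: complex fls)" for n
      by (simp_all only: fls_const_hom)
    have JW: "jet_germ z q (shift_dp \<eta> (2 * \<kappa>0 + 1)) = W"
      unfolding shift_dp_def J(4,5) J0 J1 Jx
      by (simp only: J(1) e' mk fls_const_numeral_simps) (simp add: W_def)
    have Jd: "jet_germ z q denominator_dp = 4 * (Q ^ 4 * X)"
      unfolding denominator_dp_def J(4,5,7) J0 Jx by (simp only: J(1) num)
    have nz: "X \<noteq> 0" "Q \<noteq> 0" using ident_germ[of z] admissibleD(4)[OF q] by (simp_all add: X_def Q_def)
    show "jet_germ z q denominator_dp \<noteq> 0" using nz by (simp add: Jd)
    have z0: "z \<noteq> 0" using D z by auto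
    have s: "(sqrt_germ z)\<^sup>2 = X" unfolding X_def by (rule sqrt_germ_square[OF z0])
    then have "sqrt_germ z \<noteq> 0" using nz by auto
    then have nz': "cst X \<noteq> 0" "cst Q \<noteq> 0" "cst (sqrt_germ z) \<noteq> 0" using nz by simp_all
    have two: "2 \<noteq> (0 :: complex fls ratfun)" "4 \<noteq> (0 :: complex fls ratfun)"
      using cst_eq_0_iff[of "2 :: complex fls"] cst_eq_0_iff[of "4 :: complex fls"] by simp_all
    have S: "(cst (sqrt_germ z))\<^sup>2 = cst X" using s by (metis cst_power)
    have k: "cst k = 2 * cst (fls_const \<kappa>0) + 1" by (simp add: k_def)
    have W: "cst W = cst X * (2 * cst (fls_const \<eta>) - cst (fls_deriv Q)) - cst k * cst Q"
      by (simp add: W_def)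
    note ids = bg_coefficient_identities[OF nz' two S k W, of var_y var_z]
    have sys: "fst (bg_D7_system \<eta> \<kappa>0 q z) = bg_rhs_y (cst (fls_const \<eta>)) (cst (fls_const \<kappa>0))
        (cst (sqrt_germ z)) (cst X) (cst Q) (cst (fls_deriv Q)) var_y var_z"
      "snd (bg_D7_system \<eta> \<kappa>0 q z) = bg_rhs_z (cst (fls_const \<eta>)) (cst (fls_const \<kappa>0))
        (cst X) (cst Q) (cst (fls_deriv Q)) var_y var_z"
      unfolding bg_D7_system_germ[OF q] X_def Q_def by simp_all
    have Jy: "jet_germ z q (bg_y_dp \<eta> (2 * \<kappa>0 + 1) i j) =
      (if (i, j) = (0, 0) then - W\<^sup>2 else if (i, j) = (1, 0) then 4 * (Q ^ 3 * (4 * W + 2 * k * Q))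
       else if (i, j) = (1, 1) then 12 * (Q\<^sup>2 * W) else if (i, j) = (2, 0) then - 16 * Q ^ 6
       else if (i, j) = (2, 1) then - 48 * Q ^ 5 else if (i, j) = (2, 2) then - 32 * Q ^ 4 else 0)" for i j
      unfolding bg_y_dp_def Let_def if_distrib[of "jet_germ z q"] J(4,5,7) J0 JW
      by (simp only: J(1) num k2 fls_const_numeral_simps fls_const_0 power_one_right mult_minus1)
    have Jz: "jet_germ z q (bg_z_dp \<eta> (2 * \<kappa>0 + 1) i j) =
      (if (i, j) = (0, 1) then - 4 * (Q ^ 3 * (2 * W + k * Q)) else if (i, j) = (0, 2) then - 4 * (Q\<^sup>2 * W)
       else if (i, j) = (1, 1) then 16 * Q ^ 6 else if (i, j) = (1, 2) then 32 * Q ^ 5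
       else if (i, j) = (1, 3) then 16 * Q ^ 4 else 0)" for i j
      unfolding bg_z_dp_def Let_def if_distrib[of "jet_germ z q"] J(4,5,7) J0 JW
      by (simp only: J(1) num k' fls_const_0 power_one_right)
    show "fst (bg_D7_system \<eta> \<kappa>0 q z) = (\<Sum>i\<le>2. \<Sum>j\<le>2. cst (jet_germ z q (bg_y_dp \<eta> (2 * \<kappa>0 + 1) i j))
        * var_y ^ i * var_z ^ j) / cst (jet_germ z q denominator_dp)"
      unfolding sys ids(1) Jd Jy
      by (simp add: numeral_2_eq_2 atMost_Suc)
    show "snd (bg_D7_system \<eta> \<kappa>0 q z) = (\<Sum>i\<le>3. \<Sum>j\<le>3. cst (jet_germ z q (bg_z_dp \<eta> (2 * \<kappa>0 + 1) i j))
        * var_y ^ i * var_z ^ j) / cst (jet_germ z q denominator_dp)"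
      unfolding sys ids(2) Jd Jz
      by (simp add: numeral_3_eq_3 numeral_2_eq_2 atMost_Suc)
  qed
  show "coefficients_in_q D (\<lambda>q z. fst (bg_D7_system \<eta> \<kappa>0 q z))"
    by (rule coefficients_in_q_polynomial[OF D(1,2) *(1,2)])
  show "coefficients_in_q D (\<lambda>q z. snd (bg_D7_system \<eta> \<kappa>0 q z))"
    by (rule coefficients_in_q_polynomial[OF D(1,2) *(1,3)])
qed

lemma bg_birational:
  assumes D: "open D" "0 \<notin> D" and q: "q \<in> admissible D"
    and P: "\<And>x. x \<in> D \<Longrightarrow> eval_dp (painleve_dp \<eta> \<kappa>0) q x = - 4 * \<kappa> * q x ^ 3"
  shows "birationally_equivalent_on D (bg_D7_system \<eta> \<kappa>0 q) (ham_D7_system \<eta> \<kappa>0 \<kappa>)"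
proof -
  define c where "c = (\<lambda>x. x * (deriv q x - 2 * \<eta>) / (4 * (q x)\<^sup>2) + (2 * \<kappa>0 + 1) / (4 * q x))"
  have hol: "q holomorphic_on D" "deriv q holomorphic_on D"
    using q holomorphic_deriv D by (auto simp: admissible_def)
  have mero: "q meromorphic_on D" "deriv q meromorphic_on D" "(\<lambda>_. a) meromorphic_on D" for a :: complex
    using hol D by (auto intro!: analytic_on_imp_meromorphic_on simp: analytic_on_open)
  have mero_c: "c meromorphic_on D"
    unfolding c_def by (intro meromorphic_intros mero)
  have germs: "germ (\<lambda>_. a) z = cst (fls_const a)" "germ q z = cst (laurent_expansion q z)"
    "germ c z = cst (laurent_expansion c z)" for a z
    by (simp_all add: germ_def laurent_expansion_const)
  define U V Y Z where "U = (\<lambda>z. var_z + germ q z)" and "V = (\<lambda>z. var_y * var_z + germ c z)"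
    and "Y = (\<lambda>z. (var_z - germ c z) / (var_y - germ q z))" and "Z = (\<lambda>z. var_y - germ q z)"
  have mero_neg: "(\<lambda>x. - q x) meromorphic_on D" "(\<lambda>x. - c x) meromorphic_on D"
    by (intro meromorphic_intros mero mero_c)+
  have neg: "germ (\<lambda>x. - f x) z = - germ f z" if "f meromorphic_on D" "z \<in> D" for f z
    using meromorphic_on_subset[OF that(1), of "{z}"] that(2)
    by (simp add: germ_def laurent_expansion_uminus)
  have "meromorphic_coefficients D U"
    by (rule meromorphic_coefficients_bilinear[of q _ "\<lambda>_. 0" "\<lambda>_. 1" "\<lambda>_. 0" "\<lambda>_. 1" "\<lambda>_. 0"])
      (simp_all add: mero U_def germs)
  moreover have "meromorphic_coefficients D V"
    by (rule meromorphic_coefficients_bilinear[of c _ "\<lambda>_. 0" "\<lambda>_. 0" "\<lambda>_. 1" "\<lambda>_. 1" "\<lambda>_. 0"])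
      (simp_all add: mero mero_c V_def germs)
  moreover have "meromorphic_coefficients D Y"
    by (rule meromorphic_coefficients_bilinear[of "\<lambda>x. - c x" _ "\<lambda>_. 0" "\<lambda>_. 1" "\<lambda>_. 0" "\<lambda>x. - q x" "\<lambda>_. 1"])
      (simp_all add: mero mero_c mero_neg neg Y_def germs)
  moreover have "meromorphic_coefficients D Z"
    by (rule meromorphic_coefficients_bilinear[of "\<lambda>x. - q x" _ "\<lambda>_. 1" "\<lambda>_. 0" "\<lambda>_. 0" "\<lambda>_. 1" "\<lambda>_. 0"])
      (simp_all add: mero mero_neg neg Z_def germs)
  moreover have "mutually_inverse (U z, V z) (Y z, Z z) \<and>
      in_coordinates fls_deriv (bg_D7_system \<eta> \<kappa>0 q z) (U z, V z) (Y z, Z z) = ham_D7_system \<eta> \<kappa>0 \<kappa> z"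
    if z: "z \<in> D" for z
  proof
    show "mutually_inverse (U z, V z) (Y z, Z z)"
      unfolding U_def V_def Y_def Z_def germs by (rule shift_subst)
    note qz = q D(1) z
    define X where "X = laurent_expansion (\<lambda>x. x) z"
    define Q where "Q = laurent_expansion q z"
    have z0: "z \<noteq> 0" using D z by auto
    have m: "(\<lambda>_. a) meromorphic_on {z}" "(\<lambda>x. x) meromorphic_on {z}" for a :: complex
      by (intro meromorphic_intros)+
    note m' = m admissibleD(2,3)[OF qz]
    have const: "fls_const 2 = (2 :: complex fls)" "fls_const 4 = (4 :: complex fls)"
      "fls_const (2 * \<eta>) = 2 * fls_const \<eta>" "fls_const (2 * \<kappa>0 + 1) = 2 * fls_const \<kappa>0 + 1"
      by (simp_all only: fls_const_hom)
    have L: "laurent_expansion c z = X * (fls_deriv Q - 2 * fls_const \<eta>) / (4 * Q\<^sup>2)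
        + (2 * fls_const \<kappa>0 + 1) / (4 * Q)"
      unfolding c_def
      by (simp add: laurent_expansion_add laurent_expansion_diff laurent_expansion_mult
          laurent_expansion_divide laurent_expansion_power laurent_expansion_const m' const
          admissibleD(5)[OF qz] X_def Q_def meromorphic_intros)
    have "eventually (\<lambda>x. x \<in> D) (at z)"
      using D z by (auto simp: eventually_at_topological)
    then have "eventually (\<lambda>x. eval_dp (painleve_dp \<eta> \<kappa>0) q x = - 4 * \<kappa> * q x ^ 3) (at z)"
      by eventually_elim (rule P)
    then have "jet_germ z q (painleve_dp \<eta> \<kappa>0) = laurent_expansion (\<lambda>x. - 4 * \<kappa> * q x ^ 3) z"
      unfolding jet_germ_def by (intro laurent_expansion_cong refl)
    also have "\<dots> = fls_const (- 4 * \<kappa>) * Q ^ 3"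
      unfolding Q_def using m'
      by (simp only: laurent_expansion_mult laurent_expansion_power laurent_expansion_const
          meromorphic_intros)
    also have "fls_const (- 4 * \<kappa>) = - 4 * fls_const \<kappa>"
      by (simp only: fls_const_hom)
    finally have PQ: "Q * fls_deriv Q + X * Q * fls_deriv (fls_deriv Q) - X * (fls_deriv Q)\<^sup>2
        + 4 * (fls_const \<eta>)\<^sup>2 * X - 4 * fls_const \<eta> * (fls_const \<kappa>0 + 1) * Q = - 4 * fls_const \<kappa> * Q ^ 3"
      unfolding jet_germ_painleve_dp[OF qz] X_def Q_def .
    have X: "fls_deriv X = 1" "X \<noteq> 0" using ident_germ[of z] by (simp_all add: X_def)
    have Q: "Q \<noteq> 0" using admissibleD(4)[OF qz] by (simp add: Q_def)
    have S: "(sqrt_germ z)\<^sup>2 = X" unfolding X_def by (rule sqrt_germ_square[OF z0])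
    have H: "ham_D7_system \<eta> \<kappa>0 \<kappa> z = hamiltonian_system
        (ham_D7 (cst (fls_const \<eta>)) (cst (fls_const \<kappa>0)) (cst (fls_const \<kappa>)) (cst X) var_y var_z)"
      by (simp add: ham_D7_system_def germ_def laurent_expansion_const X_def)
    show "in_coordinates fls_deriv (bg_D7_system \<eta> \<kappa>0 q z) (U z, V z) (Y z, Z z) = ham_D7_system \<eta> \<kappa>0 \<kappa> z"
      unfolding bg_D7_system_germ[OF qz] U_def V_def Y_def Z_def germs H
        X_def[symmetric] Q_def[symmetric]
      by (rule bg_transformation[OF derivation_fls_deriv X Q fls_deriv_const fls_deriv_const S L PQ])
  qed
  ultimately show ?thesis
    unfolding birationally_equivalent_on_def by blast
qed

theorem proposition3p2:
  fixes \<eta>0 \<kappa>0 \<kappa>inf :: complex and D :: "complex set" and q :: "complex \<Rightarrow> complex"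
  assumes "\<eta>0 * \<kappa>inf \<noteq> 0"
    and "open D" and "connected D" and "D \<noteq> {}" and "0 \<notin> D"
    and "q holomorphic_on D" and "\<forall>x\<in>D. q x \<noteq> 0"
    and "painleve_III (-4 * \<kappa>inf) (4 * \<eta>0 * (\<kappa>0 + 1)) 0 (-4 * \<eta>0\<^sup>2) D q"
  shows
    "(\<forall>U y z y3 z3. open U \<and> U \<subseteq> D \<and> y holomorphic_on U \<and> z holomorphic_on U \<and>
        (\<forall>x\<in>U. z x \<noteq> 0) \<and>
        (\<forall>x\<in>U. y3 x = z x + q x) \<and>
        (\<forall>x\<in>U. z3 x = y x * z x + x * (deriv q x - 2 * \<eta>0) / (4 * (q x)\<^sup>2)
                        + (2 * \<kappa>0 + 1) / (4 * q x)) \<longrightarrow>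
        ((\<forall>x\<in>U. deriv y3 x = deriv (\<lambda>w. ham_D7 \<eta>0 \<kappa>0 \<kappa>inf x (y3 x) w) (z3 x) \<and>
                 deriv z3 x = - deriv (\<lambda>w. ham_D7 \<eta>0 \<kappa>0 \<kappa>inf x w (z3 x)) (y3 x))
         \<longleftrightarrow>
         (\<forall>x\<in>U. deriv y x = bg_rhs_y \<eta>0 \<kappa>0 (csqrt x) x (q x) (deriv q x) (y x) (z x) \<and>
                 deriv z x = bg_rhs_z \<eta>0 \<kappa>0 x (q x) (deriv q x) (y x) (z x))))
     \<and>
     bureau_guillot D (painleve_III (-4 * \<kappa>inf) (4 * \<eta>0 * (\<kappa>0 + 1)) 0 (-4 * \<eta>0\<^sup>2) D)
       (ham_D7_system \<eta>0 \<kappa>0 \<kappa>inf) (bg_D7_system \<eta>0 \<kappa>0) q"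
proof (intro conjI allI impI)
  fix U y z y3 z3
  assume *: "open U \<and> U \<subseteq> D \<and> y holomorphic_on U \<and> z holomorphic_on U \<and>
        (\<forall>x\<in>U. z x \<noteq> 0) \<and>
        (\<forall>x\<in>U. y3 x = z x + q x) \<and>
        (\<forall>x\<in>U. z3 x = y x * z x + x * (deriv q x - 2 * \<eta>0) / (4 * (q x)\<^sup>2)
                        + (2 * \<kappa>0 + 1) / (4 * q x))"
  show "(\<forall>x\<in>U. deriv y3 x = deriv (\<lambda>w. ham_D7 \<eta>0 \<kappa>0 \<kappa>inf x (y3 x) w) (z3 x) \<and>
                 deriv z3 x = - deriv (\<lambda>w. ham_D7 \<eta>0 \<kappa>0 \<kappa>inf x w (z3 x)) (y3 x))
         \<longleftrightarrow>
         (\<forall>x\<in>U. deriv y x = bg_rhs_y \<eta>0 \<kappa>0 (csqrt x) x (q x) (deriv q x) (y x) (z x) \<and>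
                 deriv z x = bg_rhs_z \<eta>0 \<kappa>0 x (q x) (deriv q x) (y x) (z x))"
    using * by (intro ball_cong refl solutions_correspond[where D = D and q = q])
      (use assms in auto)
next
  have q: "q \<in> admissible D" using assms by (simp add: admissible_def)
  have nz: "\<eta>0 \<noteq> 0" "\<kappa>inf \<noteq> 0" using assms(1) by auto
  show "bureau_guillot D (painleve_III (-4 * \<kappa>inf) (4 * \<eta>0 * (\<kappa>0 + 1)) 0 (-4 * \<eta>0\<^sup>2) D)
       (ham_D7_system \<eta>0 \<kappa>0 \<kappa>inf) (bg_D7_system \<eta>0 \<kappa>0) q"
    unfolding bureau_guillot_def
    using bg_birational[OF assms(2,5) q painleve_imp_conditions(1)[OF assms(2,4,5) q nz(2) assms(8)]]
      bg_coefficients_in_q[OF assms(2,4,5)]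
      bg_regularising_condition[OF assms(2-5) nz]
    by blast
qed

end
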